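(* Let $G$ be an undirected, unweighted, connected graph with $n$ nodes that contains at least one cycle, and let $g$ denote its girth (the length of a shortest cycle of $G$). Let $k\ge 2$ be any integer. Then there exists an algorithm that runs in time $O\!\left(n^{2-1/k}(\log n)^{1-1/k}\right)$ and finds a cycle in $G$ with length at most $2\left\lceil \frac{g}{2}\right\rceil + 2\left\lceil\frac{g}{2(k-1)}\right\rceil$.
   Context: Graphs are given in adjacency list representation. Throughout, all graphs are assumed undirected, unweighted, connected and to contain at least one cycle. $\log x$ denotes the natural logarithm. *)

theory Defs
  imports
    Complex_Main
    "HOL-Library.Landau_Symbols"
    "Graph_Theory.Graph_Theory"
begin

text \<open>
  A finite simple undirected graph is a \<^locale>\<open>pair_graph\<close>: finite, loop-free, without parallel
  arcs, and every edge is present as two opposite arcs. The library's notion of cycle is the one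
  for digraphs, which admits the closed walk \<open>u, v, u\<close>. In a simple graph this is the only
  cycle of length below 3, so the cycles of the undirected graph are those of length at least 3.
\<close>

definition undirected_cycle :: "'a pair_pre_digraph \<Rightarrow> ('a \<times> 'a) list \<Rightarrow> bool" where
  "undirected_cycle G p \<longleftrightarrow> pre_digraph.cycle (with_proj G) p \<and> length p \<ge> 3"

text \<open>Meaningful only if \<open>G\<close> contains a cycle.\<close>

definition girth :: "'a pair_pre_digraph \<Rightarrow> nat" where
  "girth G = (LEAST l. \<exists>p. undirected_cycle G p \<and> length p = l)"

text \<open>The order of the neighbours within each list is arbitrary.\<close>

definition adjacency_lists :: "nat pair_pre_digraph \<Rightarrow> nat list list \<Rightarrow> bool" where
  "adjacency_lists G adj \<longleftrightarrow>
     pverts G = {..<length adj} \<and>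
     (\<forall>v<length adj. distinct (adj ! v) \<and> set (adj ! v) = {w. (v, w) \<in> parcs G})"

text \<open>
  Algorithms are programs of a word RAM: a fixed while-program over finitely many registers and
  finitely many randomly addressable arrays. All numbers that occur during a run have to be words,
  that is, smaller than a bound \<open>W\<close>; a program that computes a larger number gets stuck.
  Every operation on words takes unit time. Subtraction is truncated, and division by zero yields
  zero.
\<close>

type_synonym vname = string
type_synonym aname = string

record state =
  regs :: "vname \<Rightarrow> nat"
  arrs :: "aname \<Rightarrow> nat \<Rightarrow> nat"

datatype aexp =
    N nat
  | V vname
  | Read aname aexp
  | Plus aexp aexp
  | Minus aexp aexp
  | Times aexp aexp
  | Div aexp aexp

datatype bexp =
    Less aexp aexp
  | Eq aexp aexp
  | Not bexp
  | And bexp bexp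

datatype com =
    Skip
  | Assign vname aexp
  | Write aname aexp aexp \<comment> \<open>array, index, value\<close>
  | Seq com com
  | If bexp com com
  | While bexp com

fun aval :: "aexp \<Rightarrow> state \<Rightarrow> nat" where
  "aval (N m) s = m"
| "aval (V x) s = regs s x"
| "aval (Read a e) s = arrs s a (aval e s)"
| "aval (Plus e f) s = aval e s + aval f s"
| "aval (Minus e f) s = aval e s - aval f s"
| "aval (Times e f) s = aval e s * aval f s"
| "aval (Div e f) s = aval e s div aval f s"

fun bval :: "bexp \<Rightarrow> state \<Rightarrow> bool" where
  "bval (Less e f) s \<longleftrightarrow> aval e s < aval f s"
| "bval (Eq e f) s \<longleftrightarrow> aval e s = aval f s"
| "bval (Not b) s \<longleftrightarrow> \<not> bval b s"
| "bval (And b c) s \<longleftrightarrow> bval b s \<and> bval c s"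

text \<open>All intermediate results, array indices included, are words.\<close>

fun afits :: "nat \<Rightarrow> aexp \<Rightarrow> state \<Rightarrow> bool" where
  "afits W (N m) s \<longleftrightarrow> m < W"
| "afits W (V x) s \<longleftrightarrow> regs s x < W"
| "afits W (Read a e) s \<longleftrightarrow> afits W e s \<and> aval (Read a e) s < W"
| "afits W (Plus e f) s \<longleftrightarrow> afits W e s \<and> afits W f s \<and> aval (Plus e f) s < W"
| "afits W (Minus e f) s \<longleftrightarrow> afits W e s \<and> afits W f s"
| "afits W (Times e f) s \<longleftrightarrow> afits W e s \<and> afits W f s \<and> aval (Times e f) s < W"
| "afits W (Div e f) s \<longleftrightarrow> afits W e s \<and> afits W f s"

fun bfits :: "nat \<Rightarrow> bexp \<Rightarrow> state \<Rightarrow> bool" where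
  "bfits W (Less e f) s \<longleftrightarrow> afits W e s \<and> afits W f s"
| "bfits W (Eq e f) s \<longleftrightarrow> afits W e s \<and> afits W f s"
| "bfits W (Not b) s \<longleftrightarrow> bfits W b s"
| "bfits W (And b c) s \<longleftrightarrow> bfits W b s \<and> bfits W c s"

fun acost :: "aexp \<Rightarrow> nat" where
  "acost (N m) = 1"
| "acost (V x) = 1"
| "acost (Read a e) = acost e + 1"
| "acost (Plus e f) = acost e + acost f + 1"
| "acost (Minus e f) = acost e + acost f + 1"
| "acost (Times e f) = acost e + acost f + 1"
| "acost (Div e f) = acost e + acost f + 1"

fun bcost :: "bexp \<Rightarrow> nat" where
  "bcost (Less e f) = acost e + acost f + 1"
| "bcost (Eq e f) = acost e + acost f + 1"
| "bcost (Not b) = bcost b + 1"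
| "bcost (And b c) = bcost b + bcost c + 1"

text \<open>
  \<open>exec W P s t s'\<close>: started in \<open>s\<close> with word bound \<open>W\<close>, the program \<open>P\<close> terminates after exactly
  \<open>t\<close> time units in \<open>s'\<close>.
\<close>

inductive exec :: "nat \<Rightarrow> com \<Rightarrow> state \<Rightarrow> nat \<Rightarrow> state \<Rightarrow> bool" for W where
  Skip: "exec W Skip s 1 s"
| Assign: "afits W e s \<Longrightarrow>
    exec W (Assign x e) s (acost e + 1) (s\<lparr>regs := (regs s)(x := aval e s)\<rparr>)"
| Write: "afits W i s \<Longrightarrow> afits W e s \<Longrightarrow>
    exec W (Write a i e) s (acost i + acost e + 1)
      (s\<lparr>arrs := (arrs s)(a := (arrs s a)(aval i s := aval e s))\<rparr>)"
| Seq: "exec W P s t s' \<Longrightarrow> exec W Q s' t' s'' \<Longrightarrow> exec W (Seq P Q) s (t + t') s''"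
| IfTrue: "bfits W b s \<Longrightarrow> bval b s \<Longrightarrow> exec W P s t s' \<Longrightarrow>
    exec W (If b P Q) s (bcost b + t + 1) s'"
| IfFalse: "bfits W b s \<Longrightarrow> \<not> bval b s \<Longrightarrow> exec W Q s t s' \<Longrightarrow>
    exec W (If b P Q) s (bcost b + t + 1) s'"
| WhileFalse: "bfits W b s \<Longrightarrow> \<not> bval b s \<Longrightarrow> exec W (While b P) s (bcost b + 1) s"
| WhileTrue: "bfits W b s \<Longrightarrow> bval b s \<Longrightarrow> exec W P s t s' \<Longrightarrow>
    exec W (While b P) s' t' s'' \<Longrightarrow> exec W (While b P) s (bcost b + t + t' + 1) s''"

lemma exec_deterministic:
  "exec W P s t s' \<Longrightarrow> exec W P s u s'' \<Longrightarrow> u = t \<and> s'' = s'"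
proof (induction arbitrary: u s'' rule: exec.induct)
  case (Seq P s t s' Q t' s'')
  from Seq.prems show ?case by cases (use Seq.IH in blast)
next
  case (WhileTrue b s P t s' t' s'')
  from WhileTrue.prems show ?case by cases (use WhileTrue in blast)+
qed (erule exec.cases; blast)+

text \<open>
  The adjacency lists are given in memory, stored one after the other: register \<open>n\<close> holds the
  number of nodes, and the neighbours of \<open>v\<close> are the entries of array \<open>adj\<close> from index \<open>off[v]\<close>
  up to, but excluding, index \<open>off[v + 1]\<close>. All other memory is initially zero.
\<close>

definition input_state :: "nat list list \<Rightarrow> state" where
  "input_state adj =
     \<lparr>regs = (\<lambda>_. 0)(''n'' := length adj),
      arrs = (\<lambda>_ _. 0)
        (''off'' := (\<lambda>v. if v \<le> length adj then length (concat (take v adj)) else 0),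
         ''adj'' := (\<lambda>i. if i < length (concat adj) then concat adj ! i else 0))\<rparr>"

text \<open>
  The output is the list of the nodes of the cycle in cyclic order, in the first \<open>len\<close> entries of
  array \<open>out\<close>.
\<close>

definition output_nodes :: "state \<Rightarrow> nat list" where
  "output_nodes s = map (arrs s ''out'') [0..<regs s ''len'']"

definition closed_arcs :: "'a list \<Rightarrow> ('a \<times> 'a) list" where
  "closed_arcs vs = zip vs (rotate1 vs)"

end

theory Submission
  imports Defs
begin

text \<open>
  Let \<open>s\<close> be about \<open>(n log n)^(1/k)\<close> and \<open>M = s^(k-1)\<close>. Every search stops at the first non-tree arc, so it takes time
  linear in the number of visited vertices, and it yields a cycle of length at most \<open>2\<lceil>g/2\<rceil> + 2d\<close> if it
  starts at distance \<open>d\<close> from a shortest cycle \<open>C\<close>. First the search from every vertex \<open>v\<close> is cut off after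
  \<open>s\<close> vertices; let \<open>rad v\<close> be the distance of the last one (0 if a cycle was found). A greedy hitting set of the
  resulting balls has at most \<open>M\<close> elements, from which unlimited searches are run; this settles the case
  that some \<open>v\<close> on \<open>C\<close> has \<open>rad v \<le> r = \<lceil>g/(2(k-1))\<rceil>\<close>. Finally, the search from every \<open>v\<close> is repeated up to \<open>M\<close>
  vertices, where vertices \<open>u\<close> with \<open>rad u < rad v\<close> are not expanded. If \<open>rad > r\<close> on \<open>C\<close> and \<open>v\<close> minimizes
  \<open>rad\<close> on \<open>C\<close>, then \<open>C\<close> survives in this restricted graph and all its balls of radius \<open>r\<close> have fewer than \<open>s\<close>
  elements; hence the ball of radius \<open>(k-1)r \<ge> g/2\<close> around \<open>v\<close> has fewer than \<open>M\<close> elements and the search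
  finds a cycle of length at most \<open>2\<lceil>g/2\<rceil>\<close>.
\<close>

section \<open>Weakest preconditions with running time\<close>

text \<open>The parameters come from a balance. A greedy choice hits at least a fraction s/n of the
  balls that are left, so M choices leave at most n (1 - s/n)^M \<le> n exp(-s M/n) of them. This is
  below 1 once s M = s^k reaches about n log n, which is the origin of the logarithm in the time
  bound; the n searches up to M vertices and the M unlimited searches then both cost O(n M). The
  radius r depends on the unknown girth, so the program can neither compute it nor use it as a
  threshold. In the restricted searches \<open>rad v\<close> of the root takes its place: the
  analysis needs only that one root on C has minimal \<open>rad\<close> there. The time of a search
  must depend on the visited vertices alone. Scanned arcs are therefore charged to vertices, marks
  are time stamps that never have to be erased, and the n by n table of memberships relies on memory
  being zero at the start.\<close>

definition wp :: "nat \<Rightarrow> com \<Rightarrow> (nat \<Rightarrow> state \<Rightarrow> bool) \<Rightarrow> state \<Rightarrow> bool" where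
  "wp W c Q s \<longleftrightarrow> (\<exists>t s'. exec W c s t s' \<and> Q t s')"

notation Assign (infix \<open>::=\<close> 61)
notation Write (\<open>_\<langle>_\<rangle> ::= _\<close> [61, 0, 61] 61)
notation Seq (infixr \<open>;;\<close> 60)

inductive_cases exec_SkipE: "exec W Skip s t s'"
inductive_cases exec_AssignE: "exec W (x ::= e) s t s'"
inductive_cases exec_WriteE: "exec W (a\<langle>i\<rangle> ::= e) s t s'"
inductive_cases exec_SeqE: "exec W (P ;; R) s t s'"
inductive_cases exec_IfE: "exec W (If b P R) s t s'"

text \<open>As equivalences, these rules let the simplifier execute loop-free code symbolically: the
  word bounds become side conditions, and the exact cost arrives as the first argument of the
  postcondition.\<close>

lemma wp_Skip [simp]: "wp W Skip Q s \<longleftrightarrow> Q 1 s"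
  unfolding wp_def by (metis exec.Skip exec_SkipE)

lemma wp_Assign [simp]:
  "wp W (x ::= e) Q s \<longleftrightarrow> afits W e s \<and> Q (acost e + 1) (s\<lparr>regs := (regs s)(x := aval e s)\<rparr>)"
  unfolding wp_def by (metis exec.Assign exec_AssignE)

lemma wp_Write [simp]:
  "wp W (a\<langle>i\<rangle> ::= e) Q s \<longleftrightarrow> afits W i s \<and> afits W e s \<and>
    Q (acost i + acost e + 1) (s\<lparr>arrs := (arrs s)(a := (arrs s a)(aval i s := aval e s))\<rparr>)"
  unfolding wp_def by (metis exec.Write exec_WriteE)

lemma wp_Seq [simp]: "wp W (P ;; R) Q s \<longleftrightarrow> wp W P (\<lambda>t. wp W R (\<lambda>t'. Q (t + t'))) s"
  unfolding wp_def by (blast intro: exec.Seq elim: exec_SeqE)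

lemma wp_If [simp]:
  "wp W (If b P R) Q s \<longleftrightarrow> bfits W b s \<and>
    (bval b s \<longrightarrow> wp W P (\<lambda>t. Q (bcost b + t + 1)) s) \<and>
    (\<not> bval b s \<longrightarrow> wp W R (\<lambda>t. Q (bcost b + t + 1)) s)"
proof (cases "bval b s")
  case True
  then have "exec W (If b P R) s t s' \<longleftrightarrow>
      (\<exists>t'. t = bcost b + t' + 1 \<and> bfits W b s \<and> exec W P s t' s')" for t s'
    by (auto intro: exec.IfTrue[simplified] elim: exec_IfE)
  with True show ?thesis unfolding wp_def by auto
next
  case False
  then have "exec W (If b P R) s t s' \<longleftrightarrow>
      (\<exists>t'. t = bcost b + t' + 1 \<and> bfits W b s \<and> exec W R s t' s')" for t s'
    by (auto intro: exec.IfFalse[simplified] elim: exec_IfE)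
  with False show ?thesis unfolding wp_def by auto
qed

lemma wp_mono: "wp W c Q s \<Longrightarrow> (\<And>t s'. Q t s' \<Longrightarrow> R t s') \<Longrightarrow> wp W c R s"
  unfolding wp_def by blast

section \<open>Registers and arrays that a program leaves unchanged\<close>

fun mod_regs :: "com \<Rightarrow> vname set" where
  "mod_regs (x ::= e) = {x}"
| "mod_regs (P ;; R) = mod_regs P \<union> mod_regs R"
| "mod_regs (If b P R) = mod_regs P \<union> mod_regs R"
| "mod_regs (While b P) = mod_regs P"
| "mod_regs _ = {}"

fun mod_arrs :: "com \<Rightarrow> aname set" where
  "mod_arrs (a\<langle>i\<rangle> ::= e) = {a}"
| "mod_arrs (P ;; R) = mod_arrs P \<union> mod_arrs R"
| "mod_arrs (If b P R) = mod_arrs P \<union> mod_arrs R"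
| "mod_arrs (While b P) = mod_arrs P"
| "mod_arrs _ = {}"

definition frame :: "vname set \<Rightarrow> aname set \<Rightarrow> state \<Rightarrow> state \<Rightarrow> bool" where
  "frame X Y s s' \<longleftrightarrow> (\<forall>x. x \<notin> X \<longrightarrow> regs s' x = regs s x) \<and> (\<forall>a. a \<notin> Y \<longrightarrow> arrs s' a = arrs s a)"

lemma frame_refl: "frame X Y s s"
  unfolding frame_def by simp

lemma frame_trans: "frame X Y s s' \<Longrightarrow> frame X Y s' s'' \<Longrightarrow> frame X Y s s''"
  unfolding frame_def by simp

lemma frame_mono: "frame X Y s s' \<Longrightarrow> X \<subseteq> X' \<Longrightarrow> Y \<subseteq> Y' \<Longrightarrow> frame X' Y' s s'"
  unfolding frame_def by blast

lemma frame_regs: "frame X Y s s' \<Longrightarrow> x \<notin> X \<Longrightarrow> regs s' x = regs s x"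
  and frame_arrs: "frame X Y s s' \<Longrightarrow> a \<notin> Y \<Longrightarrow> arrs s' a = arrs s a"
  unfolding frame_def by auto

lemma exec_frame: "exec W c s t s' \<Longrightarrow> frame (mod_regs c) (mod_arrs c) s s'"
proof (induction rule: exec.induct)
  case (Seq P s t s' Q t' s'')
  then show ?case by (auto intro: frame_trans frame_mono)
next
  case (WhileTrue b s P t s' t' s'')
  then show ?case by (auto intro: frame_trans)
qed (auto simp: frame_def)

text \<open>The syntactic footprint of \<open>c\<close> yields everything that stays unchanged, so
  specifications have to mention only what a program computes.\<close>

lemma wp_frame:
  assumes "wp W c Q s"
    and "\<And>t s'. Q t s' \<Longrightarrow> frame (mod_regs c) (mod_arrs c) s s' \<Longrightarrow> R t s'"
  shows "wp W c R s"
  using assms exec_frame unfolding wp_def by blast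

text \<open>The potential \<open>f\<close> bounds the running time of all remaining iterations.\<close>

lemma wp_While:
  assumes I0: "I s"
    and fits: "\<And>s'. I s' \<Longrightarrow> frame (mod_regs P) (mod_arrs P) s s' \<Longrightarrow> bfits W b s'"
    and step: "\<And>s'. I s' \<Longrightarrow> bval b s' \<Longrightarrow> frame (mod_regs P) (mod_arrs P) s s' \<Longrightarrow>
        wp W P (\<lambda>t s''. I s'' \<and> t + bcost b + 1 + f s'' \<le> f s') s'"
    and exit: "\<And>t s'. I s' \<Longrightarrow> \<not> bval b s' \<Longrightarrow> frame (mod_regs P) (mod_arrs P) s s' \<Longrightarrow>
        t + f s' \<le> f s + bcost b + 1 \<Longrightarrow> Q t s'"
  shows "wp W (While b P) Q s"
proof -
  \<comment> \<open>The last, failing evaluation of the guard is not paid for by \<open>f\<close>;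
    this is the extra \<open>bcost b + 1\<close>. The frame is kept relative to the initial
    \<open>s\<close>, not to the previous iteration.\<close>
  have "\<exists>t s''. exec W (While b P) s' t s'' \<and> I s'' \<and> \<not> bval b s'' \<and> t + f s'' \<le> f s' + bcost b + 1"
    if "I s'" "frame (mod_regs P) (mod_arrs P) s s'" for s'
    using that
  proof (induction "f s'" arbitrary: s' rule: less_induct)
    case less
    show ?case
    proof (cases "bval b s'")
      case False
      with less fits show ?thesis by (intro exI[of _ "bcost b + 1"] exI[of _ s'] conjI exec.WhileFalse) auto
    next
      case True
      from step[OF less.prems(1) True less.prems(2)]
      obtain t1 s1 where 1: "exec W P s' t1 s1" "I s1" "t1 + bcost b + 1 + f s1 \<le> f s'"
        unfolding wp_def by blast
      have fr: "frame (mod_regs P) (mod_arrs P) s s1"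
        using frame_trans[OF less.prems(2) exec_frame[OF 1(1)]] .
      from 1(3) have "f s1 < f s'" by simp
      from less.hyps[OF this 1(2) fr] obtain t2 s2 where
        2: "exec W (While b P) s1 t2 s2" "I s2" "\<not> bval b s2" "t2 + f s2 \<le> f s1 + bcost b + 1" by blast
      have "exec W (While b P) s' (bcost b + t1 + t2 + 1) s2"
        using exec.WhileTrue[OF fits[OF less.prems] True 1(1) 2(1)] .
      with 1 2 show ?thesis by (intro exI[of _ "bcost b + t1 + t2 + 1"] exI[of _ s2]) auto
    qed
  qed
  from this[OF I0 frame_refl] obtain t s' where
    *: "exec W (While b P) s t s'" "I s'" "\<not> bval b s'" "t + f s' \<le> f s + bcost b + 1" by blast
  have "frame (mod_regs P) (mod_arrs P) s s'" using exec_frame[OF *(1)] by simp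
  with * exit show ?thesis unfolding wp_def by blast
qed

section \<open>Balls and cycles in adjacency lists\<close>

locale adjacency =
  fixes adj :: "nat list list"
  assumes distinct_adj: "v < length adj \<Longrightarrow> distinct (adj ! v)"
    and adj_sym: "u < length adj \<Longrightarrow> v \<in> set (adj ! u) \<Longrightarrow> v < length adj \<and> u \<in> set (adj ! v)"
    and adj_irrefl: "u < length adj \<Longrightarrow> u \<notin> set (adj ! u)"
begin

definition vcycle :: "nat list \<Rightarrow> bool" where
  "vcycle cs \<longleftrightarrow> 3 \<le> length cs \<and> distinct cs \<and> set cs \<subseteq> {..<length adj} \<and>
     (\<forall>i<length cs. cs ! (Suc i mod length cs) \<in> set (adj ! (cs ! i)))"

text \<open>The ball in the graph in which only the vertices satisfying \<open>P\<close> have outgoing arcs.\<close>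

fun ball :: "(nat \<Rightarrow> bool) \<Rightarrow> nat \<Rightarrow> nat \<Rightarrow> nat set" where
  "ball P v 0 = {v}"
| "ball P v (Suc d) = insert v (if P v then (\<Union>u\<in>set (adj ! v). ball P u d) else {})"

lemma self_in_ball: "v \<in> ball P v d"
  by (cases d) auto

lemma ball_subset_vertices: "v < length adj \<Longrightarrow> ball P v d \<subseteq> {..<length adj}"
  by (induction d arbitrary: v) (auto dest: adj_sym split: if_splits)

lemma finite_ball: "v < length adj \<Longrightarrow> finite (ball P v d)"
  by (rule finite_subset[OF ball_subset_vertices finite_lessThan])

text \<open>The recursion of \<open>ball\<close> prolongs walks at the centre, whereas a search
  prolongs them at the far end.\<close>

lemma ball_step: "u \<in> ball P v d \<Longrightarrow> P u \<Longrightarrow> w \<in> set (adj ! u) \<Longrightarrow> w \<in> ball P v (Suc d)"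
proof (induction d arbitrary: v)
  case (Suc d)
  then show ?case
    by (cases "u = v") (force simp: self_in_ball split: if_splits simp del: ball.simps(2) simp add: ball.simps(2)[of P v])+
qed auto

lemma ball_Suc_mono: "ball P v d \<subseteq> ball P v (Suc d)"
proof (induction d arbitrary: v)
  case (Suc d)
  show ?case using Suc.IH by (subst (1 2) ball.simps) (auto split: if_splits simp del: ball.simps)
qed auto

lemma ball_mono: "d \<le> d' \<Longrightarrow> ball P v d \<subseteq> ball P v d'"
  using ball_Suc_mono by (rule lift_Suc_mono_le)

lemma ball_subset_ball_True: "ball P v d \<subseteq> ball (\<lambda>_. True) v d"
proof (induction d arbitrary: v)
  case (Suc d)
  then show ?case by (auto split: if_splits)
qed auto

text \<open>Turns a ball of \<open>v\<close> that contains \<open>z\<close> into a search from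
  \<open>z\<close> that starts close to \<open>v\<close>. Restricted balls lack this symmetry, since
  the end of a walk need not satisfy \<open>P\<close>.\<close>

lemma ball_True_sym:
  assumes "v < length adj" "u \<in> ball (\<lambda>_. True) v d"
  shows "v \<in> ball (\<lambda>_. True) u d"
  using assms
proof (induction d arbitrary: v)
  case (Suc d)
  show ?case
  proof (cases "u = v")
    case False
    then obtain w where w: "w \<in> set (adj ! v)" "u \<in> ball (\<lambda>_. True) w d"
      using Suc.prems by auto
    with Suc.prems adj_sym have "w < length adj" "v \<in> set (adj ! w)" by blast+
    with Suc.IH w(2) show ?thesis by (blast intro: ball_step)
  qed (simp add: self_in_ball)
qed auto

text \<open>A forbidden vertex can only be the end of a walk. Hence a walk is cut after
  \<open>m\<close> steps, or else, if it meets a forbidden vertex by then, at the vertex just before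
  its end; the one remaining arc is then covered by \<open>0 < r\<close>. The second piece is
  relaxed to the unrestricted ball, whose size is known.\<close>

lemma ball_add:
  assumes "w \<in> ball P v (m + r)" "P v" "0 < r"
  shows "\<exists>u\<in>ball P v m. P u \<and> w \<in> ball (\<lambda>_. True) u r"
  using assms(1,2)
proof (induction m arbitrary: v)
  case 0
  then show ?case using ball_subset_ball_True by auto
next
  case (Suc m)
  show ?case
  proof (cases "w = v")
    case True
    then show ?thesis using Suc.prems self_in_ball by blast
  next
    case False
    then obtain y where y: "y \<in> set (adj ! v)" "w \<in> ball P y (m + r)"
      using Suc.prems by (auto split: if_splits)
    show ?thesis
    proof (cases "P y")
      case True
      from Suc.IH[OF y(2) True] obtain u where
        "u \<in> ball P y m" "P u" "w \<in> ball (\<lambda>_. True) u r" by blast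
      with y(1) Suc.prems(2) show ?thesis by auto
    next
      case False
      with y(2) have "w = y" by (cases "m + r") auto
      with y(1) have "w \<in> ball (\<lambda>_. True) v (Suc 0)" by auto
      then have "w \<in> ball (\<lambda>_. True) v r" using ball_mono[of "Suc 0" r] \<open>0 < r\<close> by (meson Suc_leI subsetD)
      with Suc.prems(2) show ?thesis using self_in_ball by blast
    qed
  qed
qed

text \<open>Every \<open>r\<close> further steps multiply the size by at most \<open>b\<close>. The
  bound \<open>b\<close> is required around allowed vertices only, which is what the restriction of
  the graph is for.\<close>

lemma card_ball_mult:
  assumes "v < length adj" "P v" "0 < r"
    and small: "\<And>u. u < length adj \<Longrightarrow> P u \<Longrightarrow> card (ball (\<lambda>_. True) u r) \<le> b"
  shows "card (ball P v (j * r)) \<le> b ^ j"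
proof (induction j)
  case (Suc j)
  let ?U = "{u \<in> ball P v (j * r). P u}"
  have U: "?U \<subseteq> {..<length adj}" using ball_subset_vertices[OF assms(1)] by auto
  have fin: "finite ?U" using U finite_subset by blast
  have "ball P v (Suc j * r) \<subseteq> (\<Union>u\<in>?U. ball (\<lambda>_. True) u r)"
    using ball_add[of _ P v "j * r" r] assms by (auto simp: add.commute)
  then have "card (ball P v (Suc j * r)) \<le> card (\<Union>u\<in>?U. ball (\<lambda>_. True) u r)"
    using fin U by (intro card_mono finite_UN_I finite_ball) auto
  also have "\<dots> \<le> (\<Sum>u\<in>?U. card (ball (\<lambda>_. True) u r))" using fin by (rule card_UN_le)
  also have "\<dots> \<le> (\<Sum>u\<in>?U. b)" using U small by (intro sum_mono) auto
  also have "\<dots> = card ?U * b" by simp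
  also have "\<dots> \<le> b ^ j * b"
    using Suc card_mono[of "ball P v (j * r)" ?U] finite_ball[OF assms(1)]
    by (intro mult_right_mono) auto
  finally show ?case by (simp add: mult.commute)
qed auto

text \<open>The two bounds come from walking around the cycle in its two directions; the smaller one
  never exceeds half the length.\<close>

lemma vcycle_nth_in_ball:
  assumes "vcycle cs" "\<And>c. c \<in> set cs \<Longrightarrow> P c" "i < length cs"
  shows "cs ! i \<in> ball P (cs ! 0) i" and "cs ! i \<in> ball P (cs ! 0) (length cs - i)"
proof -
  let ?g = "length cs"
  have E: "cs ! (Suc i mod ?g) \<in> set (adj ! (cs ! i))" if "i < ?g" for i
    using assms(1) that unfolding vcycle_def by blast
  have V: "cs ! i < length adj" if "i < ?g" for i
    using assms(1) that nth_mem unfolding vcycle_def by blast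
  show "cs ! i \<in> ball P (cs ! 0) i"
    using assms(3)
  proof (induction i)
    case (Suc i)
    then have "cs ! Suc i \<in> set (adj ! (cs ! i))" using E[of i] by simp
    with Suc assms(2)[of "cs ! i"] show ?case by (intro ball_step[of "cs ! i"]) auto
  qed auto
  \<comment> \<open>Backwards walk: the induction descends from the last vertex and reverses each
    arc of the cycle by symmetry.\<close>
  have "cs ! (?g - Suc j) \<in> ball P (cs ! 0) (Suc j)" if "j < ?g" for j
    using that
  proof (induction j)
    case 0
    then have "cs ! 0 \<in> set (adj ! (cs ! (?g - 1)))" using E[of "?g - 1"] by simp
    then have "cs ! (?g - 1) \<in> set (adj ! (cs ! 0))" using adj_sym[OF V[of "?g - 1"]] 0 by auto
    moreover have "P (cs ! 0)" using assms(2) 0 by simp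
    ultimately show ?case using ball_step[of "cs ! 0" P "cs ! 0" 0] by auto
  next
    case (Suc j)
    then have "cs ! (?g - Suc j) \<in> set (adj ! (cs ! (?g - Suc (Suc j))))"
      using E[of "?g - Suc (Suc j)"] by (simp add: Suc_diff_Suc)
    then have "cs ! (?g - Suc (Suc j)) \<in> set (adj ! (cs ! (?g - Suc j)))"
      using adj_sym[OF V[of "?g - Suc (Suc j)"]] Suc.prems by auto
    moreover have "P (cs ! (?g - Suc j))" using assms(2) Suc.prems by simp
    moreover have "cs ! (?g - Suc j) \<in> ball P (cs ! 0) (Suc j)" using Suc.IH Suc.prems by (meson Suc_lessD)
    ultimately show ?case by (blast intro: ball_step)
  qed
  from this[of "?g - Suc i"] assms(3) show "cs ! i \<in> ball P (cs ! 0) (?g - i)"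
    by (simp add: Suc_diff_Suc)
qed

lemma vcycle_rotate: "vcycle cs \<Longrightarrow> vcycle (rotate m cs)"
proof -
  assume cs: "vcycle cs"
  let ?g = "length cs"
  have "rotate m cs ! (Suc i mod ?g) \<in> set (adj ! (rotate m cs ! i))" if "i < ?g" for i
  proof -
    have "rotate m cs ! i = cs ! ((m + i) mod ?g)" using that by (rule nth_rotate)
    moreover have "rotate m cs ! (Suc i mod ?g) = cs ! ((m + Suc i mod ?g) mod ?g)"
      using that by (intro nth_rotate mod_less_divisor) linarith
    moreover have "(m + Suc i mod ?g) mod ?g = Suc ((m + i) mod ?g) mod ?g"
      by (simp add: mod_Suc_eq mod_add_right_eq)
    moreover have "(m + i) mod ?g < ?g" using that by (intro mod_less_divisor) linarith
    ultimately show ?thesis using cs unfolding vcycle_def by metis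
  qed
  with cs show ?thesis unfolding vcycle_def by auto
qed

text \<open>Distances along a cycle are measured from its entry 0, so the vertex of interest is
  moved there.\<close>

lemma vcycle_rotate_to:
  assumes "vcycle cs" "v \<in> set cs"
  obtains cs' where "vcycle cs'" "set cs' = set cs" "length cs' = length cs" "cs' ! 0 = v"
proof -
  obtain m where m: "m < length cs" "cs ! m = v" using assms(2) by (auto simp: in_set_conv_nth)
  then have "rotate m cs ! 0 = v" by (subst nth_rotate) auto
  with vcycle_rotate[OF assms(1), of m] show ?thesis by (intro that[of "rotate m cs"]) auto
qed

text \<open>
  If all arcs out of the allowed vertices of level below \<open>D\<close> are tree arcs, then a cycle of allowed
  vertices cannot lie within distance \<open>D\<close> of the source: a vertex of maximal level on it would have
  both its neighbours on the cycle as parent.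
\<close>

definition tree_below :: "(nat \<Rightarrow> bool) \<Rightarrow> nat set \<Rightarrow> nat \<Rightarrow> (nat \<Rightarrow> nat) \<Rightarrow> (nat \<Rightarrow> nat) \<Rightarrow> nat \<Rightarrow> bool" where
  "tree_below P vis src lev par D \<longleftrightarrow>
     src \<in> vis \<and> lev src = 0 \<and> par src = src \<and>
     (\<forall>u\<in>vis. u < length adj) \<and>
     (\<forall>u\<in>vis. u \<noteq> src \<longrightarrow> lev u = Suc (lev (par u))) \<and>
     (\<forall>u\<in>vis. lev u < D \<longrightarrow> P u \<longrightarrow> (\<forall>w\<in>set (adj ! u). w \<in> vis \<and> (par u = w \<or> par w = u)))"

text \<open>Arcs out of allowed vertices of level below \<open>D\<close> are tree arcs and change
  the level by exactly one. A walk of length \<open>d\<close> therefore stays among the visited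
  vertices and climbs at most \<open>d\<close> levels.\<close>

lemma tree_below_ball:
  assumes "tree_below P vis src lev par D" "u \<in> vis" "lev u + d \<le> D" "w \<in> ball P u d"
  shows "w \<in> vis \<and> lev w \<le> lev u + d"
  using assms(2-)
proof (induction d arbitrary: u)
  case (Suc d)
  show ?case
  proof (cases "w = u")
    case False
    then obtain y where y: "y \<in> set (adj ! u)" "w \<in> ball P y d" "P u"
      using Suc.prems by (auto split: if_splits)
    have yv: "y \<in> vis" "par u = y \<or> par y = u"
      using assms(1) Suc.prems y unfolding tree_below_def by auto
    have "y \<noteq> u" using y(1) Suc.prems(1) assms(1) adj_irrefl unfolding tree_below_def by auto
    have T: "x \<in> vis \<Longrightarrow> x \<noteq> src \<Longrightarrow> lev x = Suc (lev (par x))" "par src = src" "lev src = 0" for x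
      using assms(1) unfolding tree_below_def by blast+
    have "lev y \<le> Suc (lev u)"
      using yv(2) T(1)[OF yv(1)] T(1)[OF Suc.prems(1)] T(2,3) \<open>y \<noteq> u\<close>
      by (cases "y = src"; cases "u = src") auto
    with Suc.IH[OF yv(1) _ y(2)] Suc.prems(2) show ?thesis by auto
  qed (use Suc.prems in auto)
qed auto

lemma tree_below_no_cycle:
  assumes tree: "tree_below P vis src lev par D"
    and cs: "vcycle cs" "\<And>c. c \<in> set cs \<Longrightarrow> P c"
    and near: "cs ! 0 \<in> ball P src d" "d + (length cs + 1) div 2 \<le> D"
  shows False
proof -
  let ?g = "length cs"
  have g: "3 \<le> ?g" using cs(1) unfolding vcycle_def by simp
  have d0: "cs ! 0 \<in> vis" "lev (cs ! 0) \<le> d"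
    using tree_below_ball[OF tree _ _ near(1)] tree near(2) unfolding tree_below_def by auto
  have near': "cs ! i \<in> vis \<and> lev (cs ! i) \<le> d + min i (?g - i)" if "i < ?g" for i
  proof -
    have le: "lev (cs ! 0) + min i (?g - i) \<le> D" using d0(2) near(2) by (auto simp: min_def)
    have "cs ! i \<in> ball P (cs ! 0) (min i (?g - i))"
      using vcycle_nth_in_ball[OF cs that] by (auto simp: min_def)
    from tree_below_ball[OF tree d0(1) le this] d0(2) show ?thesis by auto
  qed
  have V: "cs ! i < length adj" if "i < ?g" for i
    using cs(1) that nth_mem unfolding vcycle_def by blast
  have edge: "par (cs ! i) = cs ! (Suc i mod ?g) \<or> par (cs ! (Suc i mod ?g)) = cs ! i" if i: "i < ?g" for i
  proof -
    let ?j = "Suc i mod ?g"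
    have j: "?j < ?g" using i by (intro mod_less_divisor) linarith
    have ij: "cs ! ?j \<in> set (adj ! (cs ! i))" using cs(1) i unfolding vcycle_def by blast
    then have ji: "cs ! i \<in> set (adj ! (cs ! ?j))" using adj_sym[OF V[OF i]] by blast
    \<comment> \<open>Here the rounding up in \<open>(length cs + 1) div 2\<close> matters: on an
      even cycle only the antipode of \<open>cs ! 0\<close> can have level \<open>D\<close>, on an
      odd cycle no vertex can, so one end of each arc lies strictly below \<open>D\<close>.\<close>
    have "?j = Suc i \<or> (?j = 0 \<and> Suc i = ?g)" using i by (cases "Suc i = ?g") auto
    then have "lev (cs ! i) < D \<or> lev (cs ! ?j) < D"
      using near'[OF i] near'[OF j] near(2) i j by (auto simp: min_def split: if_splits)
    moreover have "cs ! i \<in> vis" "cs ! ?j \<in> vis" "P (cs ! i)" "P (cs ! ?j)"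
      using near'[OF i] near'[OF j] cs(2) i j by auto
    ultimately show ?thesis using tree ij ji unfolding tree_below_def by blast
  qed
  let ?F = "(\<lambda>i. lev (cs ! i)) ` {..<?g}"
  have "Max ?F \<in> ?F" using g by (intro Max_in) (auto simp: lessThan_empty_iff)
  then obtain m where m: "m < ?g" and "lev (cs ! m) = Max ?F" by auto
  then have max: "lev (cs ! i) \<le> lev (cs ! m)" if "i < ?g" for i
    using that by simp
  have par_m: "par (cs ! m) = cs ! j" if j: "j < ?g" and "m \<noteq> j"
    and e: "par (cs ! m) = cs ! j \<or> par (cs ! j) = cs ! m" for j
  proof (rule ccontr)
    assume "par (cs ! m) \<noteq> cs ! j"
    with e have p: "par (cs ! j) = cs ! m" by blast
    have ne: "cs ! m \<noteq> cs ! j"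
      using cs(1) j m \<open>m \<noteq> j\<close> unfolding vcycle_def by (simp add: nth_eq_iff_index_eq)
    have "par src = src" using tree unfolding tree_below_def by blast
    with p ne have "cs ! j \<noteq> src" by metis
    then have "lev (cs ! j) = Suc (lev (par (cs ! j)))"
      using near'[OF j] tree unfolding tree_below_def by blast
    with p have "lev (cs ! j) = Suc (lev (cs ! m))" by simp
    with max[OF j] show False by simp
  qed
  define j where "j = Suc m mod ?g"
  define i where "i = (m + (?g - 1)) mod ?g"
  have jm: "j = (if Suc m = ?g then 0 else Suc m)" using m unfolding j_def by auto
  have im: "i = (if m = 0 then ?g - 1 else m - 1)"
    using m unfolding i_def by (cases m) (auto simp: mod_if)
  \<comment> \<open>Length at least 3 separates the predecessor \<open>i\<close> of \<open>m\<close>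
    from its successor \<open>j\<close>, so the parent of \<open>cs ! m\<close> would have to be two
    different vertices.\<close>
  have ij: "j < ?g" "i < ?g" "j \<noteq> m" "i \<noteq> m" "i \<noteq> j" "Suc i mod ?g = m"
    using m g unfolding jm im by auto
  have "par (cs ! m) = cs ! j" using par_m[OF ij(1)] ij edge[OF m] j_def by auto
  moreover have "par (cs ! m) = cs ! i" using par_m[OF ij(2)] ij edge[OF ij(2)] by auto
  ultimately show False using cs(1) ij unfolding vcycle_def by (simp add: nth_eq_iff_index_eq)
qed

end

section \<open>Breadth-first search that stops at the first non-tree arc\<close>

context adjacency
begin

text \<open>
  The first \<open>qt\<close> entries of \<open>q\<close> are the visited vertices in the order of discovery, the first \<open>qh\<close>
  of which have been dequeued. \<open>x\<close> is the last dequeued vertex and \<open>rest\<close> the part of its adjacency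
  list that still has to be scanned. Vertices with \<open>rad u < thr\<close> are visited, but not expanded.
\<close>

definition bfs_inv :: "(nat \<Rightarrow> nat) \<Rightarrow> nat \<Rightarrow> nat \<Rightarrow> (nat \<Rightarrow> nat) \<Rightarrow> (nat \<Rightarrow> nat) \<Rightarrow> (nat \<Rightarrow> nat) \<Rightarrow>
    nat \<Rightarrow> nat \<Rightarrow> nat \<Rightarrow> nat list \<Rightarrow> bool" where
  "bfs_inv rad thr src q lev par qh qt x rest \<longleftrightarrow>
     0 < qt \<and> qh \<le> qt \<and> q 0 = src \<and> (\<forall>j<qt. q j < length adj) \<and> inj_on q {..<qt} \<and>
     lev src = 0 \<and> par src = src \<and>
     (\<forall>j<qt. 0 < j \<longrightarrow> (\<exists>i<qh. i < j \<and> par (q j) = q i \<and> lev (q j) = Suc (lev (q i)) \<and>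
        q j \<in> set (adj ! q i) \<and> thr \<le> rad (q i))) \<and>
     (\<forall>i j. i \<le> j \<longrightarrow> j < qt \<longrightarrow> lev (q i) \<le> lev (q j)) \<and>
     (qh = 0 \<longrightarrow> qt = 1 \<and> rest = []) \<and>
     (0 < qh \<longrightarrow> x = q (qh - 1)) \<and> (0 < qh \<longrightarrow> lev (q (qt - 1)) \<le> Suc (lev x)) \<and>
     (\<forall>j<qh. thr \<le> rad (q j) \<longrightarrow> (\<forall>w\<in>set (adj ! q j).
        (Suc j = qh \<and> w \<in> set rest) \<or> (w \<in> q ` {..<qt} \<and> (par (q j) = w \<or> par w = q j)))) \<and>
     distinct rest \<and> (rest \<noteq> [] \<longrightarrow> thr \<le> rad x) \<and> (\<forall>w\<in>set rest. w \<in> set (adj ! x)) \<and>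
     (\<forall>w\<in>q ` {..<qt}. par w = x \<longrightarrow> w \<notin> set rest)"

text \<open>Numbered access to the invariant. Conjuncts 9 and 12 say that the queue is sorted and
  spans at most two levels. Conjunct 17 ensures that a visited vertex met later in the list of
  \<open>x\<close> is never a child of \<open>x\<close>, so it closes a genuine cycle unless it is
  the parent of \<open>x\<close>.\<close>

lemma bfs_inv_conjuncts:
  assumes "bfs_inv rad thr src q lev par qh qt x rest"
  shows "0 < qt"
    "qh \<le> qt"
    "q 0 = src"
    "(\<forall>j<qt. q j < length adj)"
    "inj_on q {..<qt}"
    "lev src = 0"
    "par src = src"
    "(\<forall>j<qt. 0 < j \<longrightarrow> (\<exists>i<qh. i < j \<and> par (q j) = q i \<and> lev (q j) = Suc (lev (q i)) \<and>
        q j \<in> set (adj ! q i) \<and> thr \<le> rad (q i)))"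
    "(\<forall>i j. i \<le> j \<longrightarrow> j < qt \<longrightarrow> lev (q i) \<le> lev (q j))"
    "(qh = 0 \<longrightarrow> qt = 1 \<and> rest = [])"
    "(0 < qh \<longrightarrow> x = q (qh - 1))"
    "(0 < qh \<longrightarrow> lev (q (qt - 1)) \<le> Suc (lev x))"
    "(\<forall>j<qh. thr \<le> rad (q j) \<longrightarrow> (\<forall>w\<in>set (adj ! q j).
        (Suc j = qh \<and> w \<in> set rest) \<or> (w \<in> q ` {..<qt} \<and> (par (q j) = w \<or> par w = q j))))"
    "distinct rest"
    "(rest \<noteq> [] \<longrightarrow> thr \<le> rad x)"
    "(\<forall>w\<in>set rest. w \<in> set (adj ! x))"
    "(\<forall>w\<in>q ` {..<qt}. par w = x \<longrightarrow> w \<notin> set rest)"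
  using assms unfolding bfs_inv_def by - (elim conjE, assumption)+

lemmas bfs_invD = bfs_inv_conjuncts[rule_format]

lemma bfs_invI:
  assumes "0 < qt" "qh \<le> qt" "q 0 = src" "\<And>j. j < qt \<Longrightarrow> q j < length adj"
    and "inj_on q {..<qt}" "lev src = 0" "par src = src"
    and "\<And>j. j < qt \<Longrightarrow> 0 < j \<Longrightarrow> \<exists>i<qh. i < j \<and> par (q j) = q i \<and> lev (q j) = Suc (lev (q i)) \<and>
        q j \<in> set (adj ! q i) \<and> thr \<le> rad (q i)"
    and "\<And>i j. i \<le> j \<Longrightarrow> j < qt \<Longrightarrow> lev (q i) \<le> lev (q j)"
    and "qh = 0 \<Longrightarrow> qt = 1 \<and> rest = []" "0 < qh \<Longrightarrow> x = q (qh - 1)"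
    and "0 < qh \<Longrightarrow> lev (q (qt - 1)) \<le> Suc (lev x)"
    and "\<And>j w. j < qh \<Longrightarrow> thr \<le> rad (q j) \<Longrightarrow> w \<in> set (adj ! q j) \<Longrightarrow>
        (Suc j = qh \<and> w \<in> set rest) \<or> (w \<in> q ` {..<qt} \<and> (par (q j) = w \<or> par w = q j))"
    and "distinct rest" "rest \<noteq> [] \<Longrightarrow> thr \<le> rad x" "\<And>w. w \<in> set rest \<Longrightarrow> w \<in> set (adj ! x)"
    and "\<And>w. w \<in> q ` {..<qt} \<Longrightarrow> par w = x \<Longrightarrow> w \<notin> set rest"
  shows "bfs_inv rad thr src q lev par qh qt x rest"
  unfolding bfs_inv_def by (fact assms | rule conjI allI impI ballI)+

lemma bfs_inv_init:
  assumes "src < length adj"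
  shows "bfs_inv rad thr src (q(0 := src)) (lev(src := 0)) (par(src := src)) 0 1 x []"
  using assms unfolding bfs_inv_def by (auto simp: inj_on_def)

lemma bfs_inv_cases:
  assumes "bfs_inv rad thr src q lev par qh qt x rest" "u \<in> q ` {..<qt}"
  obtains "u = src"
  | "u \<noteq> src" "lev u = Suc (lev (par u))" "u \<in> set (adj ! par u)" "par u \<in> set (adj ! u)"
    "par u \<in> q ` {..<qt}" "thr \<le> rad (par u)"
proof -
  note inv = bfs_invD[OF assms(1)]
  obtain j where j: "j < qt" "u = q j" using assms(2) by auto
  show ?thesis
  proof (cases "j = 0")
    case True
    then show ?thesis using that(1) j inv(3) by simp
  next
    case False
    then obtain i where i: "i < qh" "i < j" "par u = q i" "lev u = Suc (lev (q i))"
      "u \<in> set (adj ! q i)" "thr \<le> rad (q i)" using inv(8)[OF j(1)] j(2) by auto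
    have "q i \<in> set (adj ! u)" using adj_sym[OF inv(4)[of i] i(5)] i j by simp
    moreover have "q i \<in> q ` {..<qt}" using i j by simp
    moreover have "u \<noteq> src" using i inv(6) by auto
    ultimately show ?thesis using that(2) i by simp
  qed
qed

lemma bfs_inv_skip:
  assumes "bfs_inv rad thr src q lev par qh qt x (par x # rest)"
  shows "bfs_inv rad thr src q lev par qh qt x rest"
proof -
  note inv = bfs_invD[OF assms]
  have h: "0 < qh" using inv(10) by (cases qh) auto
  then have x: "x = q (qh - 1)" "qh - 1 < qt" using inv(11,2) by auto
  then have xv: "x \<in> q ` {..<qt}" "x < length adj" using inv(4) by auto
  have "par x \<in> set (adj ! x)" using inv(16) by simp
  then have "par x \<noteq> x" using adj_irrefl[OF xv(2)] by metis
  then have px: "par x \<in> q ` {..<qt}" using bfs_inv_cases[OF assms xv(1)] inv(7) by metis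
  have "(Suc j = qh \<and> w \<in> set rest) \<or> (w \<in> q ` {..<qt} \<and> (par (q j) = w \<or> par w = q j))"
    if "j < qh" "thr \<le> rad (q j)" "w \<in> set (adj ! q j)" for j w
    using inv(13)[OF that] px x(1) by auto
  moreover have "w \<notin> set rest" if "w \<in> q ` {..<qt}" "par w = x" for w using inv(17)[OF that] by simp
  moreover have "distinct rest" using inv(14) by simp
  moreover have "thr \<le> rad x" using inv(15) by simp
  moreover have "w \<in> set (adj ! x)" if "w \<in> set rest" for w using inv(16) that by simp
  moreover have "qt = 1 \<and> rest = []" if "qh = 0" using that h by simp
  ultimately show ?thesis using inv(1-9,11,12) by (intro bfs_invI) (assumption | fact)+
qed

lemma bfs_inv_discover:
  assumes "bfs_inv rad thr src q lev par qh qt x (w # rest)" "w \<notin> q ` {..<qt}"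
  shows "bfs_inv rad thr src (q(qt := w)) (lev(w := Suc (lev x))) (par(w := x)) qh (Suc qt) x rest"
proof -
  note inv = bfs_invD[OF assms(1)]
  let ?q = "q(qt := w)" and ?lev = "lev(w := Suc (lev x))" and ?par = "par(w := x)"
  have h: "0 < qh" using inv(10) by (cases qh) auto
  then have x: "x = q (qh - 1)" "qh - 1 < qt" using inv(11,2) by auto
  then have xv: "x \<in> q ` {..<qt}" "x < length adj" using inv(4) by auto
  have wx: "w \<in> set (adj ! x)" "thr \<le> rad x" using inv(15,16) by simp_all
  then have w: "w < length adj" "w \<noteq> x" using adj_sym[OF xv(2)] adj_irrefl[OF xv(2)] by auto
  have src: "src \<in> q ` {..<qt}" using inv(1,3) by auto
  have old: "?q j = q j" "?lev (q j) = lev (q j)" "?par (q j) = par (q j)" "q j \<noteq> w" if "j < qt" for j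
    using that assms(2) by auto
  have img: "?q ` {..<Suc qt} = insert w (q ` {..<qt})"
    by (auto simp: lessThan_Suc image_iff)
  have "inj_on ?q {..<Suc qt}"
    using inv(5) assms(2) by (auto simp: inj_on_def less_Suc_eq)
  moreover have "\<exists>i<qh. i < j \<and> ?par (?q j) = ?q i \<and> ?lev (?q j) = Suc (?lev (?q i)) \<and>
        ?q j \<in> set (adj ! ?q i) \<and> thr \<le> rad (?q i)" if "j < Suc qt" "0 < j" for j
  proof (cases "j = qt")
    case True
    then show ?thesis using x h wx old(1,2)[OF x(2)] w by (intro exI[of _ "qh - 1"]) auto
  next
    case False
    then have j: "j < qt" "0 < j" using that by simp_all
    then obtain i where "i < qh" "i < j" "par (q j) = q i" "lev (q j) = Suc (lev (q i))"
      "q j \<in> set (adj ! q i)" "thr \<le> rad (q i)" using inv(8)[OF j] by blast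
    with j old[OF j(1)] old[of i] show ?thesis by (intro exI[of _ i]) simp
  qed
  moreover have "?lev (?q i) \<le> ?lev (?q j)" if "i \<le> j" "j < Suc qt" for i j
  proof (cases "j = qt")
    case True
    show ?thesis
    proof (cases "i = qt")
      case False
      with that True have i: "i \<le> qt - 1" "i < qt" by auto
      have "lev (q i) \<le> Suc (lev x)" using inv(9)[OF i(1)] inv(1) inv(12)[OF h] by simp
      with old[OF i(2)] True show ?thesis by simp
    qed (use True in simp)
  next
    case False
    with that have "i < qt" "j < qt" by auto
    with old[of i] old[of j] inv(9)[OF that(1)] show ?thesis by simp
  qed
  moreover have "(Suc j = qh \<and> v \<in> set rest) \<or>
      (v \<in> ?q ` {..<Suc qt} \<and> (?par (?q j) = v \<or> ?par v = ?q j))"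
    if "j < qh" "thr \<le> rad (?q j)" "v \<in> set (adj ! ?q j)" for j v
  proof -
    have j: "j < qt" using that(1) inv(2) by simp
    show ?thesis
    proof (cases "v = w")
      case True
      \<comment> \<open>Since \<open>w\<close> was not visited before, the old invariant can account
        for an arc to it only through the unscanned list, so the arc starts at
        \<open>x\<close>.\<close>
      have "Suc j = qh" using inv(13)[of j v] that old[OF j] assms(2) True by auto
      then have "q j = x" using x by auto
      then show ?thesis unfolding img using True old[OF j] by simp
    next
      case False
      then show ?thesis unfolding img using inv(13)[of j v] that old[OF j] by auto
    qed
  qed
  moreover have "v \<notin> set rest" if "v \<in> ?q ` {..<Suc qt}" "?par v = x" for v
    using that inv(14) inv(17)[of v] unfolding img by (auto split: if_splits)
  moreover have "?lev (?q (Suc qt - 1)) \<le> Suc (?lev x)" using w by simp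
  moreover have "?lev src = 0" "?par src = src" using src assms(2) inv(6,7) by auto
  moreover have "?q 0 = src" using inv(1,3) by simp
  moreover have "?q j < length adj" if "j < Suc qt" for j using inv(4) w that by (auto simp: less_Suc_eq)
  moreover have "x = ?q (qh - 1)" using x by simp
  moreover have "distinct rest" using inv(14) by simp
  moreover have "0 < Suc qt" "qh \<le> Suc qt" using inv(2) by simp_all
  moreover have "Suc qt = 1 \<and> rest = []" if "qh = 0" using that h by simp
  moreover have "v \<in> set (adj ! x)" if "v \<in> set rest" for v using that inv(16) by simp
  ultimately show ?thesis using wx(2) by (intro bfs_invI) (assumption | fact)+
qed

lemma bfs_inv_dequeue:
  assumes "bfs_inv rad thr src q lev par qh qt x []" "qh < qt"
    and rest: "rest = (if thr \<le> rad (q qh) then adj ! q qh else [])"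
  shows "bfs_inv rad thr src q lev par (Suc qh) qt (q qh) rest"
proof -
  note inv = bfs_invD[OF assms(1)]
  have "\<exists>i<Suc qh. i < j \<and> par (q j) = q i \<and> lev (q j) = Suc (lev (q i)) \<and>
        q j \<in> set (adj ! q i) \<and> thr \<le> rad (q i)" if "j < qt" "0 < j" for j
    using inv(8)[OF that] less_Suc_eq by blast
  moreover have "lev (q (qt - 1)) \<le> Suc (lev (q qh))"
  proof (cases "qh = 0")
    case True
    then show ?thesis using inv(10) by simp
  next
    case False
    then have "lev x \<le> lev (q qh)" using inv(9)[of "qh - 1" qh] inv(11) assms(2) by simp
    with inv(12) False show ?thesis by simp
  qed
  moreover have "(Suc j = Suc qh \<and> w \<in> set rest) \<or> (w \<in> q ` {..<qt} \<and> (par (q j) = w \<or> par w = q j))"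
    if "j < Suc qh" "thr \<le> rad (q j)" "w \<in> set (adj ! q j)" for j w
    using inv(13)[of j w] that rest by (cases "j = qh") auto
  \<comment> \<open>Parents of non-root vertices lie among the dequeued ones, and
    \<open>q qh\<close> is not yet one of these. The root, which is its own parent, is no neighbour
    of itself.\<close>
  moreover have "w \<notin> set rest" if w: "w \<in> q ` {..<qt}" and pw: "par w = q qh" for w
  proof -
    obtain j where j: "j < qt" "w = q j" using w by auto
    show ?thesis
    proof (cases "j = 0")
      case True
      then have "w = q qh" using j pw inv(3,7) by simp
      then show ?thesis using rest adj_irrefl[OF inv(4)[OF assms(2)]] by auto
    next
      case False
      then obtain i where "i < qh" "par w = q i" using inv(8)[OF j(1)] j(2) by auto
      with pw inv(5) assms(2) have False by (auto simp: inj_on_def)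
      then show ?thesis ..
    qed
  qed
  moreover have "distinct rest" using rest distinct_adj[OF inv(4)[OF assms(2)]] by simp
  moreover have "Suc qh \<le> qt" using assms(2) by simp
  moreover have "thr \<le> rad (q qh)" if "rest \<noteq> []" using that rest by (simp split: if_splits)
  moreover have "w \<in> set (adj ! q qh)" if "w \<in> set rest" for w using that rest by (simp split: if_splits)
  ultimately show ?thesis using inv(1-7,9) by (intro bfs_invI) (assumption | fact | simp)+
qed

lemma bfs_inv_card:
  assumes "bfs_inv rad thr src q lev par qh qt x rest"
  shows "qt \<le> length adj" "card (q ` {..<qt}) = qt"
proof -
  note inv = bfs_invD[OF assms]
  show c: "card (q ` {..<qt}) = qt" using inv(5) by (simp add: card_image)
  have "card (q ` {..<qt}) \<le> card {..<length adj}" using inv(4) by (intro card_mono) auto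
  with c show "qt \<le> length adj" by simp
qed

text \<open>Levels are bounded by positions in the queue; hence they fit into words, and following
  tree paths costs no more than the search itself.\<close>

lemma bfs_inv_lev_le:
  assumes "bfs_inv rad thr src q lev par qh qt x rest"
  shows "j < qt \<Longrightarrow> lev (q j) \<le> j"
proof (induction j rule: less_induct)
  case (less j)
  note inv = bfs_invD[OF assms]
  show ?case
  proof (cases "j = 0")
    case False
    with inv(8)[OF less.prems] obtain i where "i < j" "lev (q j) = Suc (lev (q i))" by blast
    with less.IH[of i] less.prems show ?thesis by simp
  qed (use inv in simp)
qed

lemma bfs_inv_in_ball:
  assumes "bfs_inv rad thr src q lev par qh qt x rest"
  shows "j < qt \<Longrightarrow> q j \<in> ball (\<lambda>u. thr \<le> rad u) src (lev (q j))"
proof (induction j rule: less_induct)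
  case (less j)
  note inv = bfs_invD[OF assms]
  show ?case
  proof (cases "j = 0")
    case False
    with inv(8)[OF less.prems] obtain i where i: "i < j" "lev (q j) = Suc (lev (q i))"
      "q j \<in> set (adj ! q i)" "thr \<le> rad (q i)" by blast
    with less.IH[of i] less.prems have "q i \<in> ball (\<lambda>u. thr \<le> rad u) src (lev (q i))" by simp
    from ball_step[OF this i(4,3)] i(2) show ?thesis by simp
  qed (use inv in simp)
qed

text \<open>Vertices are dequeued in the order of their levels. If the current vertex
  \<open>x\<close> has level at least \<open>D\<close>, then all vertices of smaller level precede
  it in the queue and are scanned completely; if nothing is left to scan, every \<open>D\<close> is
  admissible.\<close>

lemma bfs_inv_tree_below:
  assumes "bfs_inv rad thr src q lev par qh qt x rest"
    and D: "(0 < qh \<and> D \<le> lev x) \<or> (rest = [] \<and> qh = qt)"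
  shows "tree_below (\<lambda>u. thr \<le> rad u) (q ` {..<qt}) src lev par D"
proof -
  note inv = bfs_invD[OF assms(1)]
  have "w \<in> q ` {..<qt} \<and> (par (q j) = w \<or> par w = q j)"
    if "j < qt" "lev (q j) < D" "thr \<le> rad (q j)" "w \<in> set (adj ! q j)" for j w
  proof -
    have "j < qh \<and> (Suc j = qh \<longrightarrow> rest = [])"
    proof (cases "rest = [] \<and> qh = qt")
      case False
      with D have h: "0 < qh" "D \<le> lev (q (qh - 1))" using inv(11) by auto
      then have "\<not> qh - 1 \<le> j" using inv(9)[of "qh - 1" j] that by auto
      then show ?thesis by auto
    qed (use that in auto)
    then show ?thesis using inv(13)[OF _ that(3,4)] by auto
  qed
  moreover have "lev u = Suc (lev (par u))" if "u \<in> q ` {..<qt}" "u \<noteq> src" for u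
    using bfs_inv_cases[OF assms(1) that(1)] that(2) by metis
  moreover have "src \<in> q ` {..<qt}" using inv(1,3) by auto
  ultimately show ?thesis unfolding tree_below_def using inv(4,6,7) by auto
qed

section \<open>The cycle closed by a non-tree arc\<close>

text \<open>
  \<open>as @ [a]\<close> and \<open>bs @ [b]\<close> are the parts of the tree paths from \<open>x\<close> and \<open>y\<close> towards the root that
  have been followed so far; always the end of larger level, in case of a tie \<open>a\<close>, moves on.
\<close>

definition meet_inv :: "nat set \<Rightarrow> nat \<Rightarrow> (nat \<Rightarrow> nat) \<Rightarrow> (nat \<Rightarrow> nat) \<Rightarrow> nat \<Rightarrow> nat \<Rightarrow>
    nat \<Rightarrow> nat \<Rightarrow> nat list \<Rightarrow> nat list \<Rightarrow> bool" where
  "meet_inv vis src lev par x y a b as bs \<longleftrightarrow>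
     a \<in> vis \<and> b \<in> vis \<and> set as \<subseteq> vis \<and> set bs \<subseteq> vis \<and>
     distinct as \<and> distinct bs \<and> set as \<inter> set bs = {} \<and>
     (\<forall>z\<in>set as. lev a < lev z \<and> lev b \<le> lev z \<and> z \<noteq> b) \<and>
     (\<forall>z\<in>set bs. lev b < lev z \<and> lev a < lev z) \<and>
     hd (as @ [a]) = x \<and> hd (bs @ [b]) = y \<and>
     successively (\<lambda>u v. par u = v \<and> u \<noteq> src) (as @ [a]) \<and>
     successively (\<lambda>u v. par u = v \<and> u \<noteq> src) (bs @ [b]) \<and>
     length as + lev a = lev x \<and> length bs + lev b = lev y"

lemma meet_inv_init: "x \<in> vis \<Longrightarrow> y \<in> vis \<Longrightarrow> meet_inv vis src lev par x y x y [] []"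
  unfolding meet_inv_def by simp

context
  fixes rad thr src q lev par qh qt x' rest vis
  assumes bfs: "bfs_inv rad thr src q lev par qh qt x' rest"
  defines "vis \<equiv> q ` {..<qt}"
begin

lemma lev_eq_0: "u \<in> vis \<Longrightarrow> lev u = 0 \<Longrightarrow> u = src"
  using bfs_inv_cases[OF bfs, of u] unfolding vis_def by auto

lemma parent:
  assumes "u \<in> vis" "u \<noteq> src"
  shows "par u \<in> vis" "lev u = Suc (lev (par u))" "par u \<in> set (adj ! u)" "u \<in> set (adj ! par u)"
  using bfs_inv_cases[OF bfs, of u] assms unfolding vis_def by metis+

text \<open>In a tie \<open>a\<close> moves, so a vertex of \<open>as\<close> may share the level of
  \<open>b\<close> without being \<open>b\<close>, while a vertex of \<open>bs\<close> lies strictly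
  above the level of \<open>a\<close>. Levels only decrease afterwards, which keeps the two paths
  disjoint.\<close>

lemma meet_inv_left:
  assumes m: "meet_inv vis src lev par x y a b as bs" and ab: "a \<noteq> b" "lev b \<le> lev a"
  shows "a \<noteq> src" "meet_inv vis src lev par x y (par a) b (as @ [a]) bs"
proof -
  have lev_src: "lev src = 0" using bfs_invD(6)[OF bfs] .
  have v: "a \<in> vis" "b \<in> vis" using m unfolding meet_inv_def by auto
  show "a \<noteq> src" using ab v lev_eq_0[of b] lev_src by auto
  from parent(1,2)[OF v(1) this] m ab this
  show "meet_inv vis src lev par x y (par a) b (as @ [a]) bs"
    unfolding meet_inv_def by (auto simp: successively_append_iff hd_append)
qed

lemma meet_inv_right:
  assumes m: "meet_inv vis src lev par x y a b as bs" and ab: "lev a < lev b"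
  shows "b \<noteq> src" "meet_inv vis src lev par x y a (par b) as (bs @ [b])"
proof -
  have lev_src: "lev src = 0" using bfs_invD(6)[OF bfs] .
  have v: "a \<in> vis" "b \<in> vis" using m unfolding meet_inv_def by auto
  show "b \<noteq> src" using ab lev_src by auto
  from parent(1,2)[OF v(2) this] m ab this
  show "meet_inv vis src lev par x y a (par b) as (bs @ [b])"
    unfolding meet_inv_def by (fastforce simp: successively_append_iff hd_append)
qed

text \<open>The two tree paths meet in \<open>a\<close>, and the arc between \<open>x\<close> and
  \<open>y\<close> closes them. Irreflexivity excludes length 1 and a non-tree arc excludes length
  2. The bound is attained only if the paths meet at level 0.\<close>

lemma meet_inv_vcycle:
  assumes m: "meet_inv vis src lev par x y a a as bs"
    and xy: "y \<in> set (adj ! x)" "par x \<noteq> y" "par y \<noteq> x"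
  shows "vcycle (as @ a # rev bs)" "length (as @ a # rev bs) \<le> Suc (lev x + lev y)"
proof -
  let ?cs = "as @ a # rev bs"
  let ?R = "\<lambda>u v. v \<in> set (adj ! u)"
  have sub: "set ?cs \<subseteq> vis" using m unfolding meet_inv_def by auto
  have V: "u < length adj" if "u \<in> vis" for u using that bfs_invD(4)[OF bfs] unfolding vis_def by auto
  have dist: "distinct ?cs" using m unfolding meet_inv_def by auto
  have xv: "x \<in> vis" using m unfolding meet_inv_def by (cases as) auto
  have hd: "hd ?cs = x" using m unfolding meet_inv_def by (cases as) auto
  have last: "last ?cs = y" using m unfolding meet_inv_def by (cases bs) auto
  have sa: "successively ?R (as @ [a])"
    by (rule successively_mono[of "\<lambda>u v. par u = v \<and> u \<noteq> src"])
      (use m parent(3) in \<open>auto simp: meet_inv_def\<close>)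
  have sb: "successively (\<lambda>u v. u \<in> set (adj ! v)) (bs @ [a])"
    by (rule successively_mono[of "\<lambda>u v. par u = v \<and> u \<noteq> src"])
      (use m parent(4) in \<open>auto simp: meet_inv_def\<close>)
  have "successively ?R (rev (bs @ [a]))" using sb by (subst successively_rev)
  with sa have succ: "successively ?R ?cs"
    by (auto simp: successively_append_iff successively_Cons)
  have "length ?cs \<noteq> 1"
  proof
    assume "length ?cs = 1"
    then have "x = y" using hd last by (cases as; cases bs) auto
    with xy(1) adj_irrefl[OF V[OF xv]] show False by simp
  qed
  moreover have "length ?cs \<noteq> 2"
  proof
    assume "length ?cs = 2"
    then consider "length as = 1" "bs = []" | "as = []" "length bs = 1" by (cases as; cases bs) auto
    then show False
    proof cases
      case 1
      then obtain z where "as = [z]" by (cases as) auto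
      with 1 m xy(2) show False unfolding meet_inv_def by auto
    next
      case 2
      then obtain z where "bs = [z]" by (cases bs) auto
      with 2 m xy(3) show False unfolding meet_inv_def by auto
    qed
  qed
  moreover have "length ?cs \<noteq> 0" by simp
  ultimately have len: "3 \<le> length ?cs" by linarith
  have "?cs ! (Suc i mod length ?cs) \<in> set (adj ! (?cs ! i))" if i: "i < length ?cs" for i
  proof (cases "Suc i = length ?cs")
    case True
    then have "?cs ! i = y" using last by (metis diff_Suc_1 last_conv_nth length_0_conv nat.simps(3))
    moreover have "?cs ! 0 = x" using hd by (metis hd_conv_nth append_is_Nil_conv list.distinct(1))
    moreover have "x \<in> set (adj ! y)" using adj_sym[OF V[OF xv] xy(1)] by simp
    ultimately show ?thesis using True by simp
  next
    case False
    with i have "Suc i < length ?cs" by simp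
    then show ?thesis using succ by (simp add: successively_conv_nth del: length_append)
  qed
  with len dist sub V show "vcycle ?cs" unfolding vcycle_def by (auto simp del: length_append)
  show "length ?cs \<le> Suc (lev x + lev y)" using m unfolding meet_inv_def by auto
qed

end

end

section \<open>The search as a program\<close>

text \<open>Visited means that the mark equals the current \<open>stamp\<close>; a new search
  invalidates all old marks by increasing \<open>stamp\<close>. On success \<open>i\<close> is not
  advanced, so \<open>x\<close> and \<open>w\<close> remain the ends of an unscanned arc.\<close>

definition scan_arc :: com where
  "scan_arc =
     ''w'' ::= Read ''adj'' (V ''i'') ;;
     If (Eq (V ''w'') (Read ''par'' (V ''x'')))
       (''i'' ::= Plus (V ''i'') (N 1))
       (If (Eq (Read ''mark'' (V ''w'')) (V ''stamp''))
         (''found'' ::= N 1)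
         (''mark''\<langle>V ''w''\<rangle> ::= V ''stamp'' ;;
          ''lev''\<langle>V ''w''\<rangle> ::= Plus (Read ''lev'' (V ''x'')) (N 1) ;;
          ''par''\<langle>V ''w''\<rangle> ::= V ''x'' ;;
          ''q''\<langle>V ''tail''\<rangle> ::= V ''w'' ;;
          ''tail'' ::= Plus (V ''tail'') (N 1) ;;
          ''i'' ::= Plus (V ''i'') (N 1)))"

text \<open>The search calls this only when \<open>i < e\<close> fails, so keeping \<open>i\<close>
  and \<open>e\<close> gives a vertex below the threshold an empty list.\<close>

definition dequeue :: com where
  "dequeue =
     ''x'' ::= Read ''q'' (V ''head'') ;;
     ''head'' ::= Plus (V ''head'') (N 1) ;;
     If (Less (Read ''rad'' (V ''x'')) (V ''thr'')) Skip
       (''i'' ::= Read ''off'' (V ''x'') ;;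
        ''e'' ::= Read ''off'' (Plus (V ''x'') (N 1)))"

definition bfs_init :: com where
  "bfs_init =
     ''stamp'' ::= Plus (V ''stamp'') (N 1) ;;
     ''q''\<langle>N 0\<rangle> ::= V ''root'' ;;
     ''lev''\<langle>V ''root''\<rangle> ::= N 0 ;;
     ''par''\<langle>V ''root''\<rangle> ::= V ''root'' ;;
     ''mark''\<langle>V ''root''\<rangle> ::= V ''stamp'' ;;
     ''head'' ::= N 0 ;; ''tail'' ::= N 1 ;; ''x'' ::= V ''root'' ;;
     ''i'' ::= N 0 ;; ''e'' ::= N 0 ;; ''found'' ::= N 0"

definition bfs :: com where
  "bfs = bfs_init ;;
     While (And (Eq (V ''found'') (N 0)) (And (Less (V ''tail'') (V ''lim''))
         (Not (And (Not (Less (V ''i'') (V ''e''))) (Not (Less (V ''head'') (V ''tail'')))))))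
       (If (Less (V ''i'') (V ''e'')) scan_arc dequeue)"

definition climb :: com where
  "climb =
     While (Not (Eq (V ''a'') (V ''b'')))
       (If (Less (Read ''lev'' (V ''a'')) (Read ''lev'' (V ''b'')))
         (''tmp''\<langle>V ''j''\<rangle> ::= V ''b'' ;; ''j'' ::= Plus (V ''j'') (N 1) ;; ''b'' ::= Read ''par'' (V ''b''))
         (''out''\<langle>V ''len''\<rangle> ::= V ''a'' ;; ''len'' ::= Plus (V ''len'') (N 1) ;; ''a'' ::= Read ''par'' (V ''a'')))"

definition append_rev :: com where
  "append_rev =
     While (Less (N 0) (V ''j''))
       (''j'' ::= Minus (V ''j'') (N 1) ;;
        ''out''\<langle>V ''len''\<rangle> ::= Read ''tmp'' (V ''j'') ;;
        ''len'' ::= Plus (V ''len'') (N 1))"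

text \<open>\<open>best\<close> stores the bound given by the two levels rather than the length of
  the output, which is smaller when the tree paths meet away from the root.\<close>

definition record_cycle :: com where
  "record_cycle =
     If (Eq (V ''found'') (N 0)) Skip
       (If (Less (Plus (Plus (Read ''lev'' (V ''x'')) (Read ''lev'' (V ''w''))) (N 1)) (V ''best''))
         (''best'' ::= Plus (Plus (Read ''lev'' (V ''x'')) (Read ''lev'' (V ''w''))) (N 1) ;;
          ''a'' ::= V ''x'' ;; ''b'' ::= V ''w'' ;; ''len'' ::= N 0 ;; ''j'' ::= N 0 ;;
          climb ;;
          ''out''\<langle>V ''len''\<rangle> ::= V ''a'' ;; ''len'' ::= Plus (V ''len'') (N 1) ;;
          append_rev)
         Skip)"

definition search :: com where
  "search = bfs ;; record_cycle"

lemma mod_regs_loops: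
  "mod_regs scan_arc = {''w'', ''i'', ''found'', ''tail''}"
  "mod_regs dequeue = {''x'', ''head'', ''i'', ''e''}"
  "mod_arrs scan_arc = {''mark'', ''lev'', ''par'', ''q''}"
  "mod_arrs dequeue = {}"
  unfolding scan_arc_def dequeue_def by auto

lemma mod_search:
  "mod_regs search = {''w'', ''i'', ''found'', ''tail'', ''x'', ''head'', ''e'', ''stamp'',
     ''best'', ''a'', ''b'', ''len'', ''j''}"
  "mod_arrs search = {''mark'', ''lev'', ''par'', ''q'', ''tmp'', ''out''}"
  unfolding search_def bfs_def record_cycle_def climb_def append_rev_def bfs_init_def
  by (auto simp: mod_regs_loops)

section \<open>Adjacency lists in memory and the state of the search loop\<close>

context adjacency
begin

definition offs :: "nat \<Rightarrow> nat" where
  "offs v = (if v \<le> length adj then length (concat (take v adj)) else 0)"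

definition adjs :: "nat \<Rightarrow> nat" where
  "adjs i = (if i < length (concat adj) then concat adj ! i else 0)"

definition stores_graph :: "state \<Rightarrow> bool" where
  "stores_graph s \<longleftrightarrow> regs s ''n'' = length adj \<and> arrs s ''off'' = offs \<and> arrs s ''adj'' = adjs"

lemma length_adj_le: "v < length adj \<Longrightarrow> length (adj ! v) \<le> length adj"
proof -
  assume v: "v < length adj"
  have "length (adj ! v) = card (set (adj ! v))" using distinct_adj[OF v] by (simp add: distinct_card)
  also have "\<dots> \<le> card {..<length adj}" using adj_sym[OF v] by (intro card_mono) auto
  finally show ?thesis by simp
qed

lemma length_concat_le: "length (concat adj) \<le> length adj * length adj"
proof -
  have "length l \<le> length adj" if "l \<in> set adj" for l
    using that length_adj_le by (auto simp: in_set_conv_nth)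
  then have "sum_list (map length adj) \<le> sum_list (map (\<lambda>_. length adj) adj)" by (intro sum_list_mono) auto
  then show ?thesis by (simp add: length_concat sum_list_triv)
qed

lemma concat_split:
  assumes "v < length adj"
  shows "concat adj = concat (take v adj) @ adj ! v @ concat (drop (Suc v) adj)"
  by (subst id_take_nth_drop[OF assms]) simp

lemma offs_le: "offs v \<le> length (concat adj)"
proof -
  have "concat adj = concat (take v adj) @ concat (drop v adj)"
    by (metis append_take_drop_id concat_append)
  then show ?thesis unfolding offs_def by (metis le_add1 length_append zero_le)
qed

lemma offs_Suc: "v < length adj \<Longrightarrow> offs (Suc v) = offs v + length (adj ! v)"
  unfolding offs_def by (simp add: take_Suc_conv_app_nth)

lemma adjs_slice:
  assumes "v < length adj"
  shows "map adjs [offs v..<offs (Suc v)] = adj ! v"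
proof (rule nth_equalityI)
  show "length (map adjs [offs v..<offs (Suc v)]) = length (adj ! v)"
    using offs_Suc[OF assms] by simp
  fix i assume "i < length (map adjs [offs v..<offs (Suc v)])"
  then have i: "i < length (adj ! v)" using offs_Suc[OF assms] by simp
  have "offs v = length (concat (take v adj))" using assms unfolding offs_def by simp
  then show "map adjs [offs v..<offs (Suc v)] ! i = adj ! v ! i"
    using i offs_Suc[OF assms] concat_split[OF assms]
    by (simp add: adjs_def nth_append)
qed

text \<open>The default value 0 outside the stored lists is a vertex as well, so every read of
  \<open>adj\<close> yields a vertex.\<close>

lemma adjs_less: "0 < length adj \<Longrightarrow> adjs i < length adj"
proof -
  assume n: "0 < length adj"
  have "concat adj ! i < length adj" if "i < length (concat adj)"
  proof -
    have "concat adj ! i \<in> set (concat adj)" using that nth_mem by blast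
    then obtain v where "v < length adj" "concat adj ! i \<in> set (adj ! v)"
      unfolding set_concat by (metis UN_E in_set_conv_nth)
    then show ?thesis using adj_sym by blast
  qed
  with n show ?thesis unfolding adjs_def by simp
qed

definition bfs_ok :: "(nat \<Rightarrow> nat) \<Rightarrow> nat \<Rightarrow> nat \<Rightarrow> nat \<Rightarrow> nat \<Rightarrow> (nat \<Rightarrow> nat) \<Rightarrow> (nat \<Rightarrow> nat) \<Rightarrow> (nat \<Rightarrow> nat) \<Rightarrow>
    (nat \<Rightarrow> nat) \<Rightarrow> nat \<Rightarrow> nat \<Rightarrow> nat \<Rightarrow> nat \<Rightarrow> nat \<Rightarrow> nat \<Rightarrow> nat \<Rightarrow> bool" where
  "bfs_ok rad thr src lm stamp q lev par mark qh qt x i e w found \<longleftrightarrow>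
     bfs_inv rad thr src q lev par qh qt x (map adjs [i..<e]) \<and>
     e \<le> length (concat adj) \<and> i \<le> length (concat adj) \<and> x < length adj \<and> qt \<le> lm \<and>
     (\<forall>u. mark u \<le> stamp) \<and> (\<forall>u. mark u = stamp \<longleftrightarrow> u \<in> q ` {..<qt}) \<and> found \<le> 1 \<and>
     (found \<noteq> 0 \<longrightarrow> i < e \<and> w = adjs i \<and> w \<in> q ` {..<qt} \<and> w \<noteq> par x)"

text \<open>Makes the time linear in the limit \<open>lm\<close> although arcs are scanned. A
  discovery releases 3 units and keeps 2 for the later dequeuing; a dequeuing releases 2 and may
  need 1 for the single arc back to the parent of the new vertex; any other arc ends the search and
  uses up the unit for \<open>found\<close>.\<close>

definition bfs_potential :: "nat \<Rightarrow> (nat \<Rightarrow> nat) \<Rightarrow> nat \<Rightarrow> nat \<Rightarrow> nat \<Rightarrow> nat \<Rightarrow> nat \<Rightarrow> nat \<Rightarrow> nat" where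
  "bfs_potential lm par qh qt x i e found =
     3 * (lm - qt) + 2 * (qt - qh) + (if par x \<in> set (map adjs [i..<e]) then 1 else 0) +
     (if found = 0 then 1 else 0)"

lemma bfs_ok_bounds:
  assumes "bfs_ok rad thr src lm stamp q lev par mark qh qt x i e w found"
  shows "x < length adj" "qt \<le> length adj" "qt \<le> lm" "qh \<le> qt" "0 < qt" "mark u \<le> stamp"
    "e \<le> length (concat adj)" "i \<le> length (concat adj)" "adjs k < length adj"
    "j < qt \<Longrightarrow> q j < length adj" "j < qt \<Longrightarrow> lev (q j) < length adj" "j < qt \<Longrightarrow> par (q j) < length adj"
    "i < e \<Longrightarrow> 0 < qh \<and> x \<in> q ` {..<qt} \<and> lev x < length adj \<and> par x < length adj"
    "found \<le> 1"
proof -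
  note ok = assms[unfolded bfs_ok_def]
  then have bi: "bfs_inv rad thr src q lev par qh qt x (map adjs [i..<e])" by blast
  note inv = bfs_invD[OF bi]
  show "found \<le> 1" using ok by blast
  show x: "x < length adj" and "qt \<le> lm" "mark u \<le> stamp"
    "e \<le> length (concat adj)" "i \<le> length (concat adj)" using ok by blast+
  show qt: "qt \<le> length adj" using bfs_inv_card[OF bi] by simp
  show "qh \<le> qt" "0 < qt" using inv(2,1) .
  show "adjs k < length adj" using x by (intro adjs_less) linarith
  show qj: "q j < length adj" if "j < qt" for j using inv(4) that .
  show lj: "lev (q j) < length adj" if "j < qt" for j
    using bfs_inv_lev_le[OF bi that] that qt by simp
  have par: "par u < length adj" if "u \<in> q ` {..<qt}" for u
  proof (rule bfs_inv_cases[OF bi that])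
    assume "u = src"
    then show ?thesis using inv(7) that qj by auto
  next
    assume "par u \<in> q ` {..<qt}"
    then show ?thesis using qj by auto
  qed
  then show "j < qt \<Longrightarrow> par (q j) < length adj" by simp
  assume "i < e"
  then have h: "0 < qh" using inv(10) by (cases qh) auto
  then have "x = q (qh - 1)" "qh - 1 < qt" using inv(11,2) by auto
  then show "0 < qh \<and> x \<in> q ` {..<qt} \<and> lev x < length adj \<and> par x < length adj"
    using h par[of x] lj[of "qh - 1"] by auto
qed

lemma slice_Cons: "i < e \<Longrightarrow> map adjs [i..<e] = adjs i # map adjs [Suc i..<e]"
  by (simp add: upt_conv_Cons)

lemma bfs_ok_init:
  assumes "src < length adj" "0 < lm" "\<And>u. mark u < stamp"
  shows "bfs_ok rad thr src lm stamp (q(0 := src)) (lev(src := 0)) (par(src := src)) (mark(src := stamp))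
    0 (Suc 0) src 0 0 w 0"
  using assms bfs_inv_init[OF assms(1)] unfolding bfs_ok_def
  by (auto simp: less_imp_le less_imp_neq)

lemma bfs_ok_skip:
  assumes ok: "bfs_ok rad thr src lm stamp q lev par mark qh qt x i e w 0"
    and i: "i < e" "adjs i = par x"
  shows "bfs_ok rad thr src lm stamp q lev par mark qh qt x (Suc i) e w' 0"
    "bfs_potential lm par qh qt x (Suc i) e 0 < bfs_potential lm par qh qt x i e 0"
proof -
  have inv: "bfs_inv rad thr src q lev par qh qt x (par x # map adjs [Suc i..<e])"
    using ok slice_Cons[OF i(1)] i(2) unfolding bfs_ok_def by simp
  then show "bfs_ok rad thr src lm stamp q lev par mark qh qt x (Suc i) e w' 0"
    using bfs_inv_skip[OF inv] ok i unfolding bfs_ok_def by simp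
  have "par x \<notin> set (map adjs [Suc i..<e])" using bfs_invD(14)[OF inv] by simp
  then show "bfs_potential lm par qh qt x (Suc i) e 0 < bfs_potential lm par qh qt x i e 0"
    unfolding bfs_potential_def slice_Cons[OF i(1)] by (simp add: i(2))
qed

lemma bfs_ok_found:
  assumes "bfs_ok rad thr src lm stamp q lev par mark qh qt x i e w 0"
    and "i < e" "adjs i \<noteq> par x" "mark (adjs i) = stamp"
  shows "bfs_ok rad thr src lm stamp q lev par mark qh qt x i e (adjs i) (Suc 0)"
    "bfs_potential lm par qh qt x i e (Suc 0) < bfs_potential lm par qh qt x i e 0"
  using assms unfolding bfs_ok_def bfs_potential_def by auto

lemma bfs_ok_discover:
  assumes ok: "bfs_ok rad thr src lm stamp q lev par mark qh qt x i e w 0"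
    and i: "i < e" and w: "mark (adjs i) \<noteq> stamp" and lm: "qt < lm"
  shows "bfs_ok rad thr src lm stamp (q(qt := adjs i)) (lev(adjs i := Suc (lev x))) (par(adjs i := x))
      (mark(adjs i := stamp)) qh (Suc qt) x (Suc i) e (adjs i) 0"
    "bfs_potential lm (par(adjs i := x)) qh (Suc qt) x (Suc i) e 0 < bfs_potential lm par qh qt x i e 0"
proof -
  have inv: "bfs_inv rad thr src q lev par qh qt x (adjs i # map adjs [Suc i..<e])"
    using ok slice_Cons[OF i] unfolding bfs_ok_def by simp
  have new: "adjs i \<notin> q ` {..<qt}" using ok w unfolding bfs_ok_def by blast
  have img: "(q(qt := adjs i)) ` {..<Suc qt} = insert (adjs i) (q ` {..<qt})"
    by (auto simp: lessThan_Suc image_iff)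
  have "(mark(adjs i := stamp)) u = stamp \<longleftrightarrow> u \<in> (q(qt := adjs i)) ` {..<Suc qt}" for u
    unfolding img using ok unfolding bfs_ok_def by auto
  then show "bfs_ok rad thr src lm stamp (q(qt := adjs i)) (lev(adjs i := Suc (lev x))) (par(adjs i := x))
      (mark(adjs i := stamp)) qh (Suc qt) x (Suc i) e (adjs i) 0"
    using bfs_inv_discover[OF inv new] ok i lm unfolding bfs_ok_def by auto
  have "x \<noteq> adjs i" using bfs_ok_bounds(13)[OF ok i] new by metis
  then show "bfs_potential lm (par(adjs i := x)) qh (Suc qt) x (Suc i) e 0 < bfs_potential lm par qh qt x i e 0"
    using bfs_invD(2)[OF inv] lm unfolding bfs_potential_def slice_Cons[OF i] by auto
qed

lemma bfs_ok_dequeue: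
  assumes ok: "bfs_ok rad thr src lm stamp q lev par mark qh qt x i e w 0"
    and i: "\<not> i < e" and h: "qh < qt"
    and ie: "(i', e') = (if rad (q qh) < thr then (i, e) else (offs (q qh), offs (Suc (q qh))))"
  shows "bfs_ok rad thr src lm stamp q lev par mark (Suc qh) qt (q qh) i' e' w 0"
    "bfs_potential lm par (Suc qh) qt (q qh) i' e' 0 < bfs_potential lm par qh qt x i e 0"
proof -
  have inv: "bfs_inv rad thr src q lev par qh qt x []" using ok i unfolding bfs_ok_def by simp
  have qn: "q qh < length adj" using bfs_invD(4)[OF inv h] .
  have "map adjs [i'..<e'] = (if thr \<le> rad (q qh) then adj ! q qh else [])"
    using ie i adjs_slice[OF qn] by (auto split: if_splits)
  from bfs_inv_dequeue[OF inv h this]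
  show "bfs_ok rad thr src lm stamp q lev par mark (Suc qh) qt (q qh) i' e' w 0"
    using ok qn ie offs_le unfolding bfs_ok_def by (auto split: if_splits)
  show "bfs_potential lm par (Suc qh) qt (q qh) i' e' 0 < bfs_potential lm par qh qt x i e 0"
    using i h unfolding bfs_potential_def by auto
qed

end

section \<open>Correctness and running time of a single search\<close>

context adjacency
begin

definition bfs_state :: "nat \<Rightarrow> nat \<Rightarrow> state \<Rightarrow> bool" where
  "bfs_state src stamp s \<longleftrightarrow>
     bfs_ok (arrs s ''rad'') (regs s ''thr'') src (regs s ''lim'') stamp
       (arrs s ''q'') (arrs s ''lev'') (arrs s ''par'') (arrs s ''mark'')
       (regs s ''head'') (regs s ''tail'') (regs s ''x'') (regs s ''i'') (regs s ''e'')
       (regs s ''w'') (regs s ''found'')"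

abbreviation state_potential :: "state \<Rightarrow> nat" where
  "state_potential s \<equiv> bfs_potential (regs s ''lim'') (arrs s ''par'') (regs s ''head'') (regs s ''tail'')
     (regs s ''x'') (regs s ''i'') (regs s ''e'') (regs s ''found'')"

definition word_bounds :: "nat \<Rightarrow> state \<Rightarrow> bool" where
  "word_bounds W s \<longleftrightarrow> stores_graph s \<and> length adj * length adj + 4 * length adj + 10 \<le> W \<and>
     regs s ''lim'' < W \<and> regs s ''thr'' < W \<and> (\<forall>v<length adj. arrs s ''rad'' v < W)"

lemma word_bounds_concat: "word_bounds W s \<Longrightarrow> length (concat adj) + 4 * length adj + 10 \<le> W"
  using length_concat_le unfolding word_bounds_def by linarith

lemma scan_arc_wp:
  assumes wb: "word_bounds W s" and stamp: "regs s ''stamp'' = stamp" "stamp < W"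
    and ok: "bfs_state src stamp s" and found: "regs s ''found'' = 0"
    and i: "regs s ''i'' < regs s ''e''" and lm: "regs s ''tail'' < regs s ''lim''"
  shows "wp W scan_arc (\<lambda>t s'. bfs_state src stamp s' \<and> t \<le> 45 \<and> state_potential s' < state_potential s) s"
proof -
  note ok' = ok[unfolded bfs_state_def found]
  note b = bfs_ok_bounds[OF ok']
  note W = word_bounds_concat[OF wb]
  have A: "arrs s ''adj'' = adjs" using wb unfolding word_bounds_def stores_graph_def by simp
  have less: "regs s ''i'' < W" "Suc (regs s ''i'') < W" "adjs (regs s ''i'') < W" "regs s ''x'' < W"
    "arrs s ''par'' (regs s ''x'') < W" "Suc (arrs s ''lev'' (regs s ''x'')) < W" "arrs s ''lev'' (regs s ''x'') < W"
    "Suc (regs s ''tail'') < W" "regs s ''tail'' < W" "Suc 0 < W" "0 < W"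
    "\<And>u. arrs s ''mark'' u < W"
    using W b(1-8) b(9)[of "regs s ''i''"] b(13)[OF i] i stamp le_less_trans[OF b(6)] by auto
  show ?thesis
    unfolding scan_arc_def
    using less stamp A bfs_ok_skip[OF ok' i] bfs_ok_found[OF ok' i] bfs_ok_discover[OF ok' i _ lm]
    by (auto simp: bfs_state_def found)
qed

lemma dequeue_wp:
  assumes wb: "word_bounds W s"
    and ok: "bfs_state src stamp s" and found: "regs s ''found'' = 0"
    and i: "\<not> regs s ''i'' < regs s ''e''" and h: "regs s ''head'' < regs s ''tail''"
  shows "wp W dequeue (\<lambda>t s'. bfs_state src stamp s' \<and> t \<le> 45 \<and> state_potential s' < state_potential s) s"
proof -
  note ok' = ok[unfolded bfs_state_def found]
  note b = bfs_ok_bounds[OF ok']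
  note W = word_bounds_concat[OF wb]
  have A: "arrs s ''off'' = offs" using wb unfolding word_bounds_def stores_graph_def by simp
  have o: "offs v < W" for v using le_less_trans[OF offs_le] W by simp
  let ?x = "arrs s ''q'' (regs s ''head'')"
  have less: "regs s ''head'' < W" "Suc (regs s ''head'') < W" "?x < W" "Suc ?x < W" "Suc 0 < W"
    "arrs s ''rad'' ?x < W" "regs s ''thr'' < W"
    using W b(1-5) b(10)[OF h] h wb unfolding word_bounds_def by auto
  show ?thesis
    unfolding dequeue_def
    using less o A bfs_ok_dequeue[OF ok' i h]
    by (auto simp: bfs_state_def found)
qed

lemma word_bounds_frame:
  assumes "frame X Y s s'" "word_bounds W s" "''n'' \<notin> X" "''lim'' \<notin> X" "''thr'' \<notin> X"
    "''off'' \<notin> Y" "''adj'' \<notin> Y" "''rad'' \<notin> Y"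
  shows "word_bounds W s'"
  using assms unfolding word_bounds_def stores_graph_def frame_def by simp

lemma bfs_wp:
  assumes wb: "word_bounds W s" and stamp: "Suc (regs s ''stamp'') < W" "\<And>u. arrs s ''mark'' u \<le> regs s ''stamp''"
    and src: "regs s ''root'' < length adj" and lm: "0 < regs s ''lim''"
  shows "wp W bfs (\<lambda>t s'. t \<le> 600 * (regs s ''lim'' + 1) \<and>
      bfs_state (regs s ''root'') (Suc (regs s ''stamp'')) s' \<and> regs s' ''stamp'' = Suc (regs s ''stamp'') \<and>
      (regs s' ''found'' = 0 \<longrightarrow> regs s' ''tail'' = regs s ''lim'' \<or>
         (regs s' ''head'' = regs s' ''tail'' \<and> \<not> regs s' ''i'' < regs s' ''e''))) s"
proof -
  let ?exit = "\<lambda>s'. regs s' ''found'' = 0 \<longrightarrow> regs s' ''tail'' = regs s ''lim'' \<or>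
      (regs s' ''head'' = regs s' ''tail'' \<and> \<not> regs s' ''i'' < regs s' ''e'')"
  let ?src = "regs s ''root''" and ?stamp = "Suc (regs s ''stamp'')" and ?lim = "regs s ''lim''"
  let ?b = "And (Eq (V ''found'') (N 0)) (And (Less (V ''tail'') (V ''lim''))
         (Not (And (Not (Less (V ''i'') (V ''e''))) (Not (Less (V ''head'') (V ''tail''))))))"
  note W = word_bounds_concat[OF wb]
  have "wp W bfs_init (\<lambda>t s'. t \<le> 40 \<and> bfs_state ?src ?stamp s' \<and> regs s' ''stamp'' = ?stamp \<and>
      state_potential s' \<le> 3 * ?lim + 5 \<and> word_bounds W s' \<and> regs s' ''lim'' = ?lim) s"
    using W stamp src lm wb le_imp_less_Suc[OF stamp(2)]
    unfolding bfs_init_def word_bounds_def stores_graph_def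
    by (auto simp: bfs_state_def bfs_potential_def intro!: bfs_ok_init)
  then show ?thesis
    unfolding bfs_def wp_Seq
  proof (rule wp_mono)
    fix t0 :: nat and s0
    assume s0: "t0 \<le> 40 \<and> bfs_state ?src ?stamp s0 \<and> regs s0 ''stamp'' = ?stamp \<and>
      state_potential s0 \<le> 3 * ?lim + 5 \<and> word_bounds W s0 \<and> regs s0 ''lim'' = ?lim"
    show "wp W (While ?b (If (Less (V ''i'') (V ''e'')) scan_arc dequeue))
      (\<lambda>t' s'. t0 + t' \<le> 600 * (?lim + 1) \<and> bfs_state ?src ?stamp s' \<and> regs s' ''stamp'' = ?stamp \<and>
         ?exit s') s0"
    \<comment> \<open>One unit of potential pays for an iteration: at most 45 for the branch, 4 for
      the inner conditional and 19 for the guard.\<close>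
    proof (rule wp_While[where I = "bfs_state ?src ?stamp" and f = "\<lambda>s. 80 * state_potential s"], goal_cases)
      case 1
      then show ?case using s0 by simp
    next
      case (2 s')
      have wb': "word_bounds W s'" using word_bounds_frame[OF 2(2)] s0 by (simp add: mod_regs_loops)
      note b = bfs_ok_bounds[OF 2(1)[unfolded bfs_state_def]]
      have "regs s' ''found'' < W" using b(14) W by simp
      then show ?case using b wb' W unfolding word_bounds_def by auto
    next
      case (3 s')
      have wb': "word_bounds W s'" using word_bounds_frame[OF 3(3)] s0 by (simp add: mod_regs_loops)
      have st: "regs s' ''stamp'' = ?stamp" using frame_regs[OF 3(3), of "''stamp''"] s0 by (simp add: mod_regs_loops)
      have f: "regs s' ''found'' = 0" and l: "regs s' ''tail'' < regs s' ''lim''" using 3(2) by auto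
      note b = bfs_ok_bounds[OF 3(1)[unfolded bfs_state_def]]
      show ?case
      proof (cases "regs s' ''i'' < regs s' ''e''")
        case True
        from scan_arc_wp[OF wb' st stamp(1) 3(1) f True l] True b(7,8) W show ?thesis
          by (auto elim!: wp_mono)
      next
        case False
        then have h: "regs s' ''head'' < regs s' ''tail''" using 3(2) by auto
        from dequeue_wp[OF wb' 3(1) f False h] False b(7,8) W show ?thesis
          by (auto elim!: wp_mono)
      qed
    next
      case (4 t s')
      have l: "regs s' ''lim'' = ?lim" using frame_regs[OF 4(3), of "''lim''"] s0 by (simp add: mod_regs_loops)
      have st: "regs s' ''stamp'' = ?stamp" using frame_regs[OF 4(3), of "''stamp''"] s0 by (simp add: mod_regs_loops)
      note b = bfs_ok_bounds[OF 4(1)[unfolded bfs_state_def]]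
      have p: "state_potential s0 \<le> 3 * ?lim + 5" using s0 by blast
      have "t \<le> 80 * (3 * ?lim + 5) + bcost ?b + 1" using 4(4) p by simp
      with 4(1,2) b(3,4) l s0 st show ?case by auto
    qed
  qed
qed

text \<open>The value \<open>4 * length adj + 4\<close> stands for no cycle yet. It is larger than
  any length the analysis aims at, so proving a good bound on \<open>best\<close> also proves that a
  cycle has been written.\<close>

definition best_ok :: "state \<Rightarrow> bool" where
  "best_ok s \<longleftrightarrow> regs s ''best'' = 4 * length adj + 4 \<or>
     (vcycle (output_nodes s) \<and> regs s ''len'' \<le> regs s ''best'' \<and> regs s ''best'' \<le> 4 * length adj + 4)"

lemma climb_wp:
  assumes bfs: "bfs_inv rad thr src q (arrs s ''lev'') (arrs s ''par'') qh qt x' rest"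
    and ab: "regs s ''a'' \<in> q ` {..<qt}" "regs s ''b'' \<in> q ` {..<qt}" "regs s ''a'' = x" "regs s ''b'' = y"
    and init: "regs s ''len'' = 0" "regs s ''j'' = 0"
    and W: "4 * length adj + 10 \<le> W"
  shows "wp W climb (\<lambda>t s'. regs s' ''a'' = regs s' ''b'' \<and>
      meet_inv (q ` {..<qt}) src (arrs s ''lev'') (arrs s ''par'') x y (regs s' ''a'') (regs s' ''a'')
        (map (arrs s' ''out'') [0..<regs s' ''len'']) (map (arrs s' ''tmp'') [0..<regs s' ''j'']) \<and>
      t \<le> 40 * (arrs s ''lev'' x + arrs s ''lev'' y) + 5) s"
proof -
  let ?vis = "q ` {..<qt}" and ?lev = "arrs s ''lev''" and ?par = "arrs s ''par''"
  let ?I = "\<lambda>s'. meet_inv ?vis src ?lev ?par x y (regs s' ''a'') (regs s' ''b'')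
        (map (arrs s' ''out'') [0..<regs s' ''len'']) (map (arrs s' ''tmp'') [0..<regs s' ''j''])"
  \<comment> \<open>Each iteration replaces one of the two ends by its parent, exactly one level
    below.\<close>
  let ?f = "\<lambda>s'. 40 * (?lev (regs s' ''a'') + ?lev (regs s' ''b''))"
  have qt: "qt \<le> length adj" using bfs_inv_card[OF bfs] by simp
  have vis: "u < length adj \<and> ?lev u < length adj \<and> ?par u < length adj" if "u \<in> ?vis" for u
  proof -
    have *: "v < length adj" if "v \<in> ?vis" for v using that bfs_invD(4)[OF bfs] by auto
    have "?par u < length adj"
      using bfs_inv_cases[OF bfs \<open>u \<in> ?vis\<close>] *[OF that] *[of "?par u"] bfs_invD(7)[OF bfs] by metis
    moreover have "?lev u < length adj" using that bfs_inv_lev_le[OF bfs] qt by force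
    ultimately show ?thesis using *[OF that] by blast
  qed
  have vab: "regs s' ''a'' \<in> ?vis" "regs s' ''b'' \<in> ?vis" "regs s' ''len'' < length adj" "regs s' ''j'' < length adj"
    if "?I s'" for s'
  proof -
    have "x \<in> ?vis" "y \<in> ?vis" using ab by auto
    then show "regs s' ''a'' \<in> ?vis" "regs s' ''b'' \<in> ?vis" "regs s' ''len'' < length adj" "regs s' ''j'' < length adj"
      using that vis[of x] vis[of y] unfolding meet_inv_def by auto
  qed
  show ?thesis
    unfolding climb_def
  proof (rule wp_While[where I = ?I and f = ?f], goal_cases)
    case 1
    show ?case using init meet_inv_init[OF ab(1,2)] ab(3,4) by simp
  next
    case (2 s')
    show ?case using vis[OF vab(1)[OF 2(1)]] vis[OF vab(2)[OF 2(1)]] W by simp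
  next
    case (3 s')
    note v = vab[OF 3(1)]
    have fr: "arrs s' ''lev'' = ?lev" "arrs s' ''par'' = ?par"
      using frame_arrs[OF 3(3)] by simp_all
    have ne: "regs s' ''a'' \<noteq> regs s' ''b''" using 3(2) by simp
    show ?case
    proof (cases "?lev (regs s' ''a'') < ?lev (regs s' ''b'')")
      case True
      note r = meet_inv_right[OF bfs 3(1) True]
      have "?lev (regs s' ''b'') = Suc (?lev (?par (regs s' ''b'')))" using parent(2)[OF bfs v(2) r(1)] .
      with True r(2) v vis[OF v(1)] vis[OF v(2)] W show ?thesis by (simp add: fr)
    next
      case False
      note l = meet_inv_left[OF bfs 3(1) ne]
      have "?lev (regs s' ''a'') = Suc (?lev (?par (regs s' ''a'')))" using parent(2)[OF bfs v(1)] l False by simp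
      with False l(2) v vis[OF v(1)] vis[OF v(2)] W show ?thesis by (simp add: fr)
    qed
  next
    case (4 t s')
    then show ?case using ab(3,4) by simp
  qed
qed

lemma append_rev_wp:
  assumes len: "regs s ''len'' + regs s ''j'' + 10 \<le> W"
    and tmp: "\<And>i. i < regs s ''j'' \<Longrightarrow> arrs s ''tmp'' i < W"
  shows "wp W append_rev (\<lambda>t s'. output_nodes s' = output_nodes s @ rev (map (arrs s ''tmp'') [0..<regs s ''j'']) \<and>
      t \<le> 40 * regs s ''j'' + 4) s"
proof -
  let ?I = "\<lambda>s'. output_nodes s' @ rev (map (arrs s ''tmp'') [0..<regs s' ''j'']) =
      output_nodes s @ rev (map (arrs s ''tmp'') [0..<regs s ''j'']) \<and>
      regs s' ''len'' + regs s' ''j'' = regs s ''len'' + regs s ''j'' \<and> regs s' ''j'' \<le> regs s ''j''"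
  show ?thesis
    unfolding append_rev_def
  proof (rule wp_While[where I = ?I and f = "\<lambda>s'. 40 * regs s' ''j''"], goal_cases)
    case (3 s')
    obtain j where j: "regs s' ''j'' = Suc j" using 3(2) by (cases "regs s' ''j''") auto
    have "arrs s' ''tmp'' = arrs s ''tmp''" using frame_arrs[OF 3(3)] by simp
    with 3(1) j len tmp[of j] show ?case by (simp add: output_nodes_def)
  qed (use len in auto)
qed

lemma record_cycle_wp:
  assumes wb: "word_bounds W s" and ok: "bfs_state src stamp s" and best: "best_ok s"
  shows "wp W record_cycle (\<lambda>t s'. t \<le> 200 * (regs s ''lim'' + 1) \<and>
      best_ok s' \<and> regs s' ''best'' \<le> regs s ''best'' \<and>
      (regs s ''found'' \<noteq> 0 \<longrightarrow>
        regs s' ''best'' \<le> Suc (arrs s ''lev'' (regs s ''x'') + arrs s ''lev'' (regs s ''w'')))) s"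
proof -
  let ?x = "regs s ''x''" and ?w = "regs s ''w''" and ?lev = "arrs s ''lev''" and ?n = "length adj"
  note b = bfs_ok_bounds[OF ok[unfolded bfs_state_def]]
  have W: "length (concat adj) + 4 * ?n + 10 \<le> W" "?n * ?n + 4 * ?n + 10 \<le> W"
    using wb length_concat_le unfolding word_bounds_def by linarith+
  have bestW: "regs s ''best'' \<le> 4 * ?n + 4" using best unfolding best_ok_def by auto
  show ?thesis
  proof (cases "regs s ''found'' \<noteq> 0")
    case False
    then show ?thesis using W best by (simp add: record_cycle_def)
  next
    case True
    let ?q = "arrs s ''q''" and ?qt = "regs s ''tail''" and ?par = "arrs s ''par''"
    let ?L = "Suc (?lev ?x + ?lev ?w)"
    let ?meet = "\<lambda>s'. meet_inv (?q ` {..<?qt}) src ?lev ?par ?x ?w (regs s' ''a'') (regs s' ''a'')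
        (map (arrs s' ''out'') [0..<regs s' ''len'']) (map (arrs s' ''tmp'') [0..<regs s' ''j''])"
    have inv: "bfs_inv (arrs s ''rad'') (regs s ''thr'') src ?q ?lev ?par (regs s ''head'') ?qt ?x
        (map adjs [regs s ''i''..<regs s ''e''])"
      and w: "regs s ''i'' < regs s ''e''" "?w = adjs (regs s ''i'')" "?w \<in> ?q ` {..<?qt}" "?w \<noteq> ?par ?x"
      using ok True unfolding bfs_state_def bfs_ok_def by blast+
    have x: "?x \<in> ?q ` {..<?qt}" using b(13)[OF w(1)] by simp
    have levs: "?lev u < ?n" "u < ?n" "?lev u < ?qt" if "u \<in> ?q ` {..<?qt}" for u
      using that b(10,11) bfs_inv_lev_le[OF inv] by (auto intro: le_less_trans)
    \<comment> \<open>The arc that closes the cycle is still unscanned, so the last conjunct of the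
      invariant rules out that \<open>w\<close> is a child of \<open>x\<close>.\<close>
    have in_rest: "?w \<in> set (map adjs [regs s ''i''..<regs s ''e''])" using w(1,2) by auto
    then have xw: "?w \<in> set (adj ! ?x)" using bfs_invD(16)[OF inv] by blast
    have pw: "?par ?w \<noteq> ?x" using bfs_invD(17)[OF inv w(3)] in_rest by blast
    \<comment> \<open>Levels are smaller than the number of visited vertices, so writing the cycle
      is paid for by the limit of the search.\<close>
    have Lqt: "?L \<le> 2 * ?qt" using levs(3)[OF x] levs(3)[OF w(3)] by linarith
    have found_less: "regs s ''found'' < W" using b(14) W by simp
    show ?thesis
    proof (cases "?L < regs s ''best''")
      case False
      then show ?thesis
        using True W best bestW found_less levs[OF x] levs[OF w(3)]
        by (simp add: record_cycle_def)
    next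
      case L: True
      let ?s0 = "s\<lparr>regs := (regs s)(''best'' := ?L, ''a'' := ?x, ''b'' := ?w, ''len'' := 0, ''j'' := 0)\<rparr>"
      have 1: "wp W climb (\<lambda>t s'. regs s' ''best'' = ?L \<and> regs s' ''a'' = regs s' ''b'' \<and>
          ?meet s' \<and>
          t \<le> 40 * (?lev ?x + ?lev ?w) + 5) ?s0"
      proof (rule wp_frame[OF climb_wp[where s = ?s0 and rad = "arrs s ''rad''"
            and thr = "regs s ''thr''" and src = src and q = ?q and qh = "regs s ''head''" and qt = ?qt
            and x' = ?x and rest = "map adjs [regs s ''i''..<regs s ''e'']" and x = ?x and y = ?w and W = W]], goal_cases)
        case 1
        then show ?case using inv by simp
      next
        case (9 t s')
        have "regs s' ''best'' = ?L" using frame_regs[OF 9(2), of "''best''"] by (simp add: climb_def)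
        with 9(1) show ?case by auto
      qed (use x w(3) W in simp_all)
      have 2: "wp W (''out''\<langle>V ''len''\<rangle> ::= V ''a'' ;; ''len'' ::= Plus (V ''len'') (N 1) ;; append_rev)
          (\<lambda>t s'. t \<le> 40 * ?L + 20 \<and> best_ok s' \<and> regs s' ''best'' = ?L) s1"
        if s1: "regs s1 ''best'' = ?L" and m: "?meet s1" for s1
      proof -
        let ?as = "map (arrs s1 ''out'') [0..<regs s1 ''len'']" and ?bs = "map (arrs s1 ''tmp'') [0..<regs s1 ''j'']"
        let ?s2 = "s1\<lparr>arrs := (arrs s1)(''out'' := (arrs s1 ''out'')(regs s1 ''len'' := regs s1 ''a'')),
            regs := (regs s1)(''len'' := Suc (regs s1 ''len''))\<rparr>"
        note cyc = meet_inv_vcycle[OF inv m xw w(4)[symmetric] pw]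
        have out: "output_nodes ?s2 = ?as @ [regs s1 ''a'']" by (simp add: output_nodes_def)
        have len: "regs s1 ''len'' \<le> ?lev ?x" "regs s1 ''j'' \<le> ?lev ?w"
          using m unfolding meet_inv_def by auto
        have a: "regs s1 ''a'' \<in> ?q ` {..<?qt}" and bs: "set ?bs \<subseteq> ?q ` {..<?qt}"
          using m unfolding meet_inv_def by auto
        have tmp: "arrs s1 ''tmp'' i < W" if "i < regs s1 ''j''" for i
        proof -
          have "arrs s1 ''tmp'' i \<in> ?q ` {..<?qt}" using bs that by auto
          from levs(2)[OF this] W show ?thesis by simp
        qed
        have "wp W append_rev (\<lambda>t s'. t \<le> 40 * ?L + 4 \<and> best_ok s' \<and> regs s' ''best'' = ?L) ?s2"
        proof (rule wp_frame[OF append_rev_wp], goal_cases)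
          case 1
          then show ?case using len levs(1)[OF x] levs(1)[OF w(3)] W by simp
        next
          case (2 i)
          then show ?case using tmp by simp
        next
          case (3 t s')
          have bst: "regs s' ''best'' = ?L"
            using frame_regs[OF 3(2), of "''best''"] s1 by (simp add: append_rev_def)
          have o: "output_nodes s' = ?as @ regs s1 ''a'' # rev ?bs" using 3(1) out by simp
          moreover have "regs s' ''len'' = length (output_nodes s')" by (simp add: output_nodes_def)
          ultimately have "best_ok s'" using cyc bst L bestW unfolding best_ok_def by auto
          with bst 3(1) len show ?case by simp
        qed
        note app = this
        have bnd: "regs s1 ''a'' < W" "regs s1 ''len'' < W" "Suc (regs s1 ''len'') < W" "Suc 0 < W"
          using len levs[OF x] levs(2)[OF a] W by auto
        show ?thesis by (simp add: bnd, rule wp_mono[OF app], auto)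
      qed
      have 3: "wp W (climb ;; ''out''\<langle>V ''len''\<rangle> ::= V ''a'' ;; ''len'' ::= Plus (V ''len'') (N 1) ;; append_rev)
          (\<lambda>t s'. t \<le> 80 * ?L + 25 \<and> best_ok s' \<and> regs s' ''best'' = ?L) ?s0"
        unfolding wp_Seq[of _ climb]
        by (rule wp_mono[OF 1]) (erule conjE, rule wp_mono[OF 2], auto)
      show ?thesis
        using True L W bestW found_less levs[OF x] levs[OF w(3)] Lqt b(3)
        unfolding record_cycle_def
        apply (simp del: wp_Seq add: wp_Seq[of _ "_ ::= _"])
        apply (rule wp_mono[OF 3[unfolded One_nat_def]])
        apply simp
        done
    qed
  qed
qed

lemma mod_record_cycle:
  "mod_regs record_cycle = {''best'', ''a'', ''b'', ''len'', ''j''}"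
  "mod_arrs record_cycle = {''tmp'', ''out''}"
  unfolding record_cycle_def climb_def append_rev_def by auto

lemma mod_bfs:
  "mod_regs bfs = {''w'', ''i'', ''found'', ''tail'', ''x'', ''head'', ''e'', ''stamp''}"
  "mod_arrs bfs = {''mark'', ''lev'', ''par'', ''q''}"
  unfolding bfs_def bfs_init_def by (auto simp: mod_regs_loops)

lemma bfs_state_frame:
  assumes "frame (mod_regs record_cycle) (mod_arrs record_cycle) s s'" "bfs_state src stamp s"
  shows "bfs_state src stamp s'"
  using assms unfolding bfs_state_def mod_record_cycle frame_def by simp

lemma best_ok_frame:
  assumes "frame X Y s s'" "best_ok s" "''best'' \<notin> X" "''len'' \<notin> X" "''out'' \<notin> Y"
  shows "best_ok s'"
  using assms unfolding best_ok_def output_nodes_def frame_def by simp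

definition search_post :: "state \<Rightarrow> state \<Rightarrow> bool" where
  "search_post s s' \<longleftrightarrow>
     bfs_state (regs s ''root'') (regs s' ''stamp'') s' \<and> regs s' ''stamp'' = Suc (regs s ''stamp'') \<and>
     (regs s' ''found'' = 0 \<longrightarrow> regs s' ''tail'' = regs s ''lim'' \<or>
        (regs s' ''head'' = regs s' ''tail'' \<and> \<not> regs s' ''i'' < regs s' ''e'')) \<and>
     best_ok s' \<and> regs s' ''best'' \<le> regs s ''best'' \<and>
     (regs s' ''found'' \<noteq> 0 \<longrightarrow>
       regs s' ''best'' \<le> Suc (arrs s' ''lev'' (regs s' ''x'') + arrs s' ''lev'' (regs s' ''w''))) \<and>
     frame (mod_regs search) (mod_arrs search) s s'"

lemma search_wp:
  assumes wb: "word_bounds W s" and stamp: "Suc (regs s ''stamp'') < W" "\<And>u. arrs s ''mark'' u \<le> regs s ''stamp''"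
    and src: "regs s ''root'' < length adj" and lm: "0 < regs s ''lim''" and best: "best_ok s"
  shows "wp W search (\<lambda>t s'. t \<le> 900 * (regs s ''lim'' + 1) \<and> search_post s s') s"
proof -
  have "wp W search (\<lambda>t s'. t \<le> 900 * (regs s ''lim'' + 1) \<and>
      (frame (mod_regs search) (mod_arrs search) s s' \<longrightarrow> search_post s s')) s"
    unfolding search_def wp_Seq
  proof (rule wp_frame[OF bfs_wp[OF wb stamp src lm]], goal_cases)
    case (1 t s1)
    then have s1: "t \<le> 600 * (regs s ''lim'' + 1)" "bfs_state (regs s ''root'') (Suc (regs s ''stamp'')) s1"
      "regs s1 ''stamp'' = Suc (regs s ''stamp'')"
      "regs s1 ''found'' = 0 \<longrightarrow> regs s1 ''tail'' = regs s ''lim'' \<or>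
         (regs s1 ''head'' = regs s1 ''tail'' \<and> \<not> regs s1 ''i'' < regs s1 ''e'')"
      and fr: "frame (mod_regs bfs) (mod_arrs bfs) s s1" by blast+
    have wb1: "word_bounds W s1" using word_bounds_frame[OF fr wb] by (simp add: mod_bfs)
    have best1: "best_ok s1" using best_ok_frame[OF fr best] by (simp add: mod_bfs)
    have eq: "regs s1 ''lim'' = regs s ''lim''" "regs s1 ''best'' = regs s ''best''"
      using frame_regs[OF fr] by (simp_all add: mod_bfs)
    show ?case
    proof (rule wp_frame[OF record_cycle_wp[OF wb1 s1(2) best1]], goal_cases)
      case (1 t' s2)
      have "regs s2 ''stamp'' = regs s1 ''stamp''" "regs s2 ''found'' = regs s1 ''found''"
        "regs s2 ''tail'' = regs s1 ''tail''" "regs s2 ''head'' = regs s1 ''head''"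
        "regs s2 ''i'' = regs s1 ''i''" "regs s2 ''e'' = regs s1 ''e''" "regs s2 ''x'' = regs s1 ''x''"
        "regs s2 ''w'' = regs s1 ''w''" "arrs s2 ''lev'' = arrs s1 ''lev''"
        using frame_regs[OF 1(2)] frame_arrs[OF 1(2)] by (simp_all add: mod_record_cycle)
      with 1(1) s1 eq bfs_state_frame[OF 1(2) s1(2)] show ?case
        unfolding search_post_def search_def by auto
    qed
  qed
  then show ?thesis by (rule wp_frame) (simp add: search_def)
qed

lemma search_post_frame: "search_post s s' \<Longrightarrow> frame (mod_regs search) (mod_arrs search) s s'"
  unfolding search_post_def by blast

lemma search_post_marks: "search_post s s' \<Longrightarrow> arrs s' ''mark'' u \<le> regs s' ''stamp''"
  unfolding search_post_def bfs_state_def bfs_ok_def by blast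

text \<open>Were all arcs below level \<open>D\<close> tree arcs, the cycle could not exist. Hence
  the current vertex \<open>x\<close> has level below \<open>D\<close>, and every visited vertex has
  level at most \<open>D\<close>. A non-tree arc then gives at most (D - 1) + D + 1 = 2 D. Without
  one, an exhausted queue would make the tree condition hold for all \<open>D\<close>, so the limit
  must have stopped the search; a limit of at least 2 ensures that the root was dequeued.\<close>

lemma search_outcome:
  assumes post: "search_post s s'" and lm: "2 \<le> regs s ''lim''"
    and cs: "vcycle cs" "\<And>c. c \<in> set cs \<Longrightarrow> regs s ''thr'' \<le> arrs s ''rad'' c"
    and near: "cs ! 0 \<in> ball (\<lambda>u. regs s ''thr'' \<le> arrs s ''rad'' u) (regs s ''root'') d"
  defines "D \<equiv> d + (length cs + 1) div 2"
  shows "(regs s' ''found'' \<noteq> 0 \<and> regs s' ''best'' \<le> 2 * D) \<or>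
    (regs s' ''found'' = 0 \<and> regs s' ''tail'' = regs s ''lim'' \<and> 0 < regs s' ''head'' \<and>
      (\<forall>j<regs s ''lim''. arrs s' ''lev'' (arrs s' ''q'' j) \<le> D))"
proof -
  let ?rad = "arrs s ''rad''" and ?thr = "regs s ''thr''" and ?src = "regs s ''root''" and ?lim = "regs s ''lim''"
    and ?q = "arrs s' ''q''" and ?lev = "arrs s' ''lev''" and ?par = "arrs s' ''par''" and ?qh = "regs s' ''head''"
    and ?qt = "regs s' ''tail''" and ?x = "regs s' ''x''" and ?w = "regs s' ''w''"
    and ?rest = "map adjs [regs s' ''i''..<regs s' ''e'']"
  note post' = post[unfolded search_post_def]
  have fr: "arrs s' ''rad'' = ?rad" "regs s' ''thr'' = ?thr" "regs s' ''lim'' = ?lim"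
    using frame_regs[OF search_post_frame[OF post]] frame_arrs[OF search_post_frame[OF post]]
    by (simp_all add: mod_search)
  have ok: "bfs_ok ?rad ?thr ?src ?lim (regs s' ''stamp'') ?q ?lev ?par (arrs s' ''mark'')
      ?qh ?qt ?x (regs s' ''i'') (regs s' ''e'') ?w (regs s' ''found'')"
    using post' unfolding bfs_state_def fr by blast
  then have inv: "bfs_inv ?rad ?thr ?src ?q ?lev ?par ?qh ?qt ?x ?rest" unfolding bfs_ok_def by blast
  note b = bfs_ok_bounds[OF ok]
  have no_tree: False if "tree_below (\<lambda>u. ?thr \<le> ?rad u) (?q ` {..<?qt}) ?src ?lev ?par D"
    using tree_below_no_cycle[OF that cs near] unfolding D_def by simp
  have x_less: "?lev ?x < D" if "0 < ?qh"
    using no_tree bfs_inv_tree_below[OF inv, of D] that by fastforce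
  have last: "?lev (?q j) \<le> Suc (?lev ?x)" if "0 < ?qh" "j < ?qt" for j
  proof -
    have "j \<le> ?qt - 1" "?qt - 1 < ?qt" using that(2) by auto
    from bfs_invD(9)[OF inv this] bfs_invD(12)[OF inv that(1)] show ?thesis by simp
  qed
  show ?thesis
  proof (cases "regs s' ''found'' = 0")
    case False
    then have w: "regs s' ''i'' < regs s' ''e''" "?w \<in> ?q ` {..<?qt}"
      using ok unfolding bfs_ok_def by blast+
    have h: "0 < ?qh" using b(13)[OF w(1)] by simp
    have "?lev ?w \<le> Suc (?lev ?x)" using w(2) last[OF h] by auto
    then have "Suc (?lev ?x + ?lev ?w) \<le> 2 * D" using x_less[OF h] by simp
    with post' False show ?thesis by (meson le_trans)
  next
    case True
    have "?rest \<noteq> [] \<or> ?qh \<noteq> ?qt" using no_tree bfs_inv_tree_below[OF inv, of D] by blast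
    then have qt: "?qt = ?lim" using post' True by auto
    have h: "0 < ?qh" using bfs_invD(10)[OF inv] qt lm by (cases ?qh) auto
    have "?lev (?q j) \<le> D" if "j < ?lim" for j using last[OF h, of j] x_less[OF h] that qt by simp
    with True qt h show ?thesis by simp
  qed
qed

end

section \<open>The balls of the first \<open>s\<close> visited vertices\<close>

text \<open>Each ball is kept twice: \<open>B\<close> lists its elements, so that removing it takes
  time linear in its size, and \<open>mem\<close> decides in constant time whether a chosen vertex
  hits it.\<close>

definition store_ball :: com where
  "store_ball =
     ''c'' ::= N 0 ;;
     While (Less (V ''c'') (V ''s''))
       (''u'' ::= Read ''q'' (V ''c'') ;;
        ''B''\<langle>Plus (Times (V ''v'') (V ''s'')) (V ''c'')\<rangle> ::= V ''u'' ;;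
        ''mem''\<langle>Plus (Times (V ''v'') (V ''n'')) (V ''u'')\<rangle> ::= N 1 ;;
        ''cnt''\<langle>V ''u''\<rangle> ::= Plus (Read ''cnt'' (V ''u'')) (N 1) ;;
        ''c'' ::= Plus (V ''c'') (N 1))"

definition uncount_ball :: com where
  "uncount_ball =
     ''c'' ::= N 0 ;;
     While (Less (V ''c'') (V ''s''))
       (''u'' ::= Read ''B'' (Plus (Times (V ''v'') (V ''s'')) (V ''c'')) ;;
        ''cnt''\<langle>V ''u''\<rangle> ::= Minus (Read ''cnt'' (V ''u'')) (N 1) ;;
        ''c'' ::= Plus (V ''c'') (N 1))"

definition find_max :: com where
  "find_max =
     ''z'' ::= N 0 ;; ''u'' ::= N 0 ;;
     While (Less (V ''u'') (V ''n''))
       (If (Less (Read ''cnt'' (V ''z'')) (Read ''cnt'' (V ''u''))) (''z'' ::= V ''u'') Skip ;;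
        ''u'' ::= Plus (V ''u'') (N 1))"

lemma row_less: "v < n \<Longrightarrow> c < (m :: nat) \<Longrightarrow> v * m + c < n * m"
  by (metis add.commute add_less_cancel_right less_le_trans mult_Suc mult_le_mono1 Suc_leI)

lemma store_ball_wp:
  assumes regs: "regs s ''s'' = S" "regs s ''v'' = v" "regs s ''n'' = n"
    and W: "v < n" "S \<le> n" "n * n + 2 * n + 10 \<le> W"
    and q: "\<And>j. j < S \<Longrightarrow> arrs s ''q'' j < n" "inj_on (arrs s ''q'') {..<S}"
    and cnt: "\<And>u. u < n \<Longrightarrow> arrs s ''cnt'' u \<le> n"
  shows "wp W store_ball (\<lambda>t s'. t \<le> 60 * S + 10 \<and>
      arrs s' ''B'' = (\<lambda>i. if v * S \<le> i \<and> i < v * S + S then arrs s ''q'' (i - v * S) else arrs s ''B'' i) \<and>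
      arrs s' ''mem'' = (\<lambda>i. if i \<in> (\<lambda>j. v * n + arrs s ''q'' j) ` {..<S} then 1 else arrs s ''mem'' i) \<and>
      arrs s' ''cnt'' = (\<lambda>u. arrs s ''cnt'' u + (if u \<in> arrs s ''q'' ` {..<S} then 1 else 0))) s"
proof -
  let ?q = "arrs s ''q''"
  let ?I = "\<lambda>s'. regs s' ''c'' \<le> S \<and>
      arrs s' ''B'' = (\<lambda>i. if v * S \<le> i \<and> i < v * S + regs s' ''c'' then ?q (i - v * S) else arrs s ''B'' i) \<and>
      arrs s' ''mem'' = (\<lambda>i. if i \<in> (\<lambda>j. v * n + ?q j) ` {..<regs s' ''c''} then 1 else arrs s ''mem'' i) \<and>
      arrs s' ''cnt'' = (\<lambda>u. arrs s ''cnt'' u + (if u \<in> ?q ` {..<regs s' ''c''} then 1 else 0))"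
  have W0: "0 < W" using W by simp
  show ?thesis
    unfolding store_ball_def
  proof (simp del: One_nat_def add: W0, rule wp_While[where I = ?I and f = "\<lambda>s'. 60 * (S - regs s' ''c'')"], goal_cases)
    case (2 s')
    have "regs s' ''s'' = S" using frame_regs[OF 2(2), of "''s''"] regs by simp
    with 2 W show ?case by simp
  next
    case (3 s')
    have fr: "regs s' ''s'' = S" "regs s' ''v'' = v" "regs s' ''n'' = n" "arrs s' ''q'' = ?q"
      using frame_regs[OF 3(3)] frame_arrs[OF 3(3)] regs by simp_all
    have c: "regs s' ''c'' < S" using 3(2) fr by simp
    let ?c = "regs s' ''c''"
    \<comment> \<open>By injectivity the current vertex has not occurred before, so each count grows
      by at most 1.\<close>
    have "?q j \<noteq> ?q ?c" if "j < ?c" for j using inj_onD[OF q(2), of j ?c] c that by auto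
    then have u: "?q ?c < n" "?q ?c \<notin> ?q ` {..<?c}" using q(1) c by (auto, metis)
    have "v * S + ?c < n * n"
      using row_less[OF W(1) c] mult_le_mono2[OF W(2), of n] by (rule less_le_trans)
    moreover have "v * n + ?q ?c < n * n" using row_less[OF W(1) u(1)] .
    moreover have "arrs s ''cnt'' (?q ?c) \<le> n" using cnt u by simp
    ultimately have b: "?c < W" "Suc ?c < W" "?q ?c < W" "v * S + ?c < W" "v * S < W" "v * n < W" "v < W" "S < W" "n < W"
      "v * n + ?q ?c < W" "Suc (arrs s ''cnt'' (?q ?c)) < W" "arrs s ''cnt'' (?q ?c) < W" "Suc 0 < W"
      using W c by auto
    have B: "(\<lambda>i. if v * S \<le> i \<and> i < v * S + ?c then ?q (i - v * S) else arrs s ''B'' i)(v * S + ?c := ?q ?c) =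
        (\<lambda>i. if v * S \<le> i \<and> i < Suc (v * S + ?c) then ?q (i - v * S) else arrs s ''B'' i)"
      by (auto simp: fun_eq_iff less_Suc_eq)
    show ?case using 3(1) c u b by (auto simp: fr B lessThan_Suc fun_eq_iff)
  next
    case (4 t s')
    have "regs s' ''s'' = S" using frame_regs[OF 4(3), of "''s''"] regs by simp
    with 4 show ?case by auto
  qed auto
qed

lemma uncount_ball_wp:
  assumes regs: "regs s ''s'' = S" "regs s ''v'' = v"
    and W: "v < n" "S \<le> n" "n * n + 2 * n + 10 \<le> W"
    and B: "\<And>j. j < S \<Longrightarrow> arrs s ''B'' (v * S + j) < n" "inj_on (\<lambda>j. arrs s ''B'' (v * S + j)) {..<S}"
    and cnt: "\<And>u. u < n \<Longrightarrow> arrs s ''cnt'' u \<le> n"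
  shows "wp W uncount_ball (\<lambda>t s'. t \<le> 60 * S + 10 \<and>
      arrs s' ''cnt'' = (\<lambda>u. arrs s ''cnt'' u - (if u \<in> (\<lambda>j. arrs s ''B'' (v * S + j)) ` {..<S} then 1 else 0))) s"
proof -
  let ?q = "\<lambda>j. arrs s ''B'' (v * S + j)"
  let ?I = "\<lambda>s'. regs s' ''c'' \<le> S \<and>
      arrs s' ''cnt'' = (\<lambda>u. arrs s ''cnt'' u - (if u \<in> ?q ` {..<regs s' ''c''} then 1 else 0))"
  have W0: "0 < W" using W by simp
  show ?thesis
    unfolding uncount_ball_def
  proof (simp del: One_nat_def add: W0, rule wp_While[where I = ?I and f = "\<lambda>s'. 60 * (S - regs s' ''c'')"], goal_cases)
    case (2 s')
    have "regs s' ''s'' = S" using frame_regs[OF 2(2), of "''s''"] regs by simp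
    with 2 W show ?case by simp
  next
    case (3 s')
    have fr: "regs s' ''s'' = S" "regs s' ''v'' = v" "arrs s' ''B'' = arrs s ''B''"
      using frame_regs[OF 3(3)] frame_arrs[OF 3(3)] regs by simp_all
    have c: "regs s' ''c'' < S" using 3(2) fr by simp
    let ?c = "regs s' ''c''"
    have "?q j \<noteq> ?q ?c" if "j < ?c" for j using inj_onD[OF B(2), of j ?c] c that by auto
    then have u: "?q ?c < n" "?q ?c \<notin> ?q ` {..<?c}" using B(1) c by (auto, metis)
    have "v * S + ?c < n * n"
      using row_less[OF W(1) c] mult_le_mono2[OF W(2), of n] by (rule less_le_trans)
    moreover have "arrs s ''cnt'' (?q ?c) \<le> n" using cnt u by simp
    ultimately have b: "?c < W" "Suc ?c < W" "?q ?c < W" "v * S + ?c < W" "v * S < W" "v < W" "S < W"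
      "arrs s ''cnt'' (?q ?c) < W" "Suc 0 < W"
      using W c u by auto
    show ?case using 3(1) c u b by (auto simp: fr lessThan_Suc fun_eq_iff)
  next
    case (4 t s')
    have "regs s' ''s'' = S" using frame_regs[OF 4(3), of "''s''"] regs by simp
    with 4 show ?case by auto
  qed auto
qed

lemma find_max_wp:
  assumes n: "regs s ''n'' = n" "0 < n" and W: "n + 10 \<le> W" and cnt: "\<And>u. u < n \<Longrightarrow> arrs s ''cnt'' u < W"
  shows "wp W find_max (\<lambda>t s'. t \<le> 40 * n + 10 \<and> regs s' ''z'' < n \<and>
      (\<forall>u<n. arrs s ''cnt'' u \<le> arrs s ''cnt'' (regs s' ''z''))) s"
proof -
  let ?I = "\<lambda>s'. regs s' ''u'' \<le> n \<and> regs s' ''z'' < n \<and>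
      (\<forall>u<regs s' ''u''. arrs s ''cnt'' u \<le> arrs s ''cnt'' (regs s' ''z''))"
  have W0: "0 < W" using W by simp
  show ?thesis
    unfolding find_max_def
  proof (simp del: One_nat_def add: W0, rule wp_While[where I = ?I and f = "\<lambda>s'. 40 * (n - regs s' ''u'')"], goal_cases)
    case (2 s')
    have "regs s' ''n'' = n" using frame_regs[OF 2(2), of "''n''"] n by simp
    with 2 W show ?case by simp
  next
    case (3 s')
    have fr: "regs s' ''n'' = n" "arrs s' ''cnt'' = arrs s ''cnt''"
      using frame_regs[OF 3(3)] frame_arrs[OF 3(3)] n by simp_all
    have u: "regs s' ''u'' < n" using 3(2) fr by simp
    then have b: "regs s' ''u'' < W" "Suc (regs s' ''u'') < W" "regs s' ''z'' < W" "Suc 0 < W"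
      "arrs s ''cnt'' (regs s' ''u'') < W" "arrs s ''cnt'' (regs s' ''z'') < W"
      using 3(1) W cnt by auto
    show ?case using 3(1) u b by (auto simp: fr less_Suc_eq)
  next
    case (4 t s')
    have "regs s' ''n'' = n" using frame_regs[OF 4(3), of "''n''"] n by simp
    with 4 show ?case by auto
  qed (use n in auto)
qed

section \<open>Counting uncovered balls\<close>

definition ball_of :: "nat \<Rightarrow> (nat \<Rightarrow> nat) \<Rightarrow> nat \<Rightarrow> nat set" where
  "ball_of S B v = (\<lambda>j. B (v * S + j)) ` {..<S}"

definition uncovered :: "nat \<Rightarrow> (nat \<Rightarrow> nat) \<Rightarrow> nat set" where
  "uncovered n unc = {v. v < n \<and> unc v = 1}"

text \<open>
  Row \<open>v\<close> of \<open>B\<close> lists the ball of \<open>v\<close>, row \<open>v\<close> of \<open>mem\<close> is its characteristic function, and \<open>cnt u\<close>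
  counts the uncovered balls that contain \<open>u\<close>. Vertices with \<open>rad v = 0\<close> have no ball.
\<close>

definition cover_inv :: "nat \<Rightarrow> nat \<Rightarrow> (nat \<Rightarrow> nat) \<Rightarrow> (nat \<Rightarrow> nat) \<Rightarrow> (nat \<Rightarrow> nat) \<Rightarrow> (nat \<Rightarrow> nat) \<Rightarrow>
    (nat \<Rightarrow> nat) \<Rightarrow> bool" where
  "cover_inv n S rad unc B mem cnt \<longleftrightarrow>
     (\<forall>v<n. unc v = 1 \<longrightarrow> 0 < rad v) \<and> (\<forall>v<n. unc v \<le> 1) \<and> (\<forall>v<n. \<forall>u<n. mem (v * n + u) \<le> 1) \<and>
     (\<forall>v<n. 0 < rad v \<longrightarrow> inj_on (\<lambda>j. B (v * S + j)) {..<S} \<and> ball_of S B v \<subseteq> {..<n} \<and>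
        (\<forall>u<n. mem (v * n + u) = 1 \<longleftrightarrow> u \<in> ball_of S B v)) \<and>
     (\<forall>u<n. cnt u = card {v \<in> uncovered n unc. u \<in> ball_of S B v})"

lemma finite_uncovered: "finite (uncovered n unc)"
  unfolding uncovered_def by simp

lemma card_uncovered_le: "card {v \<in> uncovered n unc. P v} \<le> n"
proof -
  have "card {v \<in> uncovered n unc. P v} \<le> card {..<n}"
    by (rule card_mono) (auto simp: uncovered_def)
  then show ?thesis by simp
qed

lemma cover_inv_cnt_le: "cover_inv n S rad unc B mem cnt \<Longrightarrow> u < n \<Longrightarrow> cnt u \<le> n"
  unfolding cover_inv_def using card_uncovered_le by metis

lemma row_eq_iff:
  assumes "u < n" "u' < (n :: nat)"
  shows "v * n + u = v' * n + u' \<longleftrightarrow> v = v' \<and> u = u'"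
proof
  assume eq: "v * n + u = v' * n + u'"
  have "(v * n + u) div n = v" "(v' * n + u') div n = v'" using assms by auto
  with eq show "v = v' \<and> u = u'" by auto
qed auto

lemma store_row:
  defines "store q v S B \<equiv> \<lambda>i :: nat. if v * S \<le> i \<and> i < v * S + S then q (i - v * S) else B i :: nat"
  shows store_row_other: "v' \<noteq> v \<Longrightarrow> j < S \<Longrightarrow> store q v S B (v' * S + j) = B (v' * S + j)"
    and ball_of_store_other: "v' \<noteq> v \<Longrightarrow> ball_of S (store q v S B) v' = ball_of S B v'"
    and ball_of_store: "ball_of S (store q v S B) v = q ` {..<S}"
proof -
  show old: "store q v S B (v' * S + j) = B (v' * S + j)" if "v' \<noteq> v" "j < S" for v' j
  proof -
    \<comment> \<open>An index lying in both rows would have two representations by quotient and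
      remainder.\<close>
    have False if "v * S \<le> v' * S + j" "v' * S + j < v * S + S"
    proof -
      have "v * S + (v' * S + j - v * S) = v' * S + j" "v' * S + j - v * S < S" using that by auto
      with row_eq_iff[OF \<open>j < S\<close>, of "v' * S + j - v * S" v' v] \<open>v' \<noteq> v\<close> show False by auto
    qed
    then show ?thesis unfolding store_def by auto
  qed
  show "ball_of S (store q v S B) v' = ball_of S B v'" if "v' \<noteq> v" for v'
    unfolding ball_of_def using old[OF that] by (intro image_cong) auto
  show "ball_of S (store q v S B) v = q ` {..<S}"
    unfolding ball_of_def store_def by (intro image_cong) auto
qed

lemma cover_inv_store:
  assumes inv: "cover_inv n S rad unc B mem cnt"
    and v: "v < n" "rad v = 0" "0 < r" and row: "\<And>u. u < n \<Longrightarrow> mem (v * n + u) = 0"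
    and q: "inj_on q {..<S}" "\<And>j. j < S \<Longrightarrow> q j < n"
  shows "cover_inv n S (rad(v := r)) (unc(v := 1))
      (\<lambda>i. if v * S \<le> i \<and> i < v * S + S then q (i - v * S) else B i)
      (\<lambda>i. if i \<in> (\<lambda>j. v * n + q j) ` {..<S} then 1 else mem i)
      (\<lambda>u. cnt u + (if u \<in> q ` {..<S} then 1 else 0))" (is "cover_inv n S ?rad ?unc ?B ?mem ?cnt")
proof -
  note old = store_row_other[where v = v and S = S and q = q and B = B]
  note b1 = ball_of_store_other[where v = v and S = S and q = q and B = B] and b2 = ball_of_store[where v = v and S = S and q = q and B = B]
  have new: "?B (v * S + j) = q j" if "j < S" for j using that by simp
  have unc: "unc v \<noteq> 1" using inv v unfolding cover_inv_def by auto
  have m1: "?mem (v' * n + u) = mem (v' * n + u)" if "v' \<noteq> v" "u < n" for v' u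
    using that q(2) row_eq_iff[of u n] by auto
  have m2: "?mem (v * n + u) = 1 \<longleftrightarrow> u \<in> q ` {..<S}" if "u < n" for u
    using that q(2) row[OF that] by auto
  have "inj_on (\<lambda>j. ?B (v' * S + j)) {..<S} \<and> ball_of S ?B v' \<subseteq> {..<n} \<and>
        (\<forall>u<n. ?mem (v' * n + u) = 1 \<longleftrightarrow> u \<in> ball_of S ?B v')" if "v' < n" "0 < ?rad v'" for v'
  proof (cases "v' = v")
    case True
    have "inj_on (\<lambda>j. ?B (v * S + j)) {..<S}" using q(1) new by (simp add: inj_on_def)
    moreover have "q ` {..<S} \<subseteq> {..<n}" using q(2) by auto
    ultimately show ?thesis unfolding True b2 using m2 by blast
  next
    case False
    have "inj_on (\<lambda>j. ?B (v' * S + j)) {..<S} \<longleftrightarrow> inj_on (\<lambda>j. B (v' * S + j)) {..<S}"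
      using old[OF False] by (intro inj_on_cong) auto
    with that False b1[OF False] m1[OF False] inv show ?thesis unfolding cover_inv_def by simp
  qed
  moreover have "?cnt u = card {v' \<in> uncovered n ?unc. u \<in> ball_of S ?B v'}" if "u < n" for u
  proof -
    let ?A = "{v' \<in> uncovered n unc. u \<in> ball_of S B v'}"
    have "{v' \<in> uncovered n ?unc. u \<in> ball_of S ?B v'} = (if u \<in> q ` {..<S} then insert v ?A else ?A)"
      using unc v(1) b1 b2 by (auto simp: uncovered_def split: if_splits)
    moreover have "v \<notin> ?A" using unc by (simp add: uncovered_def)
    moreover have "cnt u = card ?A" using inv that unfolding cover_inv_def by blast
    ultimately show ?thesis using finite_uncovered[of n unc] by simp
  qed
  moreover have "?mem (v' * n + u) \<le> 1" if "v' < n" "u < n" for v' u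
    using inv that unfolding cover_inv_def by auto
  moreover have "?unc v' = 1 \<longrightarrow> 0 < ?rad v'" "?unc v' \<le> 1" if "v' < n" for v'
    using inv v(3) that unfolding cover_inv_def by auto
  ultimately show "cover_inv n S ?rad ?unc ?B ?mem ?cnt"
    unfolding cover_inv_def by blast
qed

lemma cover_inv_uncount:
  assumes inv: "cover_inv n S rad unc B mem cnt" and v: "v < n" "unc v = 1"
  shows "cover_inv n S rad (unc(v := 0)) B mem (\<lambda>u. cnt u - (if u \<in> ball_of S B v then 1 else 0))"
    and "card (uncovered n (unc(v := 0))) + 1 = card (uncovered n unc)"
proof -
  have "cnt u - (if u \<in> ball_of S B v then 1 else 0) = card {v' \<in> uncovered n (unc(v := 0)). u \<in> ball_of S B v'}"
    if "u < n" for u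
  proof -
    let ?A = "{v' \<in> uncovered n unc. u \<in> ball_of S B v'}"
    have "{v' \<in> uncovered n (unc(v := 0)). u \<in> ball_of S B v'} = ?A - {v}"
      by (auto simp: uncovered_def)
    moreover have "v \<in> ?A \<longleftrightarrow> u \<in> ball_of S B v" using v by (simp add: uncovered_def)
    moreover have "cnt u = card ?A" using inv that unfolding cover_inv_def by blast
    ultimately show ?thesis using finite_uncovered[of n unc] by (simp add: card_Diff_singleton_if)
  qed
  then show "cover_inv n S rad (unc(v := 0)) B mem (\<lambda>u. cnt u - (if u \<in> ball_of S B v then 1 else 0))"
    using inv unfolding cover_inv_def by auto
  have "uncovered n (unc(v := 0)) = uncovered n unc - {v}" by (auto simp: uncovered_def)
  moreover have "v \<in> uncovered n unc" using v by (simp add: uncovered_def)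
  ultimately show "card (uncovered n (unc(v := 0))) + 1 = card (uncovered n unc)"
    using finite_uncovered[of n unc] by (metis Suc_eq_plus1 card_Suc_Diff1)
qed

text \<open>Double counting of the pairs of an uncovered ball and one of its elements. Applied to
  the maximal count, it shows that the greedy choice hits at least an S/n share of the uncovered
  balls.\<close>

lemma cover_inv_average:
  assumes inv: "cover_inv n S rad unc B mem cnt" and max: "\<And>u. u < n \<Longrightarrow> cnt u \<le> m"
  shows "card (uncovered n unc) * S \<le> n * m"
proof -
  let ?U = "uncovered n unc"
  have ball: "card (ball_of S B v) = S" "ball_of S B v \<subseteq> {..<n}" if "v \<in> ?U" for v
    using that inv unfolding cover_inv_def uncovered_def ball_of_def by (auto simp: card_image)
  have "card ?U * S = (\<Sum>v\<in>?U. card (ball_of S B v))" using ball(1) by simp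
  also have "\<dots> = (\<Sum>v\<in>?U. \<Sum>u<n. if u \<in> ball_of S B v then 1 else 0)"
    using ball(2) by (intro sum.cong) (auto simp: sum.If_cases Int_absorb1)
  also have "\<dots> = (\<Sum>u<n. \<Sum>v\<in>?U. if u \<in> ball_of S B v then 1 else 0)" by (rule sum.swap)
  also have "\<dots> = (\<Sum>u<n. cnt u)"
  proof (rule sum.cong[OF refl])
    fix u assume "u \<in> {..<n}"
    then have "cnt u = card {v \<in> ?U. u \<in> ball_of S B v}" using inv unfolding cover_inv_def by blast
    also have "\<dots> = (\<Sum>v | v \<in> ?U \<and> u \<in> ball_of S B v. 1)" by simp
    also have "\<dots> = (\<Sum>v\<in>?U. if u \<in> ball_of S B v then 1 else 0)"
      using finite_uncovered by (rule sum.inter_filter)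
    finally show "(\<Sum>v\<in>?U. if u \<in> ball_of S B v then 1 else 0) = cnt u" by (rule sym)
  qed
  also have "\<dots> \<le> n * m" using max sum_bounded_above[of "{..<n}" cnt m] by simp
  finally show ?thesis .
qed

section \<open>The three phases\<close>

definition call_search :: "aexp \<Rightarrow> aexp \<Rightarrow> aexp \<Rightarrow> com" where
  "call_search r l th = ''root'' ::= r ;; ''lim'' ::= l ;; ''thr'' ::= th ;; search"

definition record_ball :: com where
  "record_ball =
     ''rad''\<langle>V ''v''\<rangle> ::= Read ''lev'' (Read ''q'' (Minus (V ''s'') (N 1))) ;;
     ''unc''\<langle>V ''v''\<rangle> ::= N 1 ;;
     store_ball"

definition ball_iteration :: com where
  "ball_iteration =
     call_search (V ''v'') (V ''s'') (N 0) ;;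
     If (Eq (V ''found'') (N 0)) record_ball Skip ;;
     ''v'' ::= Plus (V ''v'') (N 1)"

definition ball_phase :: com where
  "ball_phase = ''v'' ::= N 0 ;; While (Less (V ''v'') (V ''n'')) ball_iteration"

definition uncount_balls :: com where
  "uncount_balls =
     ''v'' ::= N 0 ;;
     While (Less (V ''v'') (V ''n''))
       (If (And (Eq (Read ''unc'' (V ''v'')) (N 1))
             (Eq (Read ''mem'' (Plus (Times (V ''v'') (V ''n'')) (V ''z''))) (N 1)))
          (''unc''\<langle>V ''v''\<rangle> ::= N 0 ;; uncount_ball) Skip ;;
        ''v'' ::= Plus (V ''v'') (N 1))"

text \<open>At most \<open>n\<close> vertices can be visited, so the limit \<open>n + 1\<close>
  never stops a search. The counter \<open>it\<close> ties the state to the decay of the number of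
  uncovered balls.\<close>

definition hit_iteration :: com where
  "hit_iteration =
     find_max ;;
     If (Eq (Read ''cnt'' (V ''z'')) (N 0)) (''go'' ::= N 0)
       (''it'' ::= Plus (V ''it'') (N 1) ;;
        call_search (V ''z'') (Plus (V ''n'') (N 1)) (N 0) ;;
        uncount_balls)"

definition hit_phase :: com where
  "hit_phase = ''go'' ::= N 1 ;; ''it'' ::= N 0 ;; While (Eq (V ''go'') (N 1)) hit_iteration"

definition local_phase :: com where
  "local_phase =
     ''v'' ::= N 0 ;;
     While (Less (V ''v'') (V ''n''))
       (call_search (V ''v'') (V ''M'') (Read ''rad'' (V ''v'')) ;; ''v'' ::= Plus (V ''v'') (N 1))"

lemma mod_regs_phases:
  "mod_regs (call_search r l th) = {''root'', ''lim'', ''thr''} \<union> mod_regs search"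
  "mod_regs store_ball = {''c'', ''u''}" "mod_regs uncount_ball = {''c'', ''u''}"
  "mod_regs find_max = {''z'', ''u''}"
  "mod_regs record_ball = {''c'', ''u''}"
  "mod_regs uncount_balls = {''v'', ''c'', ''u''}"
  unfolding call_search_def store_ball_def uncount_ball_def find_max_def record_ball_def uncount_balls_def
  by auto

lemma mod_arrs_phases:
  "mod_arrs (call_search r l th) = mod_arrs search"
  "mod_arrs store_ball = {''B'', ''mem'', ''cnt''}" "mod_arrs uncount_ball = {''cnt''}"
  "mod_arrs find_max = {}"
  "mod_arrs record_ball = {''rad'', ''unc'', ''B'', ''mem'', ''cnt''}"
  "mod_arrs uncount_balls = {''unc'', ''cnt''}"
  unfolding call_search_def store_ball_def uncount_ball_def find_max_def record_ball_def uncount_balls_def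
  by auto

text \<open>\<open>cs\<close> may be any cycle here; the final instantiation takes a shortest one.
  \<open>decay\<close> expresses that fewer than one uncovered ball can be left after
  \<open>M\<close> greedy choices.\<close>

locale girth_run = adjacency +
  fixes cs :: "nat list" and k W S M :: nat
  assumes cs: "vcycle cs"
    and reach: "u < length adj \<Longrightarrow> \<exists>d. cs ! 0 \<in> ball (\<lambda>_. True) u d"
    and k: "2 \<le> k" and S: "2 \<le> S" "S \<le> length adj" and M: "M = S ^ (k - 1)"
    and W: "length adj * length adj + 10 * length adj + M + 20 \<le> W"
    and decay: "real (length adj) * (1 - real S / real (length adj)) ^ M < 1"
begin

abbreviation n :: nat where "n \<equiv> length adj"
abbreviation half :: nat where "half \<equiv> (length cs + 1) div 2"

lemma S_le_M: "S \<le> M"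
  using S k unfolding M by (intro self_le_power) auto

definition base :: "state \<Rightarrow> bool" where
  "base s \<longleftrightarrow> stores_graph s \<and> regs s ''s'' = S \<and> regs s ''M'' = M \<and> (\<forall>v<n. arrs s ''rad'' v < n) \<and>
     (\<forall>u. arrs s ''mark'' u \<le> regs s ''stamp'') \<and> best_ok s"

lemma base_frame:
  assumes "base s" "frame X Y s s'" "''n'' \<notin> X" "''s'' \<notin> X" "''M'' \<notin> X" "''stamp'' \<notin> X" "''best'' \<notin> X"
    "''len'' \<notin> X" "''off'' \<notin> Y" "''adj'' \<notin> Y" "''mark'' \<notin> Y" "''out'' \<notin> Y"
    and "\<And>v. v < n \<Longrightarrow> arrs s' ''rad'' v < n"
  shows "base s'"
  using assms best_ok_frame[of X Y s s'] unfolding base_def stores_graph_def frame_def by simp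

lemma baseD:
  assumes "base s"
  shows "regs s ''n'' = n" "regs s ''s'' = S" "regs s ''M'' = M" "\<And>v. v < n \<Longrightarrow> arrs s ''rad'' v < n"
    "\<And>u. arrs s ''mark'' u \<le> regs s ''stamp''" "best_ok s"
  using assms unfolding base_def stores_graph_def by blast+

lemma base_update:
  assumes "base s" "x \<notin> {''n'', ''s'', ''M'', ''stamp'', ''best'', ''len''}"
  shows "base (s\<lparr>regs := (regs s)(x := a)\<rparr>)"
  using assms by (intro base_frame[OF assms(1), of "{x}" "{}"]) (auto simp: frame_def baseD)

definition searched :: "state \<Rightarrow> nat \<Rightarrow> nat \<Rightarrow> nat \<Rightarrow> state \<Rightarrow> bool" where
  "searched s r l th s' \<longleftrightarrow> (\<exists>s1. search_post s1 s' \<and> regs s1 ''root'' = r \<and> regs s1 ''lim'' = l \<and>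
     regs s1 ''thr'' = th \<and> arrs s1 ''rad'' = arrs s ''rad'')"

text \<open>Arguments are evaluated one after another while \<open>root\<close>, \<open>lim\<close>
  and \<open>thr\<close> are being assigned. Each is therefore required to have its value in all
  states that differ from \<open>s\<close> in these registers only.\<close>

lemma call_search_wp:
  assumes base: "base s" and stamp: "Suc (regs s ''stamp'') < W"
    and bnd: "rt < n" "0 < lm" "lm < W" "thr < W"
    and r: "\<And>s'. frame {''root'', ''lim'', ''thr''} {} s s' \<Longrightarrow> aval r s' = rt \<and> afits W r s'"
    and l: "\<And>s'. frame {''root'', ''lim'', ''thr''} {} s s' \<Longrightarrow> aval l s' = lm \<and> afits W l s'"
    and th: "\<And>s'. frame {''root'', ''lim'', ''thr''} {} s s' \<Longrightarrow> aval th s' = thr \<and> afits W th s'"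
    and cost: "acost r + acost l + acost th \<le> 10"
  shows "wp W (call_search r l th) (\<lambda>t s'. t \<le> 900 * (lm + 1) + 20 \<and> base s' \<and>
      regs s' ''stamp'' = Suc (regs s ''stamp'') \<and> regs s' ''best'' \<le> regs s ''best'' \<and>
      searched s rt lm thr s' \<and>
      frame (mod_regs (call_search r l th)) (mod_arrs (call_search r l th)) s s') s"
proof -
  let ?s1 = "s\<lparr>regs := (regs s)(''root'' := rt)\<rparr>"
  let ?s2 = "s\<lparr>regs := (regs s)(''root'' := rt, ''lim'' := lm)\<rparr>"
  let ?s3 = "s\<lparr>regs := (regs s)(''root'' := rt, ''lim'' := lm, ''thr'' := thr)\<rparr>"
  have fr: "frame {''root'', ''lim'', ''thr''} {} s s" "frame {''root'', ''lim'', ''thr''} {} s ?s1"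
    "frame {''root'', ''lim'', ''thr''} {} s ?s2" "frame {''root'', ''lim'', ''thr''} {} s ?s3"
    unfolding frame_def by simp_all
  have rad: "arrs s ''rad'' v < W" if "v < n" for v using baseD(4)[OF base that] W by simp
  have wb: "word_bounds W ?s3"
    using base bnd rad W unfolding word_bounds_def base_def stores_graph_def by simp
  have best: "best_ok ?s3" using best_ok_frame[OF fr(4) baseD(6)[OF base]] by simp
  have "wp W search (\<lambda>t s'. t \<le> 900 * (lm + 1) \<and> search_post ?s3 s') ?s3"
    using search_wp[OF wb _ _ _ _ best] stamp bnd baseD(5)[OF base] by simp
  then have "wp W (call_search r l th) (\<lambda>t s'. t \<le> 900 * (lm + 1) + 20 \<and> search_post ?s3 s') s"
    unfolding call_search_def using r[OF fr(1)] l[OF fr(2)] th[OF fr(3)] cost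
    by (auto elim!: wp_mono)
  then show ?thesis
  proof (rule wp_frame, goal_cases)
    case (1 t s')
    then have post: "search_post ?s3 s'" by blast
    have "regs s' ''stamp'' = Suc (regs s ''stamp'')" "regs s' ''best'' \<le> regs s ''best''" "best_ok s'"
      using post unfolding search_post_def by simp_all
    moreover have "searched s rt lm thr s'"
      unfolding searched_def using post by (intro exI[of _ ?s3]) simp
    moreover have "base s'"
      using base frame_regs[OF 1(2)] frame_arrs[OF 1(2)] search_post_marks[OF post] \<open>best_ok s'\<close>
      unfolding base_def stores_graph_def by (simp add: mod_regs_phases mod_arrs_phases mod_search)
    ultimately show ?case using 1 by blast
  qed
qed

lemma searched_near_cycle:
  assumes "searched s r lm thr s'" "2 \<le> lm" "v \<in> set cs" "\<And>c. c \<in> set cs \<Longrightarrow> thr \<le> arrs s ''rad'' c"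
    "v \<in> ball (\<lambda>u. thr \<le> arrs s ''rad'' u) r d"
  shows "(regs s' ''found'' \<noteq> 0 \<and> regs s' ''best'' \<le> 2 * (d + half)) \<or>
    (regs s' ''found'' = 0 \<and> regs s' ''tail'' = lm \<and> 0 < regs s' ''head'' \<and>
      (\<forall>j<lm. arrs s' ''lev'' (arrs s' ''q'' j) \<le> d + half))"
proof -
  obtain s1 where s1: "search_post s1 s'" "regs s1 ''root'' = r" "regs s1 ''lim'' = lm"
     "regs s1 ''thr'' = thr" "arrs s1 ''rad'' = arrs s ''rad''"
    using assms(1) unfolding searched_def by blast
  obtain cs' where cs': "vcycle cs'" "set cs' = set cs" "length cs' = length cs" "cs' ! 0 = v"
    using vcycle_rotate_to[OF cs assms(3)] .
  from search_outcome[OF s1(1) _ cs'(1), of d] assms cs' s1 show ?thesis by simp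
qed

lemma searched_bfs:
  assumes "searched s r lm thr s'"
  shows "bfs_ok (arrs s ''rad'') thr r lm (regs s' ''stamp'') (arrs s' ''q'') (arrs s' ''lev'')
      (arrs s' ''par'') (arrs s' ''mark'') (regs s' ''head'') (regs s' ''tail'') (regs s' ''x'')
      (regs s' ''i'') (regs s' ''e'') (regs s' ''w'') (regs s' ''found'')"
proof -
  obtain s1 where s1: "search_post s1 s'" "regs s1 ''root'' = r" "regs s1 ''lim'' = lm"
     "regs s1 ''thr'' = thr" "arrs s1 ''rad'' = arrs s ''rad''"
    using assms unfolding searched_def by blast
  have "arrs s' ''rad'' = arrs s ''rad''" "regs s' ''thr'' = thr" "regs s' ''lim'' = lm"
    using frame_regs[OF search_post_frame[OF s1(1)]] frame_arrs[OF search_post_frame[OF s1(1)]] s1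
    by (simp_all add: mod_search)
  with s1 show ?thesis unfolding search_post_def bfs_state_def by (elim conjE) simp
qed

lemma card_less_if_removed: "finite B \<Longrightarrow> A \<subseteq> B \<Longrightarrow> x \<in> B \<Longrightarrow> x \<notin> A \<Longrightarrow> card A < card B"
  by (metis psubsetI psubset_card_mono)

text \<open>Threshold 0 blocks no vertex and the cycle is reachable from \<open>v\<close>, so a
  search without result was stopped by its limit. A ball of radius below \<open>r\<close> then
  consists of visited vertices of smaller level and misses the last visited one, whose level is
  \<open>r\<close>.\<close>

lemma searched_new_ball:
  assumes sd: "searched s v S 0 s'" and v: "v < n" and nf: "regs s' ''found'' = 0"
  defines "q \<equiv> arrs s' ''q''"
  defines "r \<equiv> arrs s' ''lev'' (q (S - 1))"
  shows "inj_on q {..<S}" "\<And>j. j < S \<Longrightarrow> q j < n" "0 < r" "r < n"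
    "q ` {..<S} \<subseteq> ball (\<lambda>_. True) v r" "\<And>d. d < r \<Longrightarrow> card (ball (\<lambda>_. True) v d) < S"
proof -
  obtain d where "cs ! 0 \<in> ball (\<lambda>_. True) v d" using reach[OF v] by blast
  moreover have "cs ! 0 \<in> set cs" using cs unfolding vcycle_def by (intro nth_mem) linarith
  ultimately have tail: "regs s' ''tail'' = S" and h: "0 < regs s' ''head''"
    using searched_near_cycle[OF sd S(1)] nf by auto
  note ok = searched_bfs[OF sd, unfolded tail, folded q_def]
  note b = bfs_ok_bounds[OF ok]
  have inv: "bfs_inv (arrs s ''rad'') 0 v q (arrs s' ''lev'') (arrs s' ''par'') (regs s' ''head'') S
      (regs s' ''x'') (map adjs [regs s' ''i''..<regs s' ''e''])"
    using ok unfolding bfs_ok_def by blast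
  let ?lev = "arrs s' ''lev''"
  show "inj_on q {..<S}" using bfs_invD(5)[OF inv] .
  show "q j < n" if "j < S" for j using b(10)[OF that] .
  show "r < n" using b(11)[of "S - 1"] S unfolding r_def by simp
  show "0 < r" using bfs_invD(8)[OF inv, of "S - 1"] S unfolding r_def by force
  show "q ` {..<S} \<subseteq> ball (\<lambda>_. True) v r"
  proof
    fix z assume "z \<in> q ` {..<S}"
    then obtain j where j: "j < S" "z = q j" by auto
    have "q j \<in> ball (\<lambda>_. True) v (?lev (q j))" using bfs_inv_in_ball[OF inv j(1)] by simp
    moreover have "?lev (q j) \<le> r" unfolding r_def using bfs_invD(9)[OF inv, of j "S - 1"] j(1) by simp
    ultimately show "z \<in> ball (\<lambda>_. True) v r" using ball_mono j(2) by blast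
  qed
  fix d assume d: "d < r"
  \<comment> \<open>Arcs are known to be tree arcs only below the level of the current vertex; this
    is enough because \<open>d < r\<close> gives \<open>d\<close> at most that level.\<close>
  have rx: "r \<le> Suc (?lev (regs s' ''x''))" using bfs_invD(12)[OF inv h] unfolding r_def .
  have tree: "tree_below (\<lambda>_. True) (q ` {..<S}) v ?lev (arrs s' ''par'') (?lev (regs s' ''x''))"
    using bfs_inv_tree_below[OF inv, of "?lev (regs s' ''x'')"] h by simp
  have v0: "v \<in> q ` {..<S}" "?lev v = 0" using bfs_invD(3,6)[OF inv] S by force+
  have "ball (\<lambda>_. True) v d \<subseteq> {w \<in> q ` {..<S}. ?lev w \<le> d}"
    using tree_below_ball[OF tree v0(1), of d] v0(2) d rx by auto
  then have "card (ball (\<lambda>_. True) v d) \<le> card {w \<in> q ` {..<S}. ?lev w \<le> d}"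
    by (intro card_mono) auto
  also have "card {w \<in> q ` {..<S}. ?lev w \<le> d} < card (q ` {..<S})"
    using d S unfolding r_def by (intro card_less_if_removed[of _ _ "q (S - 1)"]) auto
  also have "\<dots> = S" using bfs_inv_card(2)[OF inv] .
  finally show "card (ball (\<lambda>_. True) v d) < S" .
qed

text \<open>The two uses of \<open>rad\<close>: whatever hits the ball is within distance
  \<open>rad v\<close> of \<open>v\<close>, and balls of smaller radius are too small to reach
  \<open>S\<close>, which feeds \<open>card_ball_mult\<close>.\<close>

definition ball_info :: "(nat \<Rightarrow> nat) \<Rightarrow> (nat \<Rightarrow> nat) \<Rightarrow> bool" where
  "ball_info rad B \<longleftrightarrow> (\<forall>v<n. 0 < rad v \<longrightarrow> ball_of S B v \<subseteq> ball (\<lambda>_. True) v (rad v) \<and>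
     (\<forall>d<rad v. card (ball (\<lambda>_. True) v d) < S))"

abbreviation count_state :: "state \<Rightarrow> bool" where
  "count_state s \<equiv> cover_inv n S (arrs s ''rad'') (arrs s ''unc'') (arrs s ''B'') (arrs s ''mem'') (arrs s ''cnt'')"

abbreviation cover_state :: "state \<Rightarrow> bool" where
  "cover_state s \<equiv> count_state s \<and> ball_info (arrs s ''rad'') (arrs s ''B'')"

section \<open>Truncated searches and the recorded balls\<close>

lemma record_ball_wp:
  assumes base: "base s" and v: "regs s ''v'' < n"
    and q: "\<And>j. j < S \<Longrightarrow> arrs s ''q'' j < n" "inj_on (arrs s ''q'') {..<S}"
    and r: "r = arrs s ''lev'' (arrs s ''q'' (S - 1))" "r < n"
    and cnt: "\<And>u. u < n \<Longrightarrow> arrs s ''cnt'' u \<le> n"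
  shows "wp W record_ball (\<lambda>t s'. t \<le> 60 * S + 40 \<and>
      arrs s' ''rad'' = (arrs s ''rad'')(regs s ''v'' := r) \<and>
      arrs s' ''unc'' = (arrs s ''unc'')(regs s ''v'' := 1) \<and>
      arrs s' ''B'' = (\<lambda>i. if regs s ''v'' * S \<le> i \<and> i < regs s ''v'' * S + S
        then arrs s ''q'' (i - regs s ''v'' * S) else arrs s ''B'' i) \<and>
      arrs s' ''mem'' = (\<lambda>i. if i \<in> (\<lambda>j. regs s ''v'' * n + arrs s ''q'' j) ` {..<S} then 1 else arrs s ''mem'' i) \<and>
      arrs s' ''cnt'' = (\<lambda>u. arrs s ''cnt'' u + (if u \<in> arrs s ''q'' ` {..<S} then 1 else 0))) s"
    (is "wp W _ (\<lambda>t s'. _ \<and> ?Q s') s")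
proof -
  let ?v = "regs s ''v''"
  let ?s2 = "s\<lparr>arrs := (arrs s)(''rad'' := (arrs s ''rad'')(?v := r), ''unc'' := (arrs s ''unc'')(?v := 1))\<rparr>"
  have W': "n * n + 2 * n + 10 \<le> W" using W by simp
  note regs = baseD(1,2)[OF base]
  have store: "wp W store_ball (\<lambda>t s'. t \<le> 60 * S + 10 \<and> ?Q s') ?s2"
    by (rule wp_frame[OF store_ball_wp[OF _ _ _ v S(2) W']])
      (use regs q cnt frame_arrs in \<open>auto simp: mod_arrs_phases\<close>)
  have b: "S < W" "arrs s ''q'' (S - 1) < W" "arrs s ''lev'' (arrs s ''q'' (S - 1)) < W" "S - 1 < W" "?v < W" "1 < W"
    using W S q(1)[of "S - 1"] r v by simp_all
  show ?thesis
    unfolding record_ball_def using b regs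
    by (simp del: One_nat_def add: r(1)[symmetric]) (rule wp_mono[OF store], auto)
qed

lemma n_ge_3: "3 \<le> n"
proof -
  have "card (set cs) \<le> card {..<n}" using cs unfolding vcycle_def by (intro card_mono) auto
  then show ?thesis using cs unfolding vcycle_def by (simp add: distinct_card)
qed

lemma cs_less: "v \<in> set cs \<Longrightarrow> v < n"
  using cs unfolding vcycle_def by auto

text \<open>\<open>stamp\<close> equals the number of searches so far, which keeps it a word. On the
  cycle, \<open>rad\<close> 0 after the search of \<open>v\<close> means that a cycle was found at
  distance 0 from \<open>cs\<close>, hence the bound \<open>2 * half\<close>.\<close>

definition ball_phase_inv :: "state \<Rightarrow> bool" where
  "ball_phase_inv s \<longleftrightarrow> base s \<and> regs s ''v'' \<le> n \<and> regs s ''stamp'' = regs s ''v'' \<and> cover_state s \<and>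
     (\<forall>v<n. regs s ''v'' \<le> v \<longrightarrow> arrs s ''rad'' v = 0 \<and> (\<forall>u<n. arrs s ''mem'' (v * n + u) = 0)) \<and>
     (\<forall>v<n. 0 < arrs s ''rad'' v \<longrightarrow> arrs s ''unc'' v = 1) \<and>
     (\<forall>v\<in>set cs. v < regs s ''v'' \<longrightarrow> arrs s ''rad'' v = 0 \<longrightarrow> regs s ''best'' \<le> 2 * half)"

lemma ball_iteration_wp:
  assumes inv: "ball_phase_inv s" and v: "regs s ''v'' < n"
  shows "wp W ball_iteration (\<lambda>t s'. ball_phase_inv s' \<and> regs s' ''v'' = Suc (regs s ''v'') \<and>
      t \<le> 1000 * S + 1000) s"
proof -
  let ?v = "regs s ''v''" and ?call = "call_search (V ''v'') (V ''s'') (N 0)"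
  note I = inv[unfolded ball_phase_inv_def]
  have base: "base s" using I by blast
  note bD = baseD[OF base]
  have bnd: "Suc (regs s ''stamp'') < W" "0 < S" "S < W" "0 < W" using I S W by auto
  have "wp W ?call (\<lambda>t s'. t \<le> 900 * (S + 1) + 20 \<and> base s' \<and>
      regs s' ''stamp'' = Suc (regs s ''stamp'') \<and> regs s' ''best'' \<le> regs s ''best'' \<and>
      searched s ?v S 0 s' \<and>
      frame (mod_regs ?call) (mod_arrs ?call) s s') s"
    using bnd v bD W by (intro call_search_wp[OF base]) (auto simp: frame_def)
  then show ?thesis
    unfolding ball_iteration_def wp_Seq[of _ "call_search _ _ _"]
  proof (rule wp_mono, goal_cases)
    case (1 t1 s1)
    then have t1: "t1 \<le> 900 * (S + 1) + 20" and base1: "base s1" and sd: "searched s ?v S 0 s1"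
      and st: "regs s1 ''stamp'' = Suc ?v" and best: "regs s1 ''best'' \<le> regs s ''best''"
      and fr: "frame (mod_regs ?call) (mod_arrs ?call) s s1"
      using I by auto
    have eq: "regs s1 ''v'' = ?v" "arrs s1 ''rad'' = arrs s ''rad''" "arrs s1 ''unc'' = arrs s ''unc''"
      "arrs s1 ''B'' = arrs s ''B''" "arrs s1 ''mem'' = arrs s ''mem''" "arrs s1 ''cnt'' = arrs s ''cnt''"
      using frame_regs[OF fr] frame_arrs[OF fr] by (simp_all add: mod_regs_phases mod_arrs_phases mod_search)
    have found: "regs s1 ''found'' < W" using bfs_ok_bounds(14)[OF searched_bfs[OF sd]] W by simp
    show ?case
    proof (cases "regs s1 ''found'' = 0")
      case False
      let ?s2 = "s1\<lparr>regs := (regs s1)(''v'' := Suc ?v)\<rparr>"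
      have "base ?s2" using base1 by (simp add: base_update)
      moreover have "regs s1 ''best'' \<le> 2 * half" if "v' \<in> set cs" "v' < Suc ?v" "arrs s ''rad'' v' = 0" for v'
      proof (cases "v' = ?v")
        case True
        then show ?thesis using searched_near_cycle[OF sd S(1) that(1), of 0] self_in_ball False by simp
      next
        case False
        then have "regs s ''best'' \<le> 2 * half" using I that by auto
        with best show ?thesis by simp
      qed
      ultimately have "ball_phase_inv ?s2"
        using I v st unfolding ball_phase_inv_def by (simp add: eq)
      with False t1 v W S found show ?thesis by (simp add: eq)
    next
      case True
      note new = searched_new_ball[OF sd v True]
      let ?q = "arrs s1 ''q''" and ?r = "arrs s1 ''lev'' (arrs s1 ''q'' (S - 1))"
      have cov: "count_state s"
        using I by blast
      have rad0: "arrs s ''rad'' ?v = 0" and mem0: "\<And>u. u < n \<Longrightarrow> arrs s ''mem'' (?v * n + u) = 0"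
        using I v by auto
      note store = cover_inv_store[OF cov v rad0 new(3) mem0 new(1,2)]
      have "wp W record_ball (\<lambda>t s2. t \<le> 60 * S + 40 \<and> regs s2 ''v'' = ?v \<and>
          ball_phase_inv (s2\<lparr>regs := (regs s2)(''v'' := Suc ?v)\<rparr>)) s1"
      proof (rule wp_frame[OF record_ball_wp[OF base1, of ?r]], goal_cases)
        case (7 t2 s2)
        let ?s3 = "s2\<lparr>regs := (regs s2)(''v'' := Suc ?v)\<rparr>"
        note fr2 = 7(2)
        have v2: "regs s2 ''v'' = ?v" and best2: "regs s2 ''best'' = regs s1 ''best''"
          and st2: "regs s2 ''stamp'' = Suc ?v"
          using frame_regs[OF fr2] eq st by (simp_all add: mod_regs_phases)
        have rad2: "arrs s2 ''rad'' = (arrs s ''rad'')(?v := ?r)"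
          and unc2: "arrs s2 ''unc'' = (arrs s ''unc'')(?v := 1)"
          and B2: "arrs s2 ''B'' = (\<lambda>i. if ?v * S \<le> i \<and> i < ?v * S + S then ?q (i - ?v * S) else arrs s ''B'' i)"
          and mem2: "arrs s2 ''mem'' = (\<lambda>i. if i \<in> (\<lambda>j. ?v * n + ?q j) ` {..<S} then 1 else arrs s ''mem'' i)"
          and cnt2: "arrs s2 ''cnt'' = (\<lambda>u. arrs s ''cnt'' u + (if u \<in> ?q ` {..<S} then 1 else 0))"
          using 7(1) unfolding eq by blast+
        have base3: "base ?s3"
        proof (rule base_frame[OF base1])
          show "frame {''c'', ''u'', ''v''} {''rad'', ''unc'', ''B'', ''mem'', ''cnt''} s1 ?s3"
            using fr2 unfolding frame_def mod_regs_phases mod_arrs_phases by auto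
        qed (use new(4) bD(4) rad2 in auto)
        have "ball_info (arrs s2 ''rad'') (arrs s2 ''B'')"
          unfolding ball_info_def
        proof (intro allI impI)
          fix v' assume v': "v' < n" "0 < arrs s2 ''rad'' v'"
          show "ball_of S (arrs s2 ''B'') v' \<subseteq> ball (\<lambda>_. True) v' (arrs s2 ''rad'' v') \<and>
              (\<forall>d<arrs s2 ''rad'' v'. card (ball (\<lambda>_. True) v' d) < S)"
          proof (cases "v' = ?v")
            case True
            show ?thesis using new(5,6) unfolding True rad2 B2 ball_of_store by simp
          next
            case False
            then show ?thesis using v' I unfolding rad2 B2 ball_of_store_other[OF False] ball_info_def by simp
          qed
        qed
        moreover have "count_state s2"
          unfolding rad2 unc2 B2 mem2 cnt2 by (rule store)
        moreover have "arrs s2 ''rad'' v' = 0 \<and> (\<forall>u<n. arrs s2 ''mem'' (v' * n + u) = 0)"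
          if "v' < n" "Suc ?v \<le> v'" for v'
          using that I new(2) row_eq_iff[of _ n _ v' ?v] unfolding rad2 mem2 by auto
        moreover have "arrs s2 ''unc'' v' = 1" if "v' < n" "0 < arrs s2 ''rad'' v'" for v'
          using that I unfolding rad2 unc2 by (auto split: if_splits)
        moreover have "regs s2 ''best'' \<le> 2 * half"
          if "v' \<in> set cs" "v' < Suc ?v" "arrs s2 ''rad'' v' = 0" for v'
        proof -
          have "v' \<noteq> ?v" using that(3) new(3) unfolding rad2 by auto
          with that I have "regs s ''best'' \<le> 2 * half" unfolding rad2 by auto
          with best best2 show ?thesis by simp
        qed
        ultimately have "ball_phase_inv ?s3" using base3 st2 v unfolding ball_phase_inv_def by simp
        with 7(1) v2 show ?case by blast
      qed (use new v cov cover_inv_cnt_le eq in auto)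
      note rec = this
      have b: "?v < W" "Suc ?v < W" "0 < W" using v W by auto
      show ?thesis
        using True t1 found b by simp (rule wp_mono[OF rec], auto)
    qed
  qed
qed

lemma ball_phase_wp:
  assumes base: "base s" and zero: "arrs s ''rad'' = (\<lambda>_. 0)" "arrs s ''unc'' = (\<lambda>_. 0)"
    "arrs s ''mem'' = (\<lambda>_. 0)" "arrs s ''cnt'' = (\<lambda>_. 0)" "regs s ''stamp'' = 0"
  shows "wp W ball_phase (\<lambda>t s'. t \<le> n * (1000 * S + 1100) + 10 \<and> base s' \<and> regs s' ''stamp'' = n \<and> cover_state s' \<and>
      (\<forall>v\<in>set cs. arrs s' ''unc'' v \<noteq> 1 \<longrightarrow> regs s' ''best'' \<le> 2 * (arrs s' ''rad'' v + half))) s"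
proof -
  let ?s0 = "s\<lparr>regs := (regs s)(''v'' := 0)\<rparr>"
  have "base ?s0" using base by (simp add: base_update)
  then have inv0: "ball_phase_inv ?s0"
    using zero unfolding ball_phase_inv_def cover_inv_def ball_info_def uncovered_def by simp
  have "wp W (While (Less (V ''v'') (V ''n'')) ball_iteration) (\<lambda>t s'. t \<le> n * (1000 * S + 1100) + 5 \<and>
      ball_phase_inv s' \<and> regs s' ''v'' = n) ?s0"
  proof (rule wp_While[where I = ball_phase_inv and f = "\<lambda>s. (n - regs s ''v'') * (1000 * S + 1100)"], goal_cases)
    case 1
    then show ?case by (rule inv0)
  next
    case (2 s')
    then show ?case using baseD(1) W unfolding ball_phase_inv_def by auto
  next
    case (3 s')
    then have v: "regs s' ''v'' < n" using baseD(1) unfolding ball_phase_inv_def by auto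
    show ?case
    proof (rule wp_mono[OF ball_iteration_wp[OF 3(1) v]], goal_cases)
      case (1 t s'')
      have "(n - regs s' ''v'') = Suc (n - regs s'' ''v'')" using 1 v by simp
      with 1 show ?case by simp
    qed
  next
    case (4 t s')
    then have "regs s' ''n'' = n" "regs s' ''v'' \<le> n" using baseD(1) unfolding ball_phase_inv_def by auto
    with 4 show ?case by auto
  qed
  then show ?thesis
    unfolding ball_phase_def using W
  proof (simp, elim wp_mono, goal_cases)
    case (1 t s')
    then have I: "ball_phase_inv s'" "regs s' ''v'' = n" "t \<le> n * (1000 * S + 1100) + 5" by (auto simp: algebra_simps)
    have "regs s' ''best'' \<le> 2 * (arrs s' ''rad'' v + half)" if "v \<in> set cs" "arrs s' ''unc'' v \<noteq> 1" for v
    proof -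
      have "arrs s' ''rad'' v = 0" using I(1) that cs_less[OF that(1)] unfolding ball_phase_inv_def by auto
      then show ?thesis using I(1,2) that(1) cs_less[OF that(1)] unfolding ball_phase_inv_def by auto
    qed
    with I show ?case unfolding ball_phase_inv_def by (auto simp: algebra_simps)
  qed
qed

section \<open>Greedy hitting set\<close>

lemma uncount_balls_wp:
  assumes base: "base s" and cov: "cover_state s" and z: "regs s ''z'' < n"
  shows "wp W uncount_balls (\<lambda>t s'. base s' \<and> cover_state s' \<and>
      t + 100 * S * card (uncovered n (arrs s' ''unc'')) \<le> 60 * n + 10 + 100 * S * card (uncovered n (arrs s ''unc'')) \<and>
      (\<forall>v<n. arrs s' ''unc'' v = (if arrs s ''unc'' v = 1 \<and> regs s ''z'' \<in> ball_of S (arrs s ''B'') v then 0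
        else arrs s ''unc'' v))) s"
proof -
  let ?s0 = "s\<lparr>regs := (regs s)(''v'' := 0)\<rparr>" and ?z = "regs s ''z''"
  let ?I = "\<lambda>s'. base s' \<and> cover_state s' \<and> regs s' ''v'' \<le> n \<and>
      arrs s' ''unc'' = (\<lambda>v. if v < regs s' ''v'' \<and> arrs s ''unc'' v = 1 \<and> ?z \<in> ball_of S (arrs s ''B'') v then 0
        else arrs s ''unc'' v)"
  \<comment> \<open>Amortization: removing a ball takes time proportional to \<open>S\<close>,
    charged to its disappearance from the uncovered ones. A ball is removed only once in the whole
    phase.\<close>
  let ?f = "\<lambda>s'. 60 * (n - regs s' ''v'') + 100 * S * card (uncovered n (arrs s' ''unc''))"
  have "base ?s0" using base by (simp add: base_update)
  then have inv0: "?I ?s0" using cov by simp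
  have W0: "0 < W" using W by simp
  show ?thesis
    unfolding uncount_balls_def
  proof (simp del: One_nat_def add: W0, rule wp_While[where I = ?I and f = ?f], goal_cases)
    case 1
    show ?case by (rule inv0)
  next
    case (2 s')
    then show ?case using baseD(1)[of s'] W by auto
  next
    case (3 s')
    let ?v = "regs s' ''v''"
    have base': "base s'" and cov': "count_state s'"
      and info': "ball_info (arrs s' ''rad'') (arrs s' ''B'')"
      and unc: "arrs s' ''unc'' = (\<lambda>v. if v < ?v \<and> arrs s ''unc'' v = 1 \<and> ?z \<in> ball_of S (arrs s ''B'') v then 0
        else arrs s ''unc'' v)" using 3(1) by blast+
    note bD = baseD[OF base']
    have v: "?v < n" using 3(2) bD(1) by simp
    have fr: "regs s' ''z'' = ?z" "arrs s' ''B'' = arrs s ''B''"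
      using frame_regs[OF 3(3)] frame_arrs[OF 3(3)] by (simp_all add: mod_regs_phases mod_arrs_phases)
    have "?v * n + ?z < n * n" using row_less[OF v z] .
    moreover have "arrs s' ''unc'' ?v \<le> 1" "arrs s' ''mem'' (?v * n + ?z) \<le> 1"
      using cov' v z unfolding cover_inv_def by auto
    ultimately have b: "?v < W" "Suc ?v < W" "?z < W" "?v * n < W" "?v * n + ?z < W" "n < W" "Suc 0 < W"
      "arrs s' ''unc'' ?v < W" "arrs s' ''mem'' (?v * n + ?z) < W"
      using W v z by auto
    have unc_v: "arrs s' ''unc'' ?v = arrs s ''unc'' ?v" using unc by simp
    have mem: "arrs s' ''mem'' (?v * n + ?z) = 1 \<longleftrightarrow> ?z \<in> ball_of S (arrs s ''B'') ?v"
      if "arrs s' ''unc'' ?v = 1"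
      using that cov' v z fr unfolding cover_inv_def by auto
    show ?case
    proof (cases "arrs s' ''unc'' ?v = 1 \<and> arrs s' ''mem'' (?v * n + ?z) = 1")
      case False
      let ?s2 = "s'\<lparr>regs := (regs s')(''v'' := Suc ?v)\<rparr>"
      have "base ?s2" using base' by (simp add: base_update)
      moreover have "arrs s' ''unc'' = (\<lambda>v. if v < Suc ?v \<and> arrs s ''unc'' v = 1 \<and> ?z \<in> ball_of S (arrs s ''B'') v then 0
        else arrs s ''unc'' v)"
        using False mem unc unc_v by (auto simp: fun_eq_iff less_Suc_eq)
      ultimately show ?thesis using False b v bD(1) fr cov' info' by (auto simp: algebra_simps)
    next
      case True
      let ?s2 = "s'\<lparr>arrs := (arrs s')(''unc'' := (arrs s' ''unc'')(?v := 0))\<rparr>"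
      note unco = cover_inv_uncount[OF cov' v] 
      have rad: "0 < arrs s' ''rad'' ?v" using cov' v True unfolding cover_inv_def by blast
      have B: "inj_on (\<lambda>j. arrs s' ''B'' (?v * S + j)) {..<S}" "ball_of S (arrs s' ''B'') ?v \<subseteq> {..<n}"
        using cov' v rad unfolding cover_inv_def by blast+
      have "wp W uncount_ball (\<lambda>t s''. ?I (s''\<lparr>regs := (regs s'')(''v'' := Suc ?v)\<rparr>) \<and> regs s'' ''v'' = ?v \<and>
          t + 40 + 100 * S * card (uncovered n (arrs s'' ''unc'')) \<le> 100 * S * card (uncovered n (arrs s' ''unc''))) ?s2"
      proof (rule wp_frame[OF uncount_ball_wp[of _ S ?v n]], goal_cases)
        case (9 t s'')
        note fr2 = 9(2)
        let ?s3 = "s''\<lparr>regs := (regs s'')(''v'' := Suc ?v)\<rparr>"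
        have eq: "regs s'' ''v'' = ?v" "arrs s'' ''unc'' = (arrs s' ''unc'')(?v := 0)" "arrs s'' ''rad'' = arrs s' ''rad''"
          "arrs s'' ''B'' = arrs s' ''B''" "arrs s'' ''mem'' = arrs s' ''mem''"
          using frame_regs[OF fr2] frame_arrs[OF fr2] by (simp_all add: mod_regs_phases mod_arrs_phases)
        have cnt: "arrs s'' ''cnt'' = (\<lambda>u. arrs s' ''cnt'' u - (if u \<in> ball_of S (arrs s' ''B'') ?v then 1 else 0))"
          using 9(1) unfolding ball_of_def by simp
        have "base ?s3"
        proof (rule base_frame[OF base'])
          show "frame {''c'', ''u'', ''v''} {''unc'', ''cnt''} s' ?s3"
            using fr2 unfolding frame_def mod_regs_phases mod_arrs_phases by auto
        qed (use bD(4) eq in auto)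
        moreover have "(arrs s' ''unc'')(?v := 0) = (\<lambda>v. if v < Suc ?v \<and> arrs s ''unc'' v = 1 \<and> ?z \<in> ball_of S (arrs s ''B'') v then 0
            else arrs s ''unc'' v)"
          using True mem unc unc_v by (auto simp: fun_eq_iff less_Suc_eq)
        moreover have "t + 40 + 100 * S * card (uncovered n (arrs s'' ''unc'')) \<le> 100 * S * card (uncovered n (arrs s' ''unc''))"
        proof -
          have "100 * S * card (uncovered n (arrs s' ''unc'')) = 100 * S + 100 * S * card (uncovered n (arrs s'' ''unc''))"
            unfolding eq unco(2)[OF conjunct1[OF True], symmetric] by simp
          with 9(1) S show ?thesis by linarith
        qed
        ultimately show ?case using unco(1) True v info' by (simp add: eq cnt)
      qed (use bD v S W B cov' cover_inv_cnt_le ball_of_def in auto)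
      note unc_wp = this
      show ?thesis
        using True b v bD(1) fr
        by (simp del: One_nat_def) (rule wp_mono[OF unc_wp], auto)
    qed
  next
    case (4 t s')
    then have "regs s' ''v'' = n" using baseD(1)[of s'] by auto
    with 4 show ?case by auto
  qed
qed

definition hit_inv :: "state \<Rightarrow> bool" where
  "hit_inv s \<longleftrightarrow> base s \<and> cover_state s \<and> regs s ''stamp'' = n + regs s ''it'' \<and> regs s ''it'' \<le> M \<and>
     regs s ''go'' \<le> 1 \<and>
     real (card (uncovered n (arrs s ''unc''))) \<le> real n * (1 - real S / real n) ^ regs s ''it'' \<and>
     (\<forall>v\<in>set cs. arrs s ''unc'' v \<noteq> 1 \<longrightarrow> regs s ''best'' \<le> 2 * (arrs s ''rad'' v + half)) \<and>
     (regs s ''go'' = 0 \<longrightarrow> uncovered n (arrs s ''unc'') = {})"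

text \<open>The three terms pay for the unlimited searches that may still follow, for the removal of
  each uncovered ball, and for the last iteration, which merely finds the maximal count to be
  0.\<close>

abbreviation hit_potential :: "state \<Rightarrow> nat" where
  "hit_potential s \<equiv> 3000 * n * (M - regs s ''it'') + 100 * S * card (uncovered n (arrs s ''unc'')) +
     (if regs s ''go'' = 1 then 100 * n else 0)"

lemma hit_iteration_wp:
  assumes inv: "hit_inv s" and go: "regs s ''go'' = 1"
  shows "wp W hit_iteration (\<lambda>t s'. hit_inv s' \<and> t + 10 + hit_potential s' \<le> hit_potential s) s"
proof -
  note I = inv[unfolded hit_inv_def]
  have base: "base s" and cov: "count_state s"
    and info: "ball_info (arrs s ''rad'') (arrs s ''B'')" using I by blast+
  note bD = baseD[OF base]
  have n: "0 < n" "3 \<le> n" using n_ge_3 by auto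
  let ?U = "uncovered n (arrs s ''unc'')" and ?it = "regs s ''it''"
  have cntW: "arrs s ''cnt'' u < W" if "u < n" for u using cover_inv_cnt_le[OF cov that] W by simp
  have "wp W find_max (\<lambda>t s'. t \<le> 40 * n + 10 \<and> regs s' ''z'' < n \<and>
      (\<forall>u<n. arrs s ''cnt'' u \<le> arrs s ''cnt'' (regs s' ''z''))) s"
    using n W cntW by (intro find_max_wp[OF bD(1)]) auto
  then show ?thesis
    unfolding hit_iteration_def wp_Seq[of _ find_max]
  proof (rule wp_frame, goal_cases)
    case (1 t1 s1)
    note fr1 = 1(2)
    have t1: "t1 \<le> 40 * n + 10" and z: "regs s1 ''z'' < n"
      and max: "\<And>u. u < n \<Longrightarrow> arrs s ''cnt'' u \<le> arrs s ''cnt'' (regs s1 ''z'')" using 1(1) by auto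
    let ?z = "regs s1 ''z''" and ?m = "arrs s ''cnt'' (regs s1 ''z'')"
    have arrs1: "arrs s1 = arrs s" using frame_arrs[OF fr1] by (simp add: mod_arrs_phases fun_eq_iff)
    have regs1: "regs s1 ''it'' = ?it" "regs s1 ''go'' = 1" "regs s1 ''stamp'' = n + ?it" "regs s1 ''best'' = regs s ''best''"
      using frame_regs[OF fr1] I go by (simp_all add: mod_regs_phases)
    have base1: "base s1" using base_frame[OF base fr1] bD(4) arrs1 by (simp add: mod_regs_phases mod_arrs_phases)
    have avg: "card ?U * S \<le> n * ?m" using cover_inv_average[OF cov max] .
    have mW: "?m < W" using cntW z by simp
    show ?case
    proof (cases "?m = 0")
      case True
      \<comment> \<open>A maximal count of 0 makes the average 0, so no ball is left
        uncovered.\<close>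
      then have "card ?U = 0" using avg S by simp
      then have "?U = {}" using finite_uncovered by simp
      moreover have "base (s1\<lparr>regs := (regs s1)(''go'' := 0)\<rparr>)"
        using base1 by (simp add: base_update)
      ultimately have "hit_inv (s1\<lparr>regs := (regs s1)(''go'' := 0)\<rparr>)"
        using I unfolding hit_inv_def by (simp add: arrs1 regs1)
      then show ?thesis using True t1 n z W go by (simp add: arrs1 regs1)
    next
      case False
      have "?m = card {v \<in> ?U. ?z \<in> ball_of S (arrs s ''B'') v}"
        using cov z unfolding cover_inv_def by blast
      moreover have "card {v \<in> ?U. ?z \<in> ball_of S (arrs s ''B'') v} \<le> card ?U"
        using finite_uncovered by (intro card_mono) auto
      ultimately have U1: "1 \<le> card ?U" and mU: "?m \<le> card ?U" using False by auto
      \<comment> \<open>After \<open>M\<close> choices \<open>decay\<close> would leave less than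
        one uncovered ball, but the positive count of \<open>?z\<close> exhibits one.\<close>
      have it: "?it < M"
      proof (rule ccontr)
        assume "\<not> ?it < M"
        then have "?it = M" using I by simp
        with I have "real (card ?U) \<le> real n * (1 - real S / real n) ^ M" by simp
        with decay U1 show False by simp
      qed
      let ?s2 = "s1\<lparr>regs := (regs s1)(''it'' := ?it + 1)\<rparr>"
      let ?call = "call_search (V ''z'') (Plus (V ''n'') (N 1)) (N 0)"
      have base2: "base ?s2"
        using base1 by (simp add: base_update)
      have "wp W ?call (\<lambda>t s'. t \<le> 900 * (Suc n + 1) + 20 \<and> base s' \<and>
        regs s' ''stamp'' = Suc (regs ?s2 ''stamp'') \<and> regs s' ''best'' \<le> regs ?s2 ''best'' \<and>
        searched ?s2 ?z (Suc n) 0 s' \<and> frame (mod_regs ?call) (mod_arrs ?call) ?s2 s') ?s2"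
        using z W it n baseD(1)[OF base1] regs1 by (intro call_search_wp[OF base2]) (auto simp: frame_def)
      then have "wp W (?call ;; uncount_balls)
        (\<lambda>t s'. hit_inv s' \<and> t + 50 * n + 30 + hit_potential s' \<le> hit_potential s) ?s2"
        unfolding wp_Seq[of _ ?call]
      proof (rule wp_mono, goal_cases)
        case (1 t3 s3)
        then have t3: "t3 \<le> 900 * (Suc n + 1) + 20" and base3: "base s3" and sd: "searched ?s2 ?z (Suc n) 0 s3"
          and st3: "regs s3 ''stamp'' = Suc (n + ?it)" and best3: "regs s3 ''best'' \<le> regs s ''best''"
          and fr3: "frame (mod_regs ?call) (mod_arrs ?call) ?s2 s3"
          using regs1 by simp_all
        have arrs3: "arrs s3 ''rad'' = arrs s ''rad''" "arrs s3 ''unc'' = arrs s ''unc''" "arrs s3 ''B'' = arrs s ''B''"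
          "arrs s3 ''mem'' = arrs s ''mem''" "arrs s3 ''cnt'' = arrs s ''cnt''"
          using frame_arrs[OF fr3] arrs1 by (simp_all add: mod_arrs_phases mod_search)
        have regs3: "regs s3 ''z'' = ?z" "regs s3 ''it'' = Suc ?it" "regs s3 ''go'' = 1"
          using frame_regs[OF fr3] regs1 by (simp_all add: mod_regs_phases mod_search)
        have z3: "regs s3 ''z'' < n" using z regs3 by simp
        have cov3: "cover_state s3" using cov info arrs3 by simp
        \<comment> \<open>If \<open>?z\<close> hits the ball of a vertex \<open>v\<close> of the
          cycle, then by symmetry the unlimited search from \<open>?z\<close> starts within
          \<open>rad v\<close> of the cycle.\<close>
        have hit: "regs s3 ''best'' \<le> 2 * (arrs s ''rad'' v + half)"
          if v: "v \<in> set cs" "arrs s ''unc'' v = 1" "?z \<in> ball_of S (arrs s ''B'') v" for v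
        proof -
          have vn: "v < n" using cs_less[OF v(1)] .
          have "0 < arrs s ''rad'' v" using cov vn v(2) unfolding cover_inv_def by blast
          then have "?z \<in> ball (\<lambda>_. True) v (arrs s ''rad'' v)" using info vn v(3) unfolding ball_info_def by blast
          from ball_True_sym[OF vn this] searched_near_cycle[OF sd _ v(1), of "arrs s ''rad'' v"]
            bfs_ok_bounds(2)[OF searched_bfs[OF sd]] n
          show ?thesis by auto
        qed
        show ?case
        proof (rule wp_frame[OF uncount_balls_wp[OF base3 cov3 z3]], goal_cases)
          case (1 t4 s4)
          note fr4 = 1(2)
          have base4: "base s4" and cov4: "cover_state s4"
            and t4: "t4 + 100 * S * card (uncovered n (arrs s4 ''unc'')) \<le> 60 * n + 10 + 100 * S * card ?U"
            and unc4: "\<And>v. v < n \<Longrightarrow> arrs s4 ''unc'' v = (if arrs s ''unc'' v = 1 \<and> ?z \<in> ball_of S (arrs s ''B'') v then 0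
              else arrs s ''unc'' v)"
            using 1(1) unfolding arrs3 regs3 by blast+
          have regs4: "regs s4 ''it'' = Suc ?it" "regs s4 ''go'' = 1" "regs s4 ''stamp'' = Suc (n + ?it)"
            "regs s4 ''best'' = regs s3 ''best''"
            using frame_regs[OF fr4] regs3 st3 by (simp_all add: mod_regs_phases)
          have rad4: "arrs s4 ''rad'' = arrs s ''rad''" using frame_arrs[OF fr4] arrs3 by (simp add: mod_arrs_phases)
          have "uncovered n (arrs s4 ''unc'') = ?U - {v \<in> ?U. ?z \<in> ball_of S (arrs s ''B'') v}"
            using unc4 by (auto simp: uncovered_def split: if_splits)
          then have "card (uncovered n (arrs s4 ''unc'')) = card ?U - ?m"
            using \<open>?m = card {v \<in> ?U. ?z \<in> ball_of S (arrs s ''B'') v}\<close> finite_uncovered[of n "arrs s ''unc''"]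
            by (simp add: card_Diff_subset)
          then have "real (card (uncovered n (arrs s4 ''unc''))) = real (card ?U) - real ?m" using mU by simp
          \<comment> \<open>The count of \<open>?z\<close> is maximal and hence at least the
            average; each choice thus multiplies the number of uncovered balls by at most 1 -
            S/n.\<close>
          moreover have "real (card ?U) * real S \<le> real n * real ?m" using avg by (metis of_nat_le_iff of_nat_mult)
          then have "real (card ?U) * (real S / real n) \<le> real ?m" using n by (simp add: field_simps)
          ultimately have "real (card (uncovered n (arrs s4 ''unc''))) \<le> real (card ?U) * (1 - real S / real n)"
            by (simp add: algebra_simps)
          also have "\<dots> \<le> (real n * (1 - real S / real n) ^ ?it) * (1 - real S / real n)"
            using I S n by (intro mult_right_mono) (auto simp: divide_le_eq)
          finally have dec: "real (card (uncovered n (arrs s4 ''unc''))) \<le> real n * (1 - real S / real n) ^ Suc ?it"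
            by (simp add: mult_ac)
          have hits: "regs s4 ''best'' \<le> 2 * (arrs s4 ''rad'' v + half)" if v: "v \<in> set cs" "arrs s4 ''unc'' v \<noteq> 1" for v
          proof (cases "arrs s ''unc'' v = 1")
            case True
            then show ?thesis using hit[OF v(1)] unc4[OF cs_less[OF v(1)]] v(2) regs4 rad4 by (auto split: if_splits)
          next
            case False
            then have "regs s ''best'' \<le> 2 * (arrs s ''rad'' v + half)" using I v(1) by blast
            then show ?thesis using best3 regs4 rad4 by simp
          qed
          have "hit_inv s4"
            unfolding hit_inv_def using base4 cov4 regs4 it dec hits by simp
          moreover have "M - ?it = Suc (M - Suc ?it)" using it by simp
          then have "3000 * n * (M - ?it) = 3000 * n * (M - Suc ?it) + 3000 * n" by simp
          ultimately show ?case using t3 t4 regs4 go n by simp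
        qed
      qed
      note call_wp = this
      have b: "?z < W" "?m < W" "?it < W" "Suc ?it < W" "0 < W" "1 < W" using z mW it W by auto
      show ?thesis
        using b False t1
        by (simp del: One_nat_def wp_Seq add: wp_Seq[of _ "_ ::= _"] arrs1 regs1 go) (rule wp_mono[OF call_wp], auto simp: go)
    qed
  qed
qed

lemma hit_phase_wp:
  assumes base: "base s" and cov: "cover_state s" and st: "regs s ''stamp'' = n"
    and hits: "\<And>v. v \<in> set cs \<Longrightarrow> arrs s ''unc'' v \<noteq> 1 \<Longrightarrow> regs s ''best'' \<le> 2 * (arrs s ''rad'' v + half)"
  shows "wp W hit_phase (\<lambda>t s'. t \<le> 3000 * n * M + 100 * S * n + 100 * n + 20 \<and> base s' \<and>
      regs s' ''stamp'' \<le> n + M \<and> ball_info (arrs s' ''rad'') (arrs s' ''B'') \<and>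
      (\<forall>v\<in>set cs. regs s' ''best'' \<le> 2 * (arrs s' ''rad'' v + half))) s"
proof -
  let ?s0 = "s\<lparr>regs := (regs s)(''go'' := 1, ''it'' := 0)\<rparr>"
  have "base ?s0" using base_frame[OF base, of "{''go'', ''it''}" "{}" ?s0] baseD(4)[OF base] by (simp add: frame_def)
  moreover have "card (uncovered n (arrs s ''unc'')) \<le> n" using card_uncovered_le[where P = "\<lambda>_. True"] by simp
  ultimately have inv0: "hit_inv ?s0" and pot0: "hit_potential ?s0 \<le> 3000 * n * M + 100 * S * n + 100 * n"
    using cov st hits unfolding hit_inv_def by auto
  have "wp W (While (Eq (V ''go'') (N 1)) hit_iteration) (\<lambda>t s'. t \<le> 3000 * n * M + 100 * S * n + 100 * n + 4 \<and>
      hit_inv s' \<and> regs s' ''go'' = 0) ?s0"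
  proof (rule wp_While[where I = hit_inv and f = hit_potential], goal_cases)
    case 1
    then show ?case by (rule inv0)
  next
    case (2 s')
    then have "regs s' ''go'' \<le> 1" unfolding hit_inv_def by blast
    then show ?case using W by simp
  next
    case (3 s')
    then have "regs s' ''go'' = 1" by simp
    from hit_iteration_wp[OF 3(1) this] show ?case by (elim wp_mono) (simp del: One_nat_def)
  next
    case (4 t s')
    then have "regs s' ''go'' \<noteq> 1" "regs s' ''go'' \<le> 1" unfolding hit_inv_def by auto
    then have "regs s' ''go'' = 0" by simp
    moreover have "t \<le> 3000 * n * M + 100 * S * n + 100 * n + bcost (Eq (V ''go'') (N 1)) + 1"
      using order_trans[OF 4(4) add_right_mono[OF add_right_mono[OF pot0]]] by (rule add_leD1)
    then have "t \<le> 3000 * n * M + 100 * S * n + 100 * n + 4" by simp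
    ultimately show ?case using 4(1) by blast
  qed
  note loop = this
  have "1 < W" "0 < W" using W by auto
  then have "wp W hit_phase (\<lambda>t s'. t \<le> 3000 * n * M + 100 * S * n + 100 * n + 20 \<and> hit_inv s' \<and> regs s' ''go'' = 0) s"
    unfolding hit_phase_def by (simp del: One_nat_def) (rule wp_mono[OF loop], auto)
  then show ?thesis
  proof (rule wp_mono, goal_cases)
    case (1 t s')
    then have I: "hit_inv s'" "uncovered n (arrs s' ''unc'') = {}" unfolding hit_inv_def by auto
    have "arrs s' ''unc'' v \<noteq> 1" if "v \<in> set cs" for v
      using I(2) cs_less[OF that] unfolding uncovered_def by blast
    with 1 I(1) show ?case unfolding hit_inv_def by auto
  qed
qed

section \<open>Restricted searches up to \<open>M\<close> vertices\<close>

definition local_inv :: "state \<Rightarrow> bool" where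
  "local_inv s \<longleftrightarrow> base s \<and> regs s ''v'' \<le> n \<and> regs s ''stamp'' \<le> n + M + regs s ''v'' \<and>
     ball_info (arrs s ''rad'') (arrs s ''B'') \<and>
     (\<forall>v\<in>set cs. regs s ''best'' \<le> 2 * (arrs s ''rad'' v + half)) \<and>
     (\<forall>v\<in>set cs. v < regs s ''v'' \<longrightarrow> (\<forall>c\<in>set cs. arrs s ''rad'' v \<le> arrs s ''rad'' c) \<longrightarrow>
       (\<forall>r. 0 < r \<longrightarrow> r < arrs s ''rad'' v \<longrightarrow> half \<le> (k - 1) * r \<longrightarrow> regs s ''best'' \<le> 2 * half))"

text \<open>
  If the balls of radius \<open>r\<close> around all vertices of the restricted graph have fewer than \<open>S\<close> elements,
  then its balls of radius \<open>(k - 1) * r\<close> have fewer than \<open>M\<close> elements, so that the limit \<open>M\<close> is not reached.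
\<close>

lemma searched_local:
  assumes sd: "searched s v M (arrs s ''rad'' v) s'" and v: "v \<in> set cs"
    and info: "ball_info (arrs s ''rad'') (arrs s ''B'')"
    and min: "\<And>c. c \<in> set cs \<Longrightarrow> arrs s ''rad'' v \<le> arrs s ''rad'' c"
    and r: "0 < r" "r < arrs s ''rad'' v" "half \<le> (k - 1) * r"
  shows "regs s' ''best'' \<le> 2 * half"
proof (rule ccontr)
  let ?P = "\<lambda>u. arrs s ''rad'' v \<le> arrs s ''rad'' u" and ?q = "arrs s' ''q''" and ?lev = "arrs s' ''lev''"
  have vn: "v < n" using cs_less[OF v] .
  have M2: "2 \<le> M" using S S_le_M by simp
  assume "\<not> regs s' ''best'' \<le> 2 * half"
  \<comment> \<open>Minimality of \<open>rad v\<close> keeps the whole cycle in the restricted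
    graph, at distance 0 from the root. If no short cycle is found, the search was stopped after
    \<open>M\<close> vertices, all of level at most \<open>half\<close>.\<close>
  with searched_near_cycle[OF sd M2 v min, of 0] self_in_ball
  have tail: "regs s' ''tail'' = M" and lev: "\<And>j. j < M \<Longrightarrow> ?lev (?q j) \<le> half" by auto
  note ok = searched_bfs[OF sd, unfolded tail]
  then have inv: "bfs_inv (arrs s ''rad'') (arrs s ''rad'' v) v ?q ?lev (arrs s' ''par'') (regs s' ''head'') M
      (regs s' ''x'') (map adjs [regs s' ''i''..<regs s' ''e''])"
    unfolding bfs_ok_def by blast
  have "?q ` {..<M} \<subseteq> ball ?P v ((k - 1) * r)"
  proof
    fix z assume "z \<in> ?q ` {..<M}"
    then obtain j where j: "j < M" "z = ?q j" by auto
    then show "z \<in> ball ?P v ((k - 1) * r)"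
      using bfs_inv_in_ball[OF inv j(1)] ball_mono[OF order_trans[OF lev[OF j(1)] r(3)]] by blast
  qed
  then have "card (?q ` {..<M}) \<le> card (ball ?P v ((k - 1) * r))"
    using finite_ball[OF vn] by (intro card_mono)
  \<comment> \<open>Fewer than \<open>S\<close> means at most \<open>S - 1\<close>; this gap of one
    makes the power strictly smaller than \<open>M\<close> and contradicts the \<open>M\<close>
    distinct visited vertices.\<close>
  also have "\<dots> \<le> (S - 1) ^ (k - 1)"
  proof (rule card_ball_mult[OF vn _ r(1)])
    fix u assume u: "u < n" "?P u"
    then have "card (ball (\<lambda>_. True) u r) < S" using info r unfolding ball_info_def by auto
    then show "card (ball (\<lambda>_. True) u r) \<le> S - 1" by simp
  qed simp
  also have "\<dots> < S ^ (k - 1)" using S k by (intro power_strict_mono) auto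
  finally show False using bfs_inv_card(2)[OF inv] M by simp
qed

lemma local_phase_wp:
  assumes base: "base s" and st: "regs s ''stamp'' \<le> n + M" and info: "ball_info (arrs s ''rad'') (arrs s ''B'')"
    and hits: "\<And>v. v \<in> set cs \<Longrightarrow> regs s ''best'' \<le> 2 * (arrs s ''rad'' v + half)"
    and stW: "2 * n + M + 10 \<le> W"
  shows "wp W local_phase (\<lambda>t s'. t \<le> n * (900 * M + 1000) + 10 \<and> local_inv s' \<and> regs s' ''v'' = n) s"
proof -
  let ?s0 = "s\<lparr>regs := (regs s)(''v'' := 0)\<rparr>"
  let ?call = "call_search (V ''v'') (V ''M'') (Read ''rad'' (V ''v''))"
  let ?P = "?call ;; ''v'' ::= Plus (V ''v'') (N 1)"
  have "base ?s0" using base by (simp add: base_update)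
  then have inv0: "local_inv ?s0" using st info hits unfolding local_inv_def by simp
  have "wp W (While (Less (V ''v'') (V ''n'')) ?P) (\<lambda>t s'. t \<le> n * (900 * M + 1000) + 5 \<and>
      local_inv s' \<and> regs s' ''v'' = n) ?s0"
  proof (rule wp_While[where I = local_inv and f = "\<lambda>s. (n - regs s ''v'') * (900 * M + 1000)"], goal_cases)
    case 1
    then show ?case by (rule inv0)
  next
    case (2 s')
    then show ?case using baseD(1)[of s'] W unfolding local_inv_def by auto
  next
    case (3 s')
    let ?v = "regs s' ''v''"
    note I = 3(1)[unfolded local_inv_def]
    have base': "base s'" using I by blast
    note bD = baseD[OF base']
    have v: "?v < n" using 3(2) bD(1) by simp
    have M0: "0 < M" "M < W" using S S_le_M W by auto
    have radW: "arrs s' ''rad'' ?v < W" using bD(4)[OF v] W by simp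
    have "wp W ?call (\<lambda>t s''. t \<le> 900 * (M + 1) + 20 \<and> base s'' \<and>
      regs s'' ''stamp'' = Suc (regs s' ''stamp'') \<and> regs s'' ''best'' \<le> regs s' ''best'' \<and>
      searched s' ?v M (arrs s' ''rad'' ?v) s'' \<and> frame (mod_regs ?call) (mod_arrs ?call) s' s'') s'"
      using v M0 radW bD I stW W by (intro call_search_wp[OF base']) (auto simp: frame_def)
    then show ?case
      unfolding wp_Seq
    proof (rule wp_mono, goal_cases)
      case (1 t s2)
      note fr = 1[THEN conjunct2, THEN conjunct2, THEN conjunct2, THEN conjunct2, THEN conjunct2]
      have s2: "t \<le> 900 * (M + 1) + 20" "base s2" "regs s2 ''stamp'' = Suc (regs s' ''stamp'')"
        "regs s2 ''best'' \<le> regs s' ''best''" and sd: "searched s' ?v M (arrs s' ''rad'' ?v) s2" using 1 by blast+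
      have eq: "regs s2 ''v'' = ?v" "arrs s2 ''rad'' = arrs s' ''rad''" "arrs s2 ''B'' = arrs s' ''B''"
        using frame_regs[OF fr] frame_arrs[OF fr] by (simp_all add: mod_regs_phases mod_arrs_phases mod_search)
      let ?s3 = "s2\<lparr>regs := (regs s2)(''v'' := Suc ?v)\<rparr>"
      have base3: "base ?s3" using s2(2) by (simp add: base_update)
      have "regs s2 ''best'' \<le> 2 * half"
        if "v \<in> set cs" "v < Suc ?v" "\<forall>c\<in>set cs. arrs s' ''rad'' v \<le> arrs s' ''rad'' c"
          "0 < r" "r < arrs s' ''rad'' v" "half \<le> (k - 1) * r" for v r
      proof (cases "v = ?v")
        case True
        show ?thesis
          by (rule searched_local[OF sd, of r]) (use that True I in auto)
      next
        case False
        then have "regs s' ''best'' \<le> 2 * half" using I that by auto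
        with s2(4) show ?thesis by simp
      qed
      moreover have "regs s2 ''best'' \<le> 2 * (arrs s' ''rad'' v + half)" if "v \<in> set cs" for v
        using I that s2(4) by (meson order_trans)
      ultimately have "local_inv ?s3"
        unfolding local_inv_def using base3 v s2(3) I by (simp add: eq)
      moreover have "n - ?v = Suc (n - Suc ?v)" using v by simp
      ultimately show ?case using s2(1) v W by (simp add: eq)
    qed
  next
    case (4 t s')
    then have "regs s' ''n'' = n" "regs s' ''v'' \<le> n" using baseD(1)[of s'] unfolding local_inv_def by auto
    with 4 show ?case by auto
  qed
  note loop = this
  show ?thesis
    unfolding local_phase_def using W by (simp del: One_nat_def) (rule wp_mono[OF loop], auto)
qed

lemma local_inv_best:
  assumes inv: "local_inv s" "regs s ''v'' = n" and r: "0 < r" "half \<le> (k - 1) * r"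
  shows "regs s ''best'' \<le> 2 * half + 2 * r"
proof -
  note I = inv(1)[unfolded local_inv_def]
  let ?rad = "arrs s ''rad''"
  have ne: "set cs \<noteq> {}" using cs unfolding vcycle_def by auto
  then have "Min (?rad ` set cs) \<in> ?rad ` set cs" by (intro Min_in) auto
  then obtain v where v: "v \<in> set cs" "?rad v = Min (?rad ` set cs)" by auto
  then have min: "?rad v \<le> ?rad c" if "c \<in> set cs" for c using that by simp
  show ?thesis
  proof (cases "?rad v \<le> r")
    case True
    moreover have "regs s ''best'' \<le> 2 * (?rad v + half)" using I v(1) by blast
    ultimately show ?thesis by simp
  next
    case False
    then have "regs s ''best'' \<le> 2 * half"
      using I v(1) min r inv(2) cs_less[OF v(1)] by (metis not_le)
    then show ?thesis by simp
  qed
qed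

lemma local_inv_output:
  assumes inv: "local_inv s" "regs s ''v'' = n" and r: "0 < r" "half \<le> (k - 1) * r" "r \<le> half"
  shows "vcycle (output_nodes s)" "length (output_nodes s) \<le> 2 * half + 2 * r"
proof -
  have best: "regs s ''best'' \<le> 2 * half + 2 * r" using local_inv_best[OF inv r(1,2)] .
  have "card (set cs) \<le> card {..<n}" using cs unfolding vcycle_def by (intro card_mono) auto
  then have "length cs \<le> n" using cs unfolding vcycle_def by (simp add: distinct_card)
  \<comment> \<open>The target is at most 2 n + 2 because \<open>r\<close> is at most
    \<open>half\<close>; being below the start value of \<open>best\<close>, it excludes the first
    case of \<open>best_ok\<close>.\<close>
  then have "2 * half + 2 * r < 4 * n + 4" using r(3) by linarith
  moreover have "best_ok s" using inv(1) unfolding local_inv_def base_def by blast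
  ultimately have "vcycle (output_nodes s)" "regs s ''len'' \<le> regs s ''best''" using best unfolding best_ok_def by auto
  with best show "vcycle (output_nodes s)" "length (output_nodes s) \<le> 2 * half + 2 * r"
    by (auto simp: output_nodes_def)
qed

end

section \<open>The complete program\<close>

text \<open>The exponent is fixed together with the program, so powers are unrolled into expressions
  of constant cost.\<close>

fun power_exp :: "aexp \<Rightarrow> nat \<Rightarrow> aexp" where
  "power_exp e 0 = N 1"
| "power_exp e (Suc m) = Times (power_exp e m) e"

lemma aval_power_exp [simp]: "aval (power_exp e m) s = aval e s ^ m"
  by (induction m) auto

lemma acost_power_exp [simp]: "acost (power_exp e m) = 1 + m * (acost e + 1)"
  by (induction m) auto

lemma afits_power_exp:
  "afits W e s \<Longrightarrow> 0 < aval e s \<Longrightarrow> aval e s ^ m < W \<Longrightarrow> afits W (power_exp e m) s"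
proof (induction m)
  case (Suc m)
  have "aval e s ^ m \<le> aval e s ^ Suc m" using Suc.prems(2) by simp
  with Suc show ?case by (simp add: mult.commute)
qed simp

definition log_loop :: com where
  "log_loop =
     ''p'' ::= N 1 ;; ''L'' ::= N 0 ;;
     While (Not (Less (V ''n'') (V ''p'')))
       (''p'' ::= Times (N 2) (V ''p'') ;; ''L'' ::= Plus (V ''L'') (N 1))"

definition size_loop :: "nat \<Rightarrow> com" where
  "size_loop k =
     ''s'' ::= N 1 ;;
     While (Less (power_exp (V ''s'') k) (Times (V ''n'') (V ''L'')))
       (''s'' ::= Plus (V ''s'') (N 1))"

definition setup_phase :: "nat \<Rightarrow> com" where
  "setup_phase k =
     log_loop ;; size_loop k ;;
     ''M'' ::= power_exp (V ''s'') (k - 1) ;;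
     ''best'' ::= Plus (Times (N 4) (V ''n'')) (N 4)"

definition girth_program :: "nat \<Rightarrow> com" where
  "girth_program k = setup_phase k ;; ball_phase ;; hit_phase ;; local_phase"

text \<open>An integer substitute for the logarithm, computable by repeated doubling. Base 2 is
  large enough for the decay since 2 \<le> e.\<close>

definition bit_length :: "nat \<Rightarrow> nat" where
  "bit_length n = (LEAST l. n < 2 ^ l)"

text \<open>The integer form of (n log n)^(1/k), rounded up: the least \<open>s\<close> for which
  \<open>s\<close> times \<open>s ^ (k - 1)\<close> makes the greedy choices succeed.\<close>

definition ball_size :: "nat \<Rightarrow> nat \<Rightarrow> nat" where
  "ball_size k n = (LEAST s. n * bit_length n \<le> s ^ k)"

definition search_limit :: "nat \<Rightarrow> nat \<Rightarrow> nat" where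
  "search_limit k n = ball_size k n ^ (k - 1)"

lemma bit_length: "n < 2 ^ bit_length n" "l < bit_length n \<Longrightarrow> 2 ^ l \<le> n"
  unfolding bit_length_def
  using LeastI[of "\<lambda>l. n < 2 ^ l" n] not_less_Least[of l "\<lambda>l. n < 2 ^ l"] less_exp[of n] by auto

lemma bit_length_eqI: "n < 2 ^ l \<Longrightarrow> (\<And>i. i < l \<Longrightarrow> 2 ^ i \<le> n) \<Longrightarrow> bit_length n = l"
  unfolding bit_length_def by (rule Least_equality) (auto simp: not_le[symmetric] dest: leD)

lemma bit_length_le: "bit_length n \<le> n"
  unfolding bit_length_def by (rule Least_le) (rule less_exp)

lemma bit_length_pos: "0 < n \<Longrightarrow> 0 < bit_length n"
  using bit_length(1)[of n] by (cases "bit_length n") auto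

text \<open>\<open>s = n\<close> satisfies the defining inequality because
  \<open>bit_length n\<close> is at most \<open>n\<close> and \<open>k\<close> is at least 2.
  Minimality supplies the upper bound on the running time.\<close>

lemma ball_size:
  assumes "2 \<le> k" "2 \<le> n"
  shows "n * bit_length n \<le> ball_size k n ^ k" "2 \<le> ball_size k n" "ball_size k n \<le> n"
    "r < ball_size k n \<Longrightarrow> r ^ k < n * bit_length n"
proof -
  have "n * bit_length n \<le> n ^ 2" using bit_length_le by (simp add: power2_eq_square)
  also have "\<dots> \<le> n ^ k" using assms by (intro power_increasing) auto
  finally have n: "n * bit_length n \<le> n ^ k" .
  show le: "n * bit_length n \<le> ball_size k n ^ k"
    unfolding ball_size_def using n by (rule LeastI)
  show "ball_size k n \<le> n" unfolding ball_size_def using n by (rule Least_le)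
  show "r < ball_size k n \<Longrightarrow> r ^ k < n * bit_length n"
    unfolding ball_size_def using not_less_Least by force
  have "2 * 1 \<le> n * bit_length n" using assms bit_length_pos[of n] by (intro mult_le_mono) auto
  with le have "2 \<le> ball_size k n ^ k" by simp
  moreover have "ball_size k n ^ k \<le> 1" if "ball_size k n \<le> 1" using power_mono[OF that, of k] by simp
  ultimately show "2 \<le> ball_size k n" by force
qed

lemma ball_size_eqI:
  assumes "n * bit_length n \<le> s ^ k" "\<And>r. r < s \<Longrightarrow> r ^ k < n * bit_length n"
  shows "ball_size k n = s"
  unfolding ball_size_def using assms by (intro Least_equality) (auto simp: not_less[symmetric])

lemma log_loop_wp:
  assumes n: "regs s ''n'' = n" "0 < n" and W: "4 * n + 10 \<le> W"
  shows "wp W log_loop (\<lambda>t s'. t \<le> 30 * n + 20 \<and> regs s' ''L'' = bit_length n) s"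
proof -
  let ?I = "\<lambda>s'. regs s' ''p'' = 2 ^ regs s' ''L'' \<and> regs s' ''p'' \<le> 2 * n \<and> (\<forall>l<regs s' ''L''. 2 ^ l \<le> n)"
  have W0: "0 < W" "1 < W" using W by simp_all
  show ?thesis
    unfolding log_loop_def
  proof (simp del: One_nat_def add: W0, rule wp_While[where I = ?I and f = "\<lambda>s'. 30 * (n - regs s' ''L'')"], goal_cases)
    case (2 s')
    have "regs s' ''n'' = n" using frame_regs[OF 2(2), of "''n''"] n by simp
    with 2 W show ?case by simp
  next
    case (3 s')
    have n': "regs s' ''n'' = n" using frame_regs[OF 3(3), of "''n''"] n by simp
    have le: "2 ^ regs s' ''L'' \<le> n" using 3(1,2) n' by simp
    then have L: "regs s' ''L'' < n" using less_le_trans[OF less_exp] by blast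
    show ?case using 3(1) le L W by (auto simp: less_Suc_eq)
  next
    case (4 t s')
    have n': "regs s' ''n'' = n" using frame_regs[OF 4(3), of "''n''"] n by simp
    have "bit_length n = regs s' ''L''" using 4(1,2) n' by (intro bit_length_eqI) auto
    with 4 show ?case by simp
  qed (use n in auto)
qed

text \<open>While the guard holds, \<open>s ^ k\<close> is below \<open>n ^ k\<close> and so
  \<open>s < n\<close>. A plain linear search thus stays within time O(n), which the product of
  \<open>n\<close> and the search limit absorbs.\<close>

lemma size_loop_wp:
  assumes n: "regs s ''n'' = n" "2 \<le> n" and L: "regs s ''L'' = bit_length n" and k: "2 \<le> k"
    and W: "n ^ k + 4 * n + 10 \<le> W"
  shows "wp W (size_loop k) (\<lambda>t s'. t \<le> (2 * k + 20) * n + 2 * k + 20 \<and> regs s' ''s'' = ball_size k n) s"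
proof -
  let ?N = "n * bit_length n"
  let ?I = "\<lambda>s'. 0 < regs s' ''s'' \<and> regs s' ''s'' \<le> n \<and> (\<forall>r<regs s' ''s''. r ^ k < ?N)"
  note bs = ball_size[OF k n(2)]
  have N: "?N \<le> n ^ k"
    using bs(1) power_mono[OF bs(3), of k] by simp
  have W0: "1 < W" using W by simp
  show ?thesis
    unfolding size_loop_def
  proof (simp del: One_nat_def add: W0, rule wp_While[where I = ?I and f = "\<lambda>s'. (2 * k + 20) * (n - regs s' ''s'')"], goal_cases)
    case 1
    show ?case using n bit_length_pos[of n] k by (simp add: zero_power)
  next
    case (2 s')
    have eq: "regs s' ''n'' = n" "regs s' ''L'' = bit_length n"
      using frame_regs[OF 2(2)] n L by simp_all
    have "regs s' ''s'' ^ k \<le> n ^ k" using 2(1) by (intro power_mono) auto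
    then have "afits W (power_exp (V ''s'') k) s'" using 2(1) W by (intro afits_power_exp) auto
    then show ?case using eq N W bit_length_le[of n] by simp
  next
    case (3 s')
    have eq: "regs s' ''n'' = n" "regs s' ''L'' = bit_length n"
      using frame_regs[OF 3(3)] n L by simp_all
    have "regs s' ''s'' ^ k < ?N" using 3(2) eq by simp
    then have "regs s' ''s'' ^ k < n ^ k" using N by simp
    then have less: "regs s' ''s'' < n" by (rule power_less_imp_less_base) simp
    then have "n - regs s' ''s'' = Suc (n - Suc (regs s' ''s''))" by simp
    then show ?case using 3(1,2) eq less W by (auto simp: less_Suc_eq)
  next
    case (4 t s')
    have eq: "regs s' ''n'' = n" "regs s' ''L'' = bit_length n"
      using frame_regs[OF 4(3)] n L by simp_all
    have "ball_size k n = regs s' ''s''" using 4(1,2) eq by (intro ball_size_eqI) auto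
    moreover have "t \<le> (2 * k + 20) * (n - 1) + 2 * k + 10" using 4(4) by simp
    then have "t \<le> (2 * k + 20) * n + 2 * k + 10"
      using mult_le_mono2[of "n - 1" n "2 * k + 20"] by linarith
    ultimately show ?case by simp
  qed
qed

lemma mod_setup:
  "mod_regs log_loop = {''p'', ''L''}" "mod_arrs log_loop = {}"
  "mod_regs (size_loop k) = {''s''}" "mod_arrs (size_loop k) = {}"
  "mod_arrs (setup_phase k) = {}"
  "mod_regs (setup_phase k) = {''p'', ''L'', ''s'', ''M'', ''best''}"
  unfolding setup_phase_def log_loop_def size_loop_def by auto

lemma setup_phase_wp:
  assumes n: "regs s ''n'' = n" "2 \<le> n" and k: "2 \<le> k" and W: "n ^ k + 4 * n + 10 \<le> W"
  shows "wp W (setup_phase k) (\<lambda>t s'. t \<le> (4 * k + 200) * n \<and> regs s' ''s'' = ball_size k n \<and>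
      regs s' ''M'' = search_limit k n \<and> regs s' ''best'' = 4 * n + 4) s"
  unfolding setup_phase_def wp_Seq[of _ log_loop] wp_Seq[of _ "size_loop k"]
proof (rule wp_frame[OF log_loop_wp[OF n(1)]], goal_cases)
  case (3 t1 s1)
  have n1: "regs s1 ''n'' = n" using frame_regs[OF 3(2), of "''n''"] n by (simp add: mod_setup)
  show ?case
  proof (rule wp_frame[OF size_loop_wp[OF n1 n(2) _ k W]], goal_cases)
    case 1
    then show ?case using 3(1) by simp
  next
    case (2 t2 s2)
    have n2: "regs s2 ''n'' = n" using frame_regs[OF 2(2), of "''n''"] n1 by (simp add: mod_setup)
    note bs = ball_size[OF k n(2)]
    have "ball_size k n ^ (k - 1) \<le> n ^ (k - 1)" by (intro power_mono bs) simp
    also have "\<dots> \<le> n ^ k" using n by (intro power_increasing) auto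
    finally have M: "ball_size k n ^ (k - 1) < W" using W by simp
    have fit: "afits W (power_exp (V ''s'') (k - 1)) s2"
      using 2(1) bs M W by (intro afits_power_exp) auto
    have "t1 \<le> 30 * n + 20" "t2 \<le> (2 * k + 20) * n + 2 * k + 20" using 3(1) 2(1) by blast+
    moreover have "(2 * k + 20) * n = 2 * (k * n) + 20 * n" "(4 * k + 200) * n = 4 * (k * n) + 200 * n"
      by (simp_all add: algebra_simps)
    moreover have "k * 2 \<le> k * n" using mult_le_mono2[OF n(2)] .
    ultimately have cost: "t1 + (t2 + (k * 2 + 30)) \<le> (4 * k + 200) * n" using n(2) by linarith
    show ?case using fit 2(1) n2 W M cost k by (auto simp: search_limit_def)
  qed
qed (use n W in auto)

context adjacency
begin

lemma input_state_stores_graph: "stores_graph (input_state adj)"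
  unfolding stores_graph_def input_state_def by (auto simp: offs_def adjs_def fun_eq_iff)

text \<open>(1 - S/n)^M \<le> exp(-S M/n), where S M = S^k is at least
  \<open>n * bit_length n\<close>; and n < 2^l \<le> e^l for l =
  \<open>bit_length n\<close>.\<close>

lemma decay_search_limit:
  assumes "2 \<le> k" "2 \<le> n"
  shows "real n * (1 - real (ball_size k n) / real n) ^ search_limit k n < 1"
proof -
  note bs = ball_size[OF assms]
  let ?S = "ball_size k n" and ?M = "search_limit k n"
  have n: "0 < real n" using assms by simp
  have "(1 - real ?S / real n) ^ ?M \<le> exp (- (real ?S / real n)) ^ ?M"
    using bs(3) n exp_ge_add_one_self[of "- (real ?S / real n)"]
    by (intro power_mono) (auto simp: divide_le_eq)
  also have "\<dots> = exp (- (real (?S * ?M) / real n))"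
    by (simp add: exp_of_nat_mult[symmetric] mult.commute)
  also have "?S * ?M = ?S ^ k"
    unfolding search_limit_def using assms(1) by (simp flip: power_Suc)
  also have "real n * real (bit_length n) \<le> real (?S ^ k)"
    using bs(1) by (metis of_nat_le_iff of_nat_mult)
  then have "exp (- (real (?S ^ k) / real n)) \<le> exp (- real (bit_length n))"
    using n by (simp add: field_simps)
  finally have "real n * (1 - real ?S / real n) ^ ?M \<le> real n * exp (- real (bit_length n))"
    using n by (intro mult_left_mono) auto
  also have "\<dots> < 1"
  proof -
    have "real n < 2 ^ bit_length n" using bit_length(1)[of n] by (metis of_nat_less_iff of_nat_numeral of_nat_power)
    also have "(2::real) ^ bit_length n \<le> exp 1 ^ bit_length n"
      using exp_ge_add_one_self[of 1] by (intro power_mono) auto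
    also have "\<dots> = exp (real (bit_length n))" by (simp add: exp_of_nat_mult[symmetric])
    finally show ?thesis by (simp add: exp_minus field_simps)
  qed
  finally show ?thesis .
qed

lemma total_time_le:
  fixes n S M k :: nat
  assumes "t1 \<le> (4 * k + 200) * n" "t2 \<le> n * (1000 * S + 1100) + 10"
    and "t3 \<le> 3000 * n * M + 100 * S * n + 100 * n + 20" "t4 \<le> n * (900 * M + 1000) + 10"
    and "S \<le> M" "1 \<le> M" "1 \<le> n"
  shows "t1 + (t2 + (t3 + t4)) \<le> (4 * k + 9000) * (n * M)"
proof -
  have "n * S \<le> n * M" "n * 1 \<le> n * M" "k * n * 1 \<le> k * n * M"
    using assms(5,6) by (simp_all only: mult_le_mono2)
  moreover have "(4 * k + 200) * n = 4 * (k * n) + 200 * n" "n * (1000 * S + 1100) = 1000 * (n * S) + 1100 * n"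
    "3000 * n * M = 3000 * (n * M)" "100 * S * n = 100 * (n * S)" "n * (900 * M + 1000) = 900 * (n * M) + 1000 * n"
    "(4 * k + 9000) * (n * M) = 4 * (k * n * M) + 9000 * (n * M)"
    by (simp_all add: algebra_simps)
  ultimately show ?thesis using assms(1-4,7) by linarith
qed

lemma girth_program_wp:
  assumes cs: "vcycle cs" and reach: "\<And>u. u < length adj \<Longrightarrow> \<exists>d. cs ! 0 \<in> ball (\<lambda>_. True) u d"
    and k: "2 \<le> k" and r: "0 < r" "(length cs + 1) div 2 \<le> (k - 1) * r" "r \<le> (length cs + 1) div 2"
  defines "n \<equiv> length adj"
  shows "wp (n ^ (k + 3)) (girth_program k) (\<lambda>t s. t \<le> (4 * k + 9000) * (n * search_limit k n) \<and>
      vcycle (output_nodes s) \<and> length (output_nodes s) \<le> 2 * ((length cs + 1) div 2) + 2 * r) (input_state adj)"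
proof -
  let ?S = "ball_size k n" and ?M = "search_limit k n" and ?W = "n ^ (k + 3)"
  have "card (set cs) \<le> card {..<n}" using cs unfolding vcycle_def n_def by (intro card_mono) auto
  then have n3: "3 \<le> n" using cs unfolding vcycle_def by (simp add: distinct_card)
  then have n2: "2 \<le> n" by simp
  note bs = ball_size[OF k n2]
  have nk: "n ^ 2 \<le> n ^ k" using n3 k by (intro power_increasing) auto
  have M: "?M \<le> n ^ k"
  proof -
    have "?M \<le> n ^ (k - 1)" unfolding search_limit_def by (intro power_mono bs) simp
    also have "\<dots> \<le> n ^ k" using n3 by (intro power_increasing) auto
    finally show ?thesis .
  qed
  \<comment> \<open>A cycle forces \<open>n\<close> to be at least 3, so the three extra factors of
    \<open>n\<close> in the word bound give a factor 27. It covers the quadratic tables, the stamps,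
    the powers and all additive constants.\<close>
  have "27 * n ^ k \<le> n ^ 3 * n ^ k" using power_mono[OF n3, of 3] by (intro mult_right_mono) auto
  then have W27: "27 * n ^ k \<le> ?W" by (simp add: power_add mult.commute)
  have "3 * n \<le> n * n" using n3 by simp
  then have n9: "n * n \<le> n ^ k" "3 * n \<le> n ^ k" "9 \<le> n ^ k" 
    using nk n3 \<open>3 * n \<le> n * n\<close> unfolding power2_eq_square by linarith+
  have W1: "n ^ k + 4 * n + 10 \<le> ?W" "2 * n + ?M + 10 \<le> ?W" using W27 n9 M by linarith+
  interpret girth_run adj cs k ?W ?S ?M
  proof
    show "n ^ (k + 3) \<ge> length adj * length adj + 10 * length adj + ?M + 20"
      using W27 n9 M unfolding n_def[symmetric] by linarith
    show "real (length adj) * (1 - real ?S / real (length adj)) ^ ?M < 1"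
      using decay_search_limit[OF k n2] unfolding n_def .
  qed (use cs reach k bs in \<open>auto simp: n_def search_limit_def\<close>)
  have stores: "stores_graph (input_state adj)" by (rule input_state_stores_graph)
  have reg_n: "regs (input_state adj) ''n'' = n" by (simp add: input_state_def n_def)
  have SM: "?S \<le> ?M" "1 \<le> ?M" using S_le_M bs(2) by auto
  show ?thesis
    unfolding girth_program_def wp_Seq
  proof (rule wp_frame[OF setup_phase_wp[OF reg_n n2 k W1(1)]], goal_cases)
    case (1 t1 s1)
    have arrs1: "arrs s1 = arrs (input_state adj)" using frame_arrs[OF 1(2)] by (simp add: mod_setup fun_eq_iff)
    have regs1: "regs s1 ''n'' = n" "regs s1 ''stamp'' = 0"
      using frame_regs[OF 1(2)] reg_n by (simp_all add: mod_setup input_state_def)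
    have zero: "arrs s1 ''rad'' = (\<lambda>_. 0)" "arrs s1 ''unc'' = (\<lambda>_. 0)" "arrs s1 ''mem'' = (\<lambda>_. 0)"
      "arrs s1 ''cnt'' = (\<lambda>_. 0)" "arrs s1 ''mark'' = (\<lambda>_. 0)"
      unfolding arrs1 input_state_def by (simp_all add: fun_eq_iff)
    have "0 < length adj" using n3 unfolding n_def by linarith
    then have base1: "base s1"
      using 1(1) stores regs1 n3 unfolding base_def stores_graph_def best_ok_def zero by (simp add: arrs1 n_def)
    show ?case
    proof (rule wp_mono[OF ball_phase_wp[OF base1 zero(1-4) regs1(2)]], goal_cases)
      case (1 t2 s2)
      note two = 1
      show ?case
      proof (rule wp_mono[OF hit_phase_wp], goal_cases)
        case (5 t3 s3)
        note three = 5
        show ?case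
        proof (rule wp_mono[OF local_phase_wp], goal_cases)
          case (6 t4 s4)
          have "local_inv s4" "regs s4 ''v'' = length adj" using 6 by blast+
          note out = local_inv_output[OF this r]
          have "t1 + (t2 + (t3 + t4)) \<le> (4 * k + 9000) * (n * ?M)"
            by (rule total_time_le) (use \<open>t1 \<le> (4 * k + 200) * n \<and> _\<close> two three 6 SM n3 in \<open>simp_all add: n_def\<close>)
          with out show ?case by simp
        qed (use three W1 in \<open>auto simp: n_def\<close>)
      qed (use two in \<open>auto simp: n_def\<close>)
    qed
  qed
qed

end

section \<open>Asymptotics\<close>

text \<open>All digits but one are bounded by n \<ge> 2^l, where ln 2 \<ge> 1/2 because e \<le> 4;
  the remaining digit is absorbed by ln n \<ge> 1, which needs n \<ge> 3.\<close>

lemma bit_length_le_ln: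
  assumes "3 \<le> n"
  shows "real (bit_length n) \<le> 3 * ln (real n)"
proof -
  obtain l where l: "bit_length n = Suc l" using bit_length_pos[of n] assms by (cases "bit_length n") auto
  then have "2 ^ l \<le> n" using bit_length(2)[of l n] by simp
  then have "(2::real) ^ l \<le> real n" by (metis of_nat_le_iff of_nat_numeral of_nat_power)
  then have "ln ((2::real) ^ l) \<le> ln (real n)" using assms by (subst ln_le_cancel_iff) auto
  then have "real l * ln 2 \<le> ln (real n)" by (simp add: ln_realpow)
  moreover have "real l * (1 / 2) \<le> real l * ln 2"
  proof (intro mult_left_mono)
    have "1 \<le> ln ((2::real) ^ 2)" using exp_le by (subst ln_ge_iff) auto
    then show "1 / 2 \<le> ln (2::real)" by (subst (asm) ln_realpow) auto
  qed simp
  moreover have "1 \<le> ln (real n)" using exp_le assms by (subst ln_ge_iff) auto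
  ultimately show ?thesis using l by simp
qed

text \<open>Minimality bounds \<open>ball_size k n - 1\<close> by the k-th root of
  \<open>n * bit_length n\<close>; doubling removes the -1 since the size is at least 2. Raising to
  the power \<open>k - 1\<close> gives the exponent 1 - 1/k of both factors.\<close>

lemma search_limit_bigo:
  assumes k: "2 \<le> k"
  shows "(\<lambda>n. real (C * (n * search_limit k n))) \<in>
    O(\<lambda>n. real n powr (2 - 1 / real k) * ln (real n) powr (1 - 1 / real k))"
proof (rule bigoI)
  let ?e = "1 - 1 / real k"
  have ke: "real (k - 1) / real k = ?e" using k by (simp add: of_nat_diff field_simps)
  show "\<forall>\<^sub>F n in sequentially. norm (real (C * (n * search_limit k n))) \<le>
      (real C * 2 ^ (k - 1) * 3 powr ?e) * norm (real n powr (2 - 1 / real k) * ln (real n) powr ?e)"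
  proof (rule eventually_mono[OF eventually_ge_at_top[of 3]])
    fix n :: nat assume n: "3 \<le> n"
    note bs = ball_size[OF k, of n]
    let ?S = "ball_size k n" and ?N = "real n * real (bit_length n)"
    have S2: "2 \<le> ?S" using bs(2) n by simp
    have N0: "0 < ?N" using n bit_length_pos[of n] by simp
    have "(?S - 1) ^ k < n * bit_length n" using bs(4)[of "?S - 1"] n S2 by simp
    then have "real (?S - 1) ^ k \<le> ?N" by (metis less_imp_le of_nat_le_iff of_nat_mult of_nat_power)
    then have "(real (?S - 1) ^ k) powr (1 / real k) \<le> ?N powr (1 / real k)" by (intro powr_mono2) auto
    moreover have "(real (?S - 1) ^ k) powr (1 / real k) = real (?S - 1)"
      using S2 k by (simp add: powr_realpow[symmetric] powr_powr)
    ultimately have "real ?S \<le> 2 * ?N powr (1 / real k)" using S2 by simp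
    then have "real ?S ^ (k - 1) \<le> (2 * ?N powr (1 / real k)) ^ (k - 1)" by (intro power_mono) auto
    also have "\<dots> = 2 ^ (k - 1) * ?N powr ?e"
    proof -
      have "0 < ?N powr (1 / real k)" using n bit_length_pos[of n] by simp
      from powr_realpow[OF this, of "k - 1"] have "(?N powr (1 / real k)) ^ (k - 1) = ?N powr ?e"
        unfolding powr_powr using ke by simp
      then show ?thesis by (simp only: power_mult_distrib)
    qed
    also have "\<dots> \<le> 2 ^ (k - 1) * (real n * (3 * ln (real n))) powr ?e"
      using bit_length_le_ln[OF n] n N0 k by (intro mult_left_mono powr_mono2) auto
    also have "\<dots> = 2 ^ (k - 1) * 3 powr ?e * (real n powr ?e * ln (real n) powr ?e)"
      using n by (simp add: powr_mult)
    finally have "real (search_limit k n) \<le> 2 ^ (k - 1) * 3 powr ?e * (real n powr ?e * ln (real n) powr ?e)"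
      unfolding search_limit_def by simp
    then have "real C * (real n * real (search_limit k n)) \<le>
        real C * (real n * (2 ^ (k - 1) * 3 powr ?e * (real n powr ?e * ln (real n) powr ?e)))"
      by (intro mult_left_mono) auto
    also have "\<dots> = real C * 2 ^ (k - 1) * 3 powr ?e * ((real n powr 1 * real n powr ?e) * ln (real n) powr ?e)"
      using n by simp
    also have "real n powr 1 * real n powr ?e = real n powr (2 - 1 / real k)"
      by (subst powr_add[symmetric]) simp
    finally show "norm (real (C * (n * search_limit k n))) \<le>
      (real C * 2 ^ (k - 1) * 3 powr ?e) * norm (real n powr (2 - 1 / real k) * ln (real n) powr ?e)"
      by simp
  qed
qed

section \<open>Cycles of the library\<close>

lemma adjacency_lists_adjacency:
  assumes "pair_graph G" "adjacency_lists G adj"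
  shows "adjacency adj"
proof
  interpret pair_graph G by fact
  have V: "pverts G = {..<length adj}" and A: "\<And>v. v < length adj \<Longrightarrow> distinct (adj ! v) \<and> set (adj ! v) = {w. (v, w) \<in> parcs G}"
    using assms(2) unfolding adjacency_lists_def by blast+
  show "distinct (adj ! v)" if "v < length adj" for v using A that by blast
  show "v < length adj \<and> u \<in> set (adj ! v)" if "u < length adj" "v \<in> set (adj ! u)" for u v
  proof -
    have uv: "(u, v) \<in> parcs G" using A that by blast
    then have "v < length adj" using in_arcsD2 V by blast
    moreover have "(v, u) \<in> parcs G" using uv pair_sym_arcs unfolding symmetric_def sym_def by (auto simp: arcs_ends_conv)
    ultimately show ?thesis using A by blast
  qed
  show "u \<notin> set (adj ! u)" if "u < length adj" for u
    using A[OF that] pair_no_loops by fastforce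
qed

lemma pcas_step: "pcas u p v \<Longrightarrow> Suc i < length p \<Longrightarrow> fst (p ! Suc i) = snd (p ! i)"
proof (induction p arbitrary: u i)
  case (Cons e es)
  show ?case
  proof (cases i)
    case 0
    then show ?thesis using Cons.prems by (cases es) auto
  next
    case (Suc j)
    then show ?thesis using Cons.IH[of "snd e" j] Cons.prems by simp
  qed
qed simp

lemma pcas_last: "pcas u p v \<Longrightarrow> p \<noteq> [] \<Longrightarrow> snd (last p) = v"
proof (induction p arbitrary: u)
  case (Cons e es)
  then show ?case by (cases "es = []") auto
qed simp

lemma pcas_zip: "pcas u (zip (u # us) (us @ [w])) w"
  by (induction us arbitrary: u) auto

context adjacency
begin

text \<open>The closed walk starts at the first vertex of \<open>cs\<close>. Its vertex sequence
  without the first entry is a rotation of \<open>cs\<close>, so distinctness carries over.\<close>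

lemma vcycle_undirected_cycle:
  assumes G: "pair_graph G" "adjacency_lists G adj" and cs: "vcycle cs"
  shows "undirected_cycle G (closed_arcs cs)"
proof -
  interpret pair_graph G by fact
  have V: "pverts G = {..<length adj}" and A: "\<And>v. v < length adj \<Longrightarrow> set (adj ! v) = {w. (v, w) \<in> parcs G}"
    using G(2) unfolding adjacency_lists_def by blast+
  let ?p = "closed_arcs cs"
  have len: "3 \<le> length cs" "distinct cs" "set cs \<subseteq> {..<length adj}" using cs unfolding vcycle_def by auto
  then obtain u us where us: "cs = u # us" by (cases cs) auto
  have p: "?p = zip (u # us) (us @ [u])" unfolding closed_arcs_def us by simp
  have "set ?p \<subseteq> parcs G"
  proof
    fix e assume "e \<in> set ?p"
    then obtain i where i: "i < length cs" "e = (cs ! i, cs ! (Suc i mod length cs))"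
      unfolding closed_arcs_def by (auto simp: set_zip nth_rotate1)
    have "cs ! i < length adj" using len(3) i(1) nth_mem by blast
    with A cs i show "e \<in> parcs G" unfolding vcycle_def by blast
  qed
  moreover have "pcas u ?p u" unfolding p by (rule pcas_zip)
  moreover have "u \<in> pverts G" using len(3) V us by simp
  ultimately have "awalk u ?p u" unfolding awalk_def by simp
  moreover have "map fst ?p = u # us" unfolding p by simp
  moreover have "map snd ?p = us @ [u]" unfolding p by simp
  then have "tl (awalk_verts u ?p) = us @ [u]"
    using awalk_verts_conv'[of u ?p u] \<open>pcas u ?p u\<close> p by (auto split: if_splits)
  ultimately show ?thesis
    using len us unfolding undirected_cycle_def cycle_def by (auto simp: closed_arcs_def)
qed

text \<open>The vertices are read off as the heads of the arcs, because the library demands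
  distinctness of the vertex sequence without its first entry, which is exactly
  \<open>map snd p\<close>.\<close>

lemma undirected_cycle_vcycle:
  assumes G: "pair_graph G" "adjacency_lists G adj" and p: "undirected_cycle G p"
  shows "\<exists>cs. vcycle cs \<and> length cs = length p"
proof -
  interpret pair_graph G by fact
  have V: "pverts G = {..<length adj}" and A: "\<And>v. v < length adj \<Longrightarrow> set (adj ! v) = {w. (v, w) \<in> parcs G}"
    using G(2) unfolding adjacency_lists_def by blast+
  obtain u where u: "awalk u p u" "distinct (tl (awalk_verts u p))" and len: "3 \<le> length p"
    using p unfolding undirected_cycle_def cycle_def by blast
  have cas: "pcas u p u" and sub: "set p \<subseteq> parcs G" using u(1) unfolding awalk_def by auto
  have "p \<noteq> []" using len by auto
  have "tl (awalk_verts u p) = map snd p"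
    using awalk_verts_conv'[of u p u] cas \<open>p \<noteq> []\<close> by simp
  then have dist: "distinct (map snd p)" using u(2) by simp
  note step = pcas_step[OF cas]
  have first: "fst (p ! 0) = u" using cas \<open>p \<noteq> []\<close> by (cases p) auto
  have last: "snd (p ! (length p - 1)) = u" using pcas_last[OF cas \<open>p \<noteq> []\<close>] \<open>p \<noteq> []\<close> by (simp add: last_conv_nth)
  have nxt: "snd (p ! (Suc i mod length p)) \<in> set (adj ! snd (p ! i))" "snd (p ! i) < length adj"
    if i: "i < length p" for i
  proof -
    let ?j = "Suc i mod length p"
    have j: "?j < length p" using i by (intro mod_less_divisor) linarith
    have "fst (p ! ?j) = snd (p ! i)"
    proof (cases "Suc i = length p")
      case True
      then have "i = length p - 1" "?j = 0" by auto
      then show ?thesis using first last by simp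
    next
      case False
      then show ?thesis using step[of i] i by simp
    qed
    then have arc: "(snd (p ! i), snd (p ! ?j)) \<in> parcs G"
      using sub nth_mem[OF j] by (metis prod.collapse subsetD)
    then show "snd (p ! i) < length adj" using in_arcsD1 V by blast
    with arc A show "snd (p ! ?j) \<in> set (adj ! snd (p ! i))" by blast
  qed
  have "vcycle (map snd p)"
    unfolding vcycle_def
  proof (intro conjI allI impI)
    show "set (map snd p) \<subseteq> {..<length adj}"
    proof
      fix v assume "v \<in> set (map snd p)"
      then obtain i where "i < length (map snd p)" "map snd p ! i = v" using in_set_conv_nth by metis
      then show "v \<in> {..<length adj}" using nxt(2)[of i] by simp
    qed
    fix i assume "i < length (map snd p)"
    then have i: "i < length p" by simp
    moreover have "Suc i mod length p < length p" using i by (intro mod_less_divisor) linarith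
    ultimately show "map snd p ! (Suc i mod length (map snd p)) \<in> set (adj ! (map snd p ! i))"
      using nxt(1)[OF i] by simp
  qed (use len dist in auto)
  then show ?thesis by (intro exI[of _ "map snd p"]) simp
qed

text \<open>Connectedness ignores orientation; symmetry of the arcs turns it into directed
  reachability, along which balls grow one step at a time.\<close>

lemma connected_reach:
  assumes G: "pair_graph G" "adjacency_lists G adj" and con: "Digraph_Component.connected (with_proj G)"
    and uv: "u < length adj" "v < length adj"
  shows "\<exists>d. v \<in> ball (\<lambda>_. True) u d"
proof -
  interpret pair_graph G by fact
  have V: "pverts G = {..<length adj}" and A: "\<And>v. v < length adj \<Longrightarrow> set (adj ! v) = {w. (v, w) \<in> parcs G}"
    using G(2) unfolding adjacency_lists_def by blast+
  have "strongly_connected (with_proj G)"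
    using symmetric_connected_imp_strongly_connected[OF _ con] pair_sym_arcs by simp
  then have "u \<rightarrow>\<^sup>*\<^bsub>with_proj G\<^esub> v" using uv V unfolding strongly_connected_def by auto
  then show ?thesis
  proof (induction rule: reachable_induct)
    case base
    then show ?case using self_in_ball by blast
  next
    case (step x y)
    then obtain d where d: "x \<in> ball (\<lambda>_. True) u d" by blast
    have "(x, y) \<in> parcs G" using step(2) by (simp add: arcs_ends_conv)
    then have "y \<in> set (adj ! x)" using A in_arcsD1 V by blast
    then show ?case using ball_step[OF d] by blast
  qed
qed

end

theorem theorem1:
  fixes k :: nat
  assumes "k \<ge> 2"
  shows "\<exists>(P :: com) (c :: nat) (T :: nat \<Rightarrow> nat).
    (\<lambda>n. real (T n)) \<in> O(\<lambda>n. real n powr (2 - 1 / real k) * ln (real n) powr (1 - 1 / real k)) \<and>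
    (\<forall>(G :: nat pair_pre_digraph) adj n g.
       pair_graph G \<and> Digraph_Component.connected (with_proj G) \<and> (\<exists>p. undirected_cycle G p) \<and>
       adjacency_lists G adj \<and> n = card (pverts G) \<and> g = girth G \<longrightarrow>
       (\<exists>t s. exec (n ^ c) P (input_state adj) t s \<and> t \<le> T n \<and>
          undirected_cycle G (closed_arcs (output_nodes s)) \<and>
          int (length (output_nodes s)) \<le>
            2 * \<lceil>real g / 2\<rceil> + 2 * \<lceil>real g / (2 * (real k - 1))\<rceil>))"
proof (rule exI[of _ "girth_program k"], rule exI[of _ "k + 3"],
    rule exI[of _ "\<lambda>n. (4 * k + 9000) * (n * search_limit k n)"], intro conjI allI impI)
  show "(\<lambda>n. real ((4 * k + 9000) * (n * search_limit k n))) \<in>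
      O(\<lambda>n. real n powr (2 - 1 / real k) * ln (real n) powr (1 - 1 / real k))"
    using assms by (rule search_limit_bigo)
next
  fix G :: "nat pair_pre_digraph" and adj n g
  assume asm: "pair_graph G \<and> Digraph_Component.connected (with_proj G) \<and> (\<exists>p. undirected_cycle G p) \<and>
       adjacency_lists G adj \<and> n = card (pverts G) \<and> g = girth G"
  then have G: "pair_graph G" "adjacency_lists G adj" and con: "Digraph_Component.connected (with_proj G)"
    and ex: "\<exists>p. undirected_cycle G p" by blast+
  have n: "n = length adj" using asm unfolding adjacency_lists_def by simp
  interpret adjacency adj using adjacency_lists_adjacency[OF G] .
  have "\<exists>l p. undirected_cycle G p \<and> length p = l" using ex by blast
  then have "\<exists>p. undirected_cycle G p \<and> length p = girth G" unfolding girth_def by (rule LeastI_ex)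
  then obtain p where "undirected_cycle G p" "length p = g" using asm by blast
  then obtain cs where cs: "vcycle cs" "length cs = g" using undirected_cycle_vcycle[OF G] by metis
  have g3: "3 \<le> g" using cs unfolding vcycle_def by simp
  have "cs ! 0 \<in> set cs" using g3 cs(2) by (intro nth_mem) linarith
  then have "cs ! 0 < length adj" using cs(1) unfolding vcycle_def by blast
  then have reach: "\<exists>d. cs ! 0 \<in> ball (\<lambda>_. True) u d" if "u < length adj" for u
    using connected_reach[OF G con that] by blast
  define r where "r = nat \<lceil>real g / (2 * (real k - 1))\<rceil>"
  have k1: "1 \<le> real k - 1" using assms by simp
  have pos: "0 < real g / (2 * (real k - 1))" using g3 k1 by simp
  then have ri: "int r = \<lceil>real g / (2 * (real k - 1))\<rceil>" unfolding r_def by simp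
  have half: "int ((g + 1) div 2) = \<lceil>real g / 2\<rceil>" by linarith
  have r0: "0 < r" using pos unfolding r_def by simp
  have "real g / (2 * (real k - 1)) \<le> real r" using ri by linarith
  then have "real g / 2 \<le> (real k - 1) * real r" using k1 by (simp add: field_simps)
  also have "\<dots> = real ((k - 1) * r)" using assms by (simp add: of_nat_diff)
  finally have r1: "(g + 1) div 2 \<le> (k - 1) * r" by linarith
  \<comment> \<open>The bound k - 1 \<ge> 1 yields \<open>r\<close> at most half the girth, rounded
    up; this keeps the target length below the initial value of \<open>best\<close>.\<close>
  have "real g / (2 * (real k - 1)) \<le> real g / 2" using k1 g3 by (intro divide_left_mono) auto
  then have r2: "r \<le> (g + 1) div 2" using ri half ceiling_mono by (metis of_nat_le_iff)
  have "wp (n ^ (k + 3)) (girth_program k) (\<lambda>t s. t \<le> (4 * k + 9000) * (n * search_limit k n) \<and>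
      vcycle (output_nodes s) \<and> length (output_nodes s) \<le> 2 * ((g + 1) div 2) + 2 * r) (input_state adj)"
    unfolding n cs(2)[symmetric]
    by (rule girth_program_wp[OF cs(1)]) (use reach assms r0 r1 r2 cs(2) in auto)
  then obtain t s where run: "exec (n ^ (k + 3)) (girth_program k) (input_state adj) t s"
    "t \<le> (4 * k + 9000) * (n * search_limit k n)" "vcycle (output_nodes s)"
    "length (output_nodes s) \<le> 2 * ((g + 1) div 2) + 2 * r"
    unfolding wp_def by blast
  have "int (length (output_nodes s)) \<le> 2 * \<lceil>real g / 2\<rceil> + 2 * \<lceil>real g / (2 * (real k - 1))\<rceil>"
    using run(4) half ri by linarith
  with run vcycle_undirected_cycle[OF G run(3)]
  show "\<exists>t s. exec (n ^ (k + 3)) (girth_program k) (input_state adj) t s \<and>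
      t \<le> (4 * k + 9000) * (n * search_limit k n) \<and>
      undirected_cycle G (closed_arcs (output_nodes s)) \<and>
      int (length (output_nodes s)) \<le> 2 * \<lceil>real g / 2\<rceil> + 2 * \<lceil>real g / (2 * (real k - 1))\<rceil>"
    by blast
qed

end
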